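(* Let $u>0$ and $R\in\{0,1,2,\dots\}$. Put $$\alpha_R(u)=\sqrt\pi\,e^{-\frac14\pi u+\frac14(1-R)\pi i}\,2^{\frac32R+\frac14+\frac14iu}\,\Gamma\left(\tfrac12-\tfrac12iu\right)\mathbf F\left(\tfrac12-\tfrac12R,-\tfrac12R;\tfrac34-\tfrac12R-\tfrac14iu;\tfrac12\right),\qquad c_3(u)=\frac{\sqrt{2\pi}\,e^{\pi i/4}e^{-\pi u/4}}{\Gamma\left(\frac12-\frac12iu\right)}.$$ Then $$W_R^{(0,3)}\left(-\tfrac12u,\sqrt{2u}z\right)=(-1)^RW_R^{(0,3)}\left(-\tfrac12u,-\sqrt{2u}z\right)+\left\{(-1)^{R+1}-ie^{-\pi u/2}\right\}\alpha_R(u)W_0\left(-\tfrac12u,-\sqrt{2u}z\right)+\alpha_R(u)c_3(u)W_3\left(-\tfrac12u,-\sqrt{2u}z\right),$$ and equivalently $$W_R^{(0,3)}\left(-\tfrac12u,\sqrt{2u}z\right)=(-1)^RW_R^{(0,3)}\left(-\tfrac12u,-\sqrt{2u}z\right)+\left\{(-1)^{R+1}-ie^{-\pi u/2}\right\}\alpha_R(u)W_0\left(-\tfrac12u,-\sqrt{2u}z\right)+\left\{(-1)^{R+1}+ie^{-\pi u/2}\right\}\overline{\alpha_R(u)}\,W_3\left(-\tfrac12u,-\sqrt{2u}z\right),$$ where $\overline{\alpha_R(u)}$ is the complex conjugate of $\alpha_R(u)$.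
   Context: $U(a,z)$ is the parabolic cylinder function: the solution of $y''-(\tfrac14z^2+a)y=0$ with $U(a,z)\sim z^{-a-1/2}e^{-z^2/4}$ as $z\to\infty$, $|\arg z|\le\frac34\pi-\delta$. $W_j(a,z)=U((-1)^jia,(-i)^jze^{-\pi i/4})$, and for $a>0$ $$W_R^{(0,3)}(-a,z)=ie^{-\pi a/2}\left[W_3(-a,z)\int_{e^{\pi i/4}\infty}^zt^RW_0(-a,t)dt-W_0(-a,z)\int_{e^{-\pi i/4}\infty}^zt^RW_3(-a,t)dt\right],$$ a particular solution of $y''+(\frac14z^2+a)y=z^R$. $\mathbf{F}(a,b;c;z)=\sum_{s\ge0}\frac{(a)_s(b)_sz^s}{\Gamma(c+s)s!}$. *)

theory Defs
  imports "HOL-Complex_Analysis.Complex_Analysis" "HOL-Library.Landau_Symbols"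
begin

text \<open>
  Complex powers use the principal branch; since \<^const>\<open>Arg\<close> takes values in
  \<open>]-\<pi>, \<pi>]\<close>, this is the branch meant by the sector \<open>|arg z| \<le> 3\<pi>/4 - \<delta>\<close>.
\<close>

definition is_parabolic_cylinder_U :: "complex \<Rightarrow> (complex \<Rightarrow> complex) \<Rightarrow> bool" where
  "is_parabolic_cylinder_U a y \<longleftrightarrow>
     y holomorphic_on UNIV \<and>
     (\<forall>z. (deriv ^^ 2) y z - (z\<^sup>2 / 4 + a) * y z = 0) \<and>
     (\<forall>\<delta>>0. y \<sim>[inf at_infinity (principal {z. \<bar>Arg z\<bar> \<le> 3 / 4 * pi - \<delta>})]
        (\<lambda>z. z powr (- a - 1 / 2) * exp (- (z\<^sup>2 / 4))))"

definition parabolic_cylinder_U :: "complex \<Rightarrow> complex \<Rightarrow> complex" where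
  "parabolic_cylinder_U a = (THE y. is_parabolic_cylinder_U a y)"

definition W :: "nat \<Rightarrow> complex \<Rightarrow> complex \<Rightarrow> complex" where
  "W j a z = parabolic_cylinder_U ((-1) ^ j * \<i> * a) ((- \<i>) ^ j * z * exp (- (pi * \<i> / 4)))"

text \<open>
  The integral of an entire function from \<open>w \<infinity>\<close> to \<open>z\<close>, that is, the limit for \<open>r \<rightarrow> \<infinity>\<close> of the
  integral from \<open>r w\<close> to \<open>z\<close> (which does not depend on the path).
\<close>

definition integral_from_infinity ::
    "complex \<Rightarrow> complex \<Rightarrow> (complex \<Rightarrow> complex) \<Rightarrow> complex" where
  "integral_from_infinity w z f =
     Lim at_top (\<lambda>r::real. contour_integral (linepath (of_real r * w) z) f)"

text \<open>
  The first parameter \<open>b\<close> is the whole parameter slot of \<open>W\<^sub>R\<^sup>(\<^sup>0\<^sup>,\<^sup>3\<^sup>)(-a, z)\<close>, that is, \<open>b = -a\<close>;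
  hence the prefactor \<open>\<i> exp (-\<pi> a/2)\<close> reads \<open>\<i> exp (\<pi> b/2)\<close>.
\<close>

definition WR03 :: "nat \<Rightarrow> real \<Rightarrow> complex \<Rightarrow> complex" where
  "WR03 R b z = \<i> * exp (of_real (pi * b / 2)) *
     (W 3 (of_real b) z *
        integral_from_infinity (exp (pi * \<i> / 4)) z (\<lambda>t. t ^ R * W 0 (of_real b) t)
    - W 0 (of_real b) z *
        integral_from_infinity (exp (- (pi * \<i> / 4))) z (\<lambda>t. t ^ R * W 3 (of_real b) t))"

definition regularized_hyp2F1 :: "complex \<Rightarrow> complex \<Rightarrow> complex \<Rightarrow> complex \<Rightarrow> complex" where
  "regularized_hyp2F1 a b c z =
     (\<Sum>s. pochhammer a s * pochhammer b s * z ^ s * rGamma (c + of_nat s) / fact s)"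

definition alpha :: "nat \<Rightarrow> real \<Rightarrow> complex" where
  "alpha R u = of_real (sqrt pi) *
     exp (- (1 / 4) * pi * u + 1 / 4 * (1 - of_nat R) * pi * \<i>) *
     2 powr (3 / 2 * of_nat R + 1 / 4 + 1 / 4 * \<i> * u) *
     Gamma (1 / 2 - 1 / 2 * \<i> * u) *
     regularized_hyp2F1 (1 / 2 - 1 / 2 * of_nat R) (- (1 / 2) * of_nat R)
       (3 / 4 - 1 / 2 * of_nat R - 1 / 4 * \<i> * u) (1 / 2)"

definition c3 :: "real \<Rightarrow> complex" where
  "c3 u = of_real (sqrt (2 * pi)) * exp (pi * \<i> / 4) * exp (- (of_real (pi * u / 4))) /
     Gamma (1 / 2 - 1 / 2 * \<i> * u)"

end

theory Submission
  imports Defs "HOL-Real_Asymp.Real_Asymp"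
begin

text \<open>
  For \<open>Re a > -1/2\<close> the function
  \<open>U(a,z) = exp(-z\<^sup>2/4) / \<Gamma>(a+1/2) * \<integral>\<^sub>0\<^sup>\<infinity> s powr (a-1/2) * exp(-s\<^sup>2/2 - z s) ds\<close> solves the equation. Rotating
  the ray of integration by up to \<open>\<pi>/4\<close> gives the asymptotics in the full sector, and a Wronskian that
  vanishes at \<open>+\<infinity>\<close> gives uniqueness.

  Let \<open>\<epsilon> = exp(-\<pi> u/2)\<close>. The values at \<open>0\<close> give \<open>c\<^sub>3 W\<^sub>3(z) = W\<^sub>0(-z) + \<i> \<epsilon> W\<^sub>0(z)\<close>. Splitting each integral
  from infinity at \<open>0\<close> and using this relation, everything cancels except the moments \<open>I\<^sub>0(R), I\<^sub>3(R)\<close>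
  of \<open>t\<^sup>R W\<^sub>0, t\<^sup>R W\<^sub>3\<close> along the rays, and the theorem becomes
  \<open>c\<^sub>3 \<alpha>\<^sub>R = \<i> exp(-\<pi> u/4) ((\<i> \<epsilon> - (-1)\<^sup>R) I\<^sub>0(R) - c\<^sub>3 I\<^sub>3(R))\<close>. Both sides satisfy
  \<open>x(R+2) = -2 u x(R) - 4 R (R-1) x(R-2)\<close>: the right-hand side by the differential equation (the
  boundary terms cancel), the left-hand side by the hypergeometric equation at \<open>1/2\<close>. For \<open>R = 0, 1\<close> the
  two moments are the halves over \<open>(1,\<infinity>)\<close> and \<open>(0,1)\<close> of one Beta integral. The recursion is real,
  so the formula for the complex conjugate of \<open>\<alpha>\<^sub>R\<close> also only needs to be checked for \<open>R = 0, 1\<close>.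
\<close>

section \<open>Laplace and Gaussian integrals with complex parameters\<close>

text \<open>Both parameters that occur, iu/2 and -iu/2, have real part 0, so the Laplace integral is
  available for \<open>W 0\<close> and \<open>W 3\<close> alike. No contour is deformed: the
  integral is expanded in powers of z, and turning the ray, differentiating and integrating by parts
  become identities between Gamma coefficients. The definition of U controls y only, whereas the
  Wronskian also involves y'; Cauchy's estimate supplies that.

  The moments are never evaluated one by one, since each contains an incomplete Beta integral.
  Multiplied by W_0'(0) for R = 0, or by W_0(0) for R = 1, the combination with c_3 becomes one in
  which both incomplete integrals carry the same Gamma factor, so that they add up to a complete
  one. Two starting values are needed because the recursion steps by 2 and its last term vanishes
  for R = 0 and R = 1.

  In the final computation everything is multiplied by the nonzero c_3, which replaces W_3 by W_0(z)
  and W_0(-z); what remains is polynomial algebra.\<close>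

lemma absolutely_integrable_continuous_bound:
  fixes f :: "real \<Rightarrow> 'a::euclidean_space"
  assumes "continuous_on S f" "S \<in> sets borel" "g integrable_on S" "\<And>x. x \<in> S \<Longrightarrow> norm (f x) \<le> g x"
  shows "f absolutely_integrable_on S"
  by (rule measurable_bounded_by_integrable_imp_absolutely_integrable[OF _ _ assms(3,4)])
     (use assms(1,2) in \<open>auto intro!: continuous_imp_measurable_on_sets_lebesgue\<close>)

lemma continuous_on_of_real_powr [continuous_intros]:
  assumes "S \<subseteq> {0<..}"
  shows "continuous_on S (\<lambda>x::real. complex_of_real x powr b)"
  by (rule continuous_intros)+ (use assms in \<open>auto simp: complex_nonpos_Reals_iff\<close>)

lemma integrable_powr_exp:
  fixes \<beta> k :: real
  assumes "\<beta> > 0" "k > 0"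
  shows "(\<lambda>s. s powr (\<beta> - 1) * exp (- (k * s))) integrable_on {0<..}"
proof -
  have "(\<lambda>t. norm (complex_of_real t powr (of_real \<beta> - 1) / of_real (exp (k * t)))) integrable_on {0<..}"
    using absolutely_integrable_Gamma_integral[of "of_real \<beta>" k] assms
    by (simp add: absolutely_integrable_on_def)
  then show ?thesis
    by (rule integrable_eq)
       (auto simp: norm_divide norm_powr_real_powr exp_minus field_simps)
qed

lemma integrable_powr_gauss:
  fixes \<beta> k m :: real
  assumes "\<beta> > 0" "k > 0"
  shows "(\<lambda>s. s powr (\<beta> - 1) * exp (m * s - k * s\<^sup>2)) integrable_on {0<..}"
proof -
  have "(\<lambda>s. s powr (\<beta> - 1) * exp (m * s - k * s\<^sup>2)) absolutely_integrable_on {0<..}"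
  proof (rule absolutely_integrable_continuous_bound)
    show "(\<lambda>s. exp ((m + 1)\<^sup>2 / (4 * k)) * (s powr (\<beta> - 1) * exp (- (1 * s)))) integrable_on {0<..}"
      by (rule integrable_on_mult_right) (rule integrable_powr_exp, use assms in auto)
    show "norm (s powr (\<beta> - 1) * exp (m * s - k * s\<^sup>2))
            \<le> exp ((m + 1)\<^sup>2 / (4 * k)) * (s powr (\<beta> - 1) * exp (- (1 * s)))" for s
    proof -
      \<comment> \<open>Completing the square gives m s - k s^2 <= (m+1)^2/(4k) - s; the spare unit
        in the linear term leaves the integrable factor exp(-s).\<close>
      have "0 \<le> (2 * k * s - (m + 1))\<^sup>2 / (4 * k)"
        using assms by simp
      also have "\<dots> = (m + 1)\<^sup>2 / (4 * k) - s - (m * s - k * s\<^sup>2)"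
        using assms by (simp add: field_simps power2_eq_square)
      finally have "exp (m * s - k * s\<^sup>2) \<le> exp ((m + 1)\<^sup>2 / (4 * k) - s)"
        by simp
      also have "\<dots> = exp ((m + 1)\<^sup>2 / (4 * k)) * exp (- (1 * s))"
        by (simp flip: exp_add)
      finally show ?thesis
        by (simp add: abs_mult mult_left_mono mult.left_commute)
    qed
  qed (auto intro!: continuous_intros)
  then show ?thesis
    using absolutely_integrable_on_def by blast
qed

text \<open>Dominated convergence: every partial sum of the exponential series is bounded in norm by
  exp(|z| s). It serves twice, to pass from real to complex \<zeta> in
  \<open>integral_Laplace\<close> and to turn \<open>gauss_laplace\<close> into a power
  series.\<close>

lemma exp_series_integral:
  fixes g :: "real \<Rightarrow> complex" and z :: complex
  assumes cont: "continuous_on {0<..} g"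
    and dom: "(\<lambda>s. norm (g s) * exp (norm z * s)) integrable_on {0<..}"
    and int: "\<And>n. (\<lambda>s. of_real s ^ n * g s) integrable_on {0<..}"
  shows "(\<lambda>n. z ^ n / fact n * integral {0<..} (\<lambda>s. of_real s ^ n * g s)) sums
           integral {0<..} (\<lambda>s. exp (z * of_real s) * g s)"
proof -
  define f where "f = (\<lambda>N (s::real). (\<Sum>n<N. z ^ n / fact n * (of_real s ^ n * g s)))"
  have f_int: "(f N has_integral (\<Sum>n<N. z ^ n / fact n * integral {0<..} (\<lambda>s. of_real s ^ n * g s))) {0<..}"
    for N
    unfolding f_def by (intro has_integral_sum has_integral_mult_right integrable_integral int) auto
  have f_eq: "f N s = (\<Sum>n<N. (z * of_real s) ^ n /\<^sub>R fact n) * g s" for N s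
    unfolding f_def sum_distrib_right
    by (simp add: scaleR_conv_of_real power_mult_distrib field_simps)
  have "(\<lambda>N. integral {0<..} (f N)) \<longlonglongrightarrow> integral {0<..} (\<lambda>s. exp (z * of_real s) * g s)"
  proof (rule dominated_convergence(2)[OF _ dom])
    show "f N integrable_on {0<..}" for N
      by (rule has_integral_integrable[OF f_int])
    show "norm (f N s) \<le> norm (g s) * exp (norm z * s)" if "s \<in> {0<..}" for N s
    proof -
      have "norm (\<Sum>n<N. (z * of_real s) ^ n /\<^sub>R fact n) \<le> (\<Sum>n<N. (norm z * s) ^ n /\<^sub>R fact n)"
        by (rule sum_norm_le) (use that in \<open>simp add: norm_mult norm_power\<close>)
      also have "\<dots> \<le> exp (norm z * s)"
        unfolding exp_def
        using that by (intro sum_le_suminf summable_exp_generic) auto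
      finally show ?thesis
        by (simp add: f_eq norm_mult mult.commute mult_left_mono)
    qed
    show "(\<lambda>N. f N s) \<longlonglongrightarrow> exp (z * of_real s) * g s" for s
      unfolding f_eq using exp_converges[of "z * of_real s"]
      by (intro tendsto_mult tendsto_const) (simp add: sums_def)
  qed
  then show ?thesis
    unfolding sums_def by (simp only: integral_unique[OF f_int])
qed

lemma norm_of_real_powr: "x > 0 \<Longrightarrow> norm (complex_of_real x powr b) = x powr Re b"
  by (simp add: norm_powr_real_powr)

lemma of_real_powr_nat_add:
  assumes "x > 0"
  shows "complex_of_real x powr (b + of_nat n) = of_real x powr b * of_real x ^ n"
  using assms by (simp add: powr_add powr_nat)

lemma absolutely_integrable_Laplace:
  assumes "Re b > 0" "Re \<zeta> > 0"
  shows "(\<lambda>s. of_real s powr (b - 1) * exp (- (\<zeta> * of_real s))) absolutely_integrable_on {0<..}"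
  by (rule absolutely_integrable_continuous_bound[OF _ _ integrable_powr_exp[OF assms]])
     (auto intro!: continuous_intros simp: norm_mult norm_of_real_powr)

lemma integral_Laplace_real:
  assumes "Re b > 0" "r > 0"
  shows "integral {0<..} (\<lambda>s. of_real s powr (b - 1) * exp (- (of_real r * of_real s)))
           = Gamma b * of_real r powr (- b)"
proof -
  define f where "f = (\<lambda>t. of_real t powr (b - 1) / complex_of_real (exp t))"
  have img: "(\<lambda>s. r * s) ` {0<..} = {0<..}"
  proof (intro set_eqI iffI)
    fix x :: real assume "x \<in> {0<..}"
    then show "x \<in> (\<lambda>s. r * s) ` {0<..}"
      using assms by (intro image_eqI[of _ _ "x / r"]) auto
  qed (use assms in auto)
  have "f absolutely_integrable_on ((\<lambda>s. r * s) ` {0<..}) \<and> integral ((\<lambda>s. r * s) ` {0<..}) f = Gamma b"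
    unfolding img f_def
    using absolutely_integrable_Gamma_integral'[OF assms(1)] Gamma_integral_complex'[OF assms(1)]
    by (auto simp: integral_unique)
  then have "integral {0<..} (\<lambda>s. \<bar>r\<bar> *\<^sub>R f (r * s)) = Gamma b"
    by (subst (asm) has_absolute_integral_change_of_variables_real[symmetric, where h = "\<lambda>_. r"])
       (use assms in \<open>auto intro!: derivative_eq_intros inj_onI\<close>)
  also have "integral {0<..} (\<lambda>s. \<bar>r\<bar> *\<^sub>R f (r * s)) =
     integral {0<..} (\<lambda>s. of_real r powr b * (of_real s powr (b - 1) * exp (- (of_real r * of_real s))))"
  proof (rule integral_cong)
    fix s :: real assume "s \<in> {0<..}"
    then show "\<bar>r\<bar> *\<^sub>R f (r * s) = of_real r powr b * (of_real s powr (b - 1) * exp (- (of_real r * of_real s)))"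
      using assms powr_times_real[of "of_real r" "of_real s" b]
      by (simp add: f_def scaleR_conv_of_real powr_diff exp_minus field_simps flip: exp_of_real)
  qed
  finally show ?thesis
    using assms by (simp add: powr_minus field_simps)
qed

text \<open>Analytic continuation by hand. With \<zeta> = r - z, r > 0 and |z| < r, expand exp(z s)
  against the integral for the real number r; termwise this is the binomial series of (1 -
  z/r)^(-b).\<close>

lemma integral_Laplace:
  assumes "Re b > 0" "Re \<zeta> > 0"
  shows "integral {0<..} (\<lambda>s. of_real s powr (b - 1) * exp (- (\<zeta> * of_real s))) = Gamma b * \<zeta> powr (- b)"
proof -
  \<comment> \<open>Every point of the right half-plane lies in the disc of radius r about r once r
    is large; for this r, |r - \<zeta>|^2 = r^2 - |\<zeta>|^2.\<close>
  define r where "r = (norm \<zeta>)\<^sup>2 / Re \<zeta>"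
  have r: "r > 0"
    unfolding r_def using assms by (intro divide_pos_pos zero_less_power) auto
  have "(norm (of_real r - \<zeta>))\<^sup>2 = r\<^sup>2 - 2 * r * Re \<zeta> + (norm \<zeta>)\<^sup>2"
    by (simp add: cmod_power2) (simp add: power2_eq_square algebra_simps)
  also have "\<dots> = r\<^sup>2 - (norm \<zeta>)\<^sup>2"
    using assms by (simp add: r_def)
  also have "\<dots> < r\<^sup>2"
    using assms by auto
  finally have less: "norm (of_real r - \<zeta>) < r"
    using r power2_less_imp_less by (metis less_eq_real_def)
  define z where "z = of_real r - \<zeta>"
  define g where "g = (\<lambda>s::real. of_real s powr (b - 1) * exp (- (complex_of_real r * of_real s)))"
  have g_eq: "of_real s ^ n * g s = of_real s powr (b + of_nat n - 1) * exp (- (complex_of_real r * of_real s))"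
    if "s > 0" for n s
    using of_real_powr_nat_add[OF that, of "b - 1" n] by (simp add: g_def algebra_simps)
  have g_int: "integral {0<..} (\<lambda>s. of_real s ^ n * g s) = Gamma (b + of_nat n) * of_real r powr (- (b + of_nat n))" for n
  proof -
    have "integral {0<..} (\<lambda>s. of_real s ^ n * g s)
        = integral {0<..} (\<lambda>s. of_real s powr (b + of_nat n - 1) * exp (- (complex_of_real r * of_real s)))"
      by (rule integral_cong) (use g_eq in auto)
    also have "\<dots> = Gamma (b + of_nat n) * of_real r powr (- (b + of_nat n))"
      by (rule integral_Laplace_real) (use assms r in auto)
    finally show ?thesis .
  qed
  have sums1: "(\<lambda>n. z ^ n / fact n * integral {0<..} (\<lambda>s. of_real s ^ n * g s)) sums
           integral {0<..} (\<lambda>s. exp (z * of_real s) * g s)"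
  proof (rule exp_series_integral)
    show "continuous_on {0<..} g"
      unfolding g_def by (auto intro!: continuous_intros)
    have "(\<lambda>s. s powr (Re b - 1) * exp (- ((r - norm z) * s))) integrable_on {0<..}"
      by (rule integrable_powr_exp) (use assms less in \<open>auto simp: z_def\<close>)
    then show "(\<lambda>s. norm (g s) * exp (norm z * s)) integrable_on {0<..}"
      by (rule integrable_eq)
         (auto simp: g_def norm_mult norm_of_real_powr algebra_simps simp flip: exp_add)
    show "(\<lambda>s. of_real s ^ n * g s) integrable_on {0<..}" for n
    proof -
      have "(\<lambda>s. of_real s powr (b + of_nat n - 1) * exp (- (complex_of_real r * of_real s))) integrable_on {0<..}"
        using absolutely_integrable_Laplace[of "b + of_nat n" "of_real r"] assms r
        by (auto simp: absolutely_integrable_on_def)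
      then show ?thesis
        by (rule integrable_eq) (use g_eq in auto)
    qed
  qed
  have "(\<lambda>n. Gamma b * of_real r powr (- b) * ((- b gchoose n) * (- (z / of_real r)) ^ n)) sums
          (Gamma b * of_real r powr (- b) * (1 + (- (z / of_real r))) powr (- b))"
    by (intro sums_mult gen_binomial_complex) (use less r in \<open>auto simp: z_def norm_divide\<close>)
  \<comment> \<open>Gamma(b+n) is (b)_n Gamma(b), and (b)_n / n! is the binomial coefficient of -b
    over n up to the sign (-1)^n.\<close>
  moreover have "Gamma b * of_real r powr (- b) * ((- b gchoose n) * (- (z / of_real r)) ^ n) =
       z ^ n / fact n * integral {0<..} (\<lambda>s. of_real s ^ n * g s)" for n
  proof -
    have nz: "b \<notin> \<int>\<^sub>\<le>\<^sub>0"
      using assms(1) by (auto elim!: nonpos_Ints_cases)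
    have "Gamma (b + of_nat n) = pochhammer b n * Gamma b"
      using pochhammer_Gamma[OF nz, of n] nz by (simp add: Gamma_eq_zero_iff)
    moreover have "complex_of_real r powr (- (b + of_nat n)) = of_real r powr (- b) / of_real r ^ n"
      using r by (simp add: powr_diff powr_nat)
    ultimately show ?thesis
      unfolding g_int using r by (simp add: gbinomial_pochhammer power_divide power_minus'[of "z / of_real r"] 
          field_simps flip: power_mult_distrib)
  qed
  ultimately have "integral {0<..} (\<lambda>s. exp (z * of_real s) * g s) =
      Gamma b * (of_real r powr (- b) * (1 + (- (z / of_real r))) powr (- b))"
    using sums1 sums_unique2 by fastforce
  also have "1 + (- (z / of_real r)) = \<zeta> / of_real r"
    using r by (simp add: z_def field_simps)
  \<comment> \<open>Dividing by r > 0 leaves the argument unchanged, so the principal powers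
    multiply.\<close>
  also have "of_real r powr (- b) * (\<zeta> / of_real r) powr (- b) = \<zeta> powr (- b)"
  proof -
    have "\<zeta> \<noteq> 0"
      using assms by auto
    then show ?thesis
      using r by (simp add: powr_def Ln_divide_of_real Ln_of_real algebra_simps flip: exp_add)
  qed
  also have "integral {0<..} (\<lambda>s. exp (z * of_real s) * g s) =
      integral {0<..} (\<lambda>s. of_real s powr (b - 1) * exp (- (\<zeta> * of_real s)))"
    by (rule integral_cong) (simp add: g_def z_def algebra_simps mult_exp_exp)
  finally show ?thesis .
qed

section \<open>Gaussian integrals and their Laplace transforms\<close>

lemma image_mult_Ioi: "r > 0 \<Longrightarrow> (\<lambda>s::real. r * s) ` {0<..} = {0<..}"
  by (auto intro!: image_eqI[of _ _ "_ / r"])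

lemma image_square_Ioi: "(\<lambda>s::real. s\<^sup>2) ` {0<..} = {0<..}"
  by (auto intro!: image_eqI[of _ _ "sqrt _"])

lemma of_real_square_powr:
  assumes "s > 0"
  shows "complex_of_real (s\<^sup>2) powr b = of_real s powr (2 * b)"
proof -
  have "ln (s\<^sup>2) = 2 * ln s"
    using assms by (simp add: ln_realpow)
  then show ?thesis
    using assms by (simp add: powr_def Ln_of_real mult_ac del: of_real_power)
qed

lemma integral_Gauss:
  assumes "Re b > 0" "Re c > 0"
  shows "integral {0<..} (\<lambda>s. of_real s powr (b - 1) * exp (- (c * of_real s ^ 2)))
           = Gamma (b / 2) / 2 * c powr (- (b / 2))"
proof -
  define f where "f = (\<lambda>s. complex_of_real s powr (b / 2 - 1) * exp (- (c * of_real s)))"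
  have "f absolutely_integrable_on ((\<lambda>s. s\<^sup>2) ` {0<..}) \<and>
        integral ((\<lambda>s. s\<^sup>2) ` {0<..}) f = Gamma (b / 2) * c powr (- (b / 2))"
    unfolding image_square_Ioi f_def
    using absolutely_integrable_Laplace[of "b / 2" c] integral_Laplace[of "b / 2" c] assms by auto
  then have "integral {0<..} (\<lambda>s. \<bar>2 * s\<bar> *\<^sub>R f (s\<^sup>2)) = Gamma (b / 2) * c powr (- (b / 2))"
    by (subst (asm) has_absolute_integral_change_of_variables_real[symmetric, where h = "\<lambda>s. 2 * s"])
       (auto intro!: derivative_eq_intros inj_onI simp: power2_eq_iff)
  also have "integral {0<..} (\<lambda>s. \<bar>2 * s\<bar> *\<^sub>R f (s\<^sup>2)) =
     integral {0<..} (\<lambda>s. 2 * (of_real s powr (b - 1) * exp (- (c * of_real s ^ 2))))"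
  proof (rule integral_cong)
    fix s :: real assume "s \<in> {0<..}"
    then have "complex_of_real (s\<^sup>2) powr (b / 2 - 1) * of_real s = of_real s powr (b - 1)"
      using of_real_square_powr[of s "b / 2 - 1"] of_real_powr_nat_add[of s "b - 2" 1]
      by (simp add: algebra_simps)
    then show "\<bar>2 * s\<bar> *\<^sub>R f (s\<^sup>2) = 2 * (of_real s powr (b - 1) * exp (- (c * of_real s ^ 2)))"
      using \<open>s \<in> {0<..}\<close> by (simp add: f_def scaleR_conv_of_real mult_ac)
  qed
  finally show ?thesis
    by (simp add: mult.commute)
qed

text \<open>The case c = 1/2 represents U. Other c with positive real part are needed because
  turning the ray by \<theta> changes the Gaussian coefficient 1/2 into cis(2 \<theta>)/2.\<close>

definition gauss_laplace :: "complex \<Rightarrow> complex \<Rightarrow> complex \<Rightarrow> complex" where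
  "gauss_laplace b c z = integral {0<..} (\<lambda>s. of_real s powr (b - 1) * exp (- (c * of_real s ^ 2) - z * of_real s))"

lemma absolutely_integrable_gauss_laplace:
  assumes "Re b > 0" "Re c > 0"
  shows "(\<lambda>s. of_real s powr (b - 1) * exp (- (c * of_real s ^ 2) - z * of_real s)) absolutely_integrable_on {0<..}"
proof (rule absolutely_integrable_continuous_bound[OF _ _ integrable_powr_gauss[OF assms, of "norm z"]])
  show "norm (of_real s powr (b - 1) * exp (- (c * of_real s ^ 2) - z * of_real s)) \<le>
          s powr (Re b - 1) * exp (norm z * s - Re c * s\<^sup>2)" if "s \<in> {0<..}" for s
  proof -
    have "- (Re z * s) \<le> norm z * s"
      using that abs_Re_le_cmod[of z] mult_right_mono[of "- Re z" "norm z" s] by simp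
    then show ?thesis
      using that by (simp add: norm_mult norm_of_real_powr mult_left_mono flip: of_real_power)
  qed
qed (auto intro!: continuous_intros)

text \<open>The value of \<open>gauss_laplace b c\<close> at 0 in closed form. Shifted in b, these
  are its Taylor coefficients up to (-1)^n/n!.\<close>

definition gauss_moment :: "complex \<Rightarrow> complex \<Rightarrow> complex" where
  "gauss_moment c b = Gamma (b / 2) / 2 * c powr (- (b / 2))"

text \<open>This power series takes over from the integral: the derivative, the three-term
  recurrence and the rotation below are read off from its coefficients, without differentiating
  under the integral or moving a contour.\<close>

lemma gauss_laplace_sums:
  assumes "Re b > 0" "Re c > 0"
  shows "(\<lambda>n. ((-1) ^ n / fact n * gauss_moment c (b + of_nat n)) * z ^ n) sums gauss_laplace b c z"
proof -
  define g where "g = (\<lambda>s::real. of_real s powr (b - 1) * exp (- (c * of_real s ^ 2)))"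
  have g_eq: "of_real s ^ n * g s = of_real s powr (b + of_nat n - 1) * exp (- (c * of_real s ^ 2))"
    if "s > 0" for n s
    using of_real_powr_nat_add[OF that, of "b - 1" n] by (simp add: g_def algebra_simps)
  have g_int: "integral {0<..} (\<lambda>s. of_real s ^ n * g s) = gauss_moment c (b + of_nat n)" for n
  proof -
    have "integral {0<..} (\<lambda>s. of_real s ^ n * g s)
        = integral {0<..} (\<lambda>s. of_real s powr (b + of_nat n - 1) * exp (- (c * of_real s ^ 2)))"
      by (rule integral_cong) (use g_eq in auto)
    also have "\<dots> = gauss_moment c (b + of_nat n)"
      unfolding gauss_moment_def by (rule integral_Gauss) (use assms in auto)
    finally show ?thesis .
  qed
  have "(\<lambda>n. (- z) ^ n / fact n * integral {0<..} (\<lambda>s. of_real s ^ n * g s)) sums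
           integral {0<..} (\<lambda>s. exp (- z * of_real s) * g s)"
  proof (rule exp_series_integral)
    show "continuous_on {0<..} g"
      unfolding g_def by (auto intro!: continuous_intros)
    show "(\<lambda>s. norm (g s) * exp (norm (- z) * s)) integrable_on {0<..}"
      by (rule integrable_eq[OF integrable_powr_gauss[OF assms, of "norm z"]])
         (auto simp: g_def norm_mult norm_of_real_powr algebra_simps simp flip: exp_add of_real_power)
    show "(\<lambda>s. of_real s ^ n * g s) integrable_on {0<..}" for n
      by (rule integrable_eq[of "\<lambda>s. of_real s powr (b + of_nat n - 1) * exp (- (c * of_real s ^ 2))"])
         (use g_eq absolutely_integrable_gauss_laplace[of "b + of_nat n" c 0] assms
           in \<open>auto simp: absolutely_integrable_on_def\<close>)
  qed
  moreover have "integral {0<..} (\<lambda>s. exp (- z * of_real s) * g s) = gauss_laplace b c z"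
    unfolding gauss_laplace_def
    by (rule integral_cong) (simp add: g_def exp_diff exp_minus field_simps)
  ultimately show ?thesis
    unfolding g_int by (simp add: power_minus[of z] mult_ac)
qed

lemma gauss_laplace_has_field_derivative:
  assumes "Re b > 0" "Re c > 0"
  shows "(gauss_laplace b c has_field_derivative - gauss_laplace (b + 1) c z) (at z)"
proof -
  define k where "k = (\<lambda>n. (-1) ^ n / fact n * gauss_moment c (b + of_nat n))"
  have k: "(\<lambda>n. k n * y ^ n) sums gauss_laplace b c y" for y
    using gauss_laplace_sums[OF assms] by (simp add: k_def)
  have "((\<lambda>x. \<Sum>n. k n * x ^ n) has_field_derivative (\<Sum>n. diffs k n * z ^ n)) (at z)"
    by (rule termdiffs_strong_converges_everywhere) (use k in \<open>auto simp: sums_iff\<close>)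
  moreover have "(\<lambda>x. \<Sum>n. k n * x ^ n) = gauss_laplace b c"
    using k by (auto simp: sums_iff)
  moreover have "diffs k n = - ((-1) ^ n / fact n * gauss_moment c (b + 1 + of_nat n))" for n
    by (simp add: diffs_def k_def add_ac del: of_nat_Suc) (simp add: field_simps)
  moreover have "(\<lambda>n. - ((-1) ^ n / fact n * gauss_moment c (b + 1 + of_nat n)) * z ^ n) sums - gauss_laplace (b + 1) c z"
    using sums_minus[OF gauss_laplace_sums[of "b + 1" c z]] assms by simp
  ultimately show ?thesis
    by (simp add: sums_iff)
qed

lemma gauss_moment_add_2:
  assumes "Re b > 0" "c \<noteq> 0"
  shows "2 * c * gauss_moment c (b + 2) = b * gauss_moment c b"
proof -
  have "b / 2 \<notin> \<int>\<^sub>\<le>\<^sub>0"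
    using assms by (auto elim!: nonpos_Ints_cases)
  then have "Gamma (b / 2 + 1) = b / 2 * Gamma (b / 2)"
    by (rule Gamma_plus1)
  moreover have "c powr (- (b / 2) - 1) = c powr (- (b / 2)) / c"
    using assms by (simp add: powr_diff)
  ultimately show ?thesis
    using assms by (simp add: gauss_moment_def add_divide_distrib)
qed

text \<open>For the integral this is integration by parts, with s^b times the exponential vanishing
  at both ends. On coefficients it is \<open>gauss_moment_add_2\<close>, that is, Gamma(x+1) = x
  Gamma(x).\<close>

lemma gauss_laplace_recurrence:
  assumes "Re b > 0" "Re c > 0"
  shows "2 * c * gauss_laplace (b + 2) c z + z * gauss_laplace (b + 1) c z = b * gauss_laplace b c z"
proof -
  \<comment> \<open>\<open>t\<close> is the series of z times the b+1 integral with the index moved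
    up by one; its term at 0 vanishes, so the sum is unaffected.\<close>
  define t where "t = (\<lambda>n. - of_nat n * ((-1) ^ n / fact n * gauss_moment c (b + of_nat n) * z ^ n))"
  have "(\<lambda>n. t (Suc n)) sums (z * gauss_laplace (b + 1) c z)"
  proof -
    have "t (Suc n) = z * ((-1) ^ n / fact n * gauss_moment c (b + 1 + of_nat n) * z ^ n)" for n
      by (simp add: t_def add_ac del: of_nat_Suc) (simp add: field_simps)
    then show ?thesis
      using sums_mult[OF gauss_laplace_sums[of "b + 1" c z], of z] assms by simp
  qed
  then have t: "t sums (z * gauss_laplace (b + 1) c z)"
    by (subst (asm) sums_Suc_iff) (simp add: t_def)
  have "(\<lambda>n. 2 * c * ((-1) ^ n / fact n * gauss_moment c (b + 2 + of_nat n) * z ^ n) + t n) sums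
      (2 * c * gauss_laplace (b + 2) c z + z * gauss_laplace (b + 1) c z)"
    by (intro sums_add sums_mult gauss_laplace_sums t) (use assms in auto)
  also have "(\<lambda>n. 2 * c * ((-1) ^ n / fact n * gauss_moment c (b + 2 + of_nat n) * z ^ n) + t n) =
      (\<lambda>n. b * ((-1) ^ n / fact n * gauss_moment c (b + of_nat n) * z ^ n))"
  proof
    fix n
    have "2 * c * gauss_moment c (b + 2 + of_nat n) = (b + of_nat n) * gauss_moment c (b + of_nat n)"
    proof -
      have "Re (b + of_nat n) > 0" "c \<noteq> 0" "b + 2 + of_nat n = b + of_nat n + 2"
        using assms by auto
      then show ?thesis
        using gauss_moment_add_2[of "b + of_nat n" c] by metis
    qed
    then have "2 * c * ((-1) ^ n / fact n * gauss_moment c (b + 2 + of_nat n) * z ^ n) = 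
       (-1) ^ n / fact n * ((b + of_nat n) * gauss_moment c (b + of_nat n)) * z ^ n"
      by (simp add: mult_ac)
    then show "2 * c * ((-1) ^ n / fact n * gauss_moment c (b + 2 + of_nat n) * z ^ n) + t n =
      b * ((-1) ^ n / fact n * gauss_moment c (b + of_nat n) * z ^ n)"
      by (simp add: t_def algebra_simps)
  qed
  finally show ?thesis
    using sums_unique2[OF _ sums_mult[OF gauss_laplace_sums[OF assms], of b z]] by simp
qed

text \<open>The substitution of s cis \<theta> for s, that is, turning the ray. It holds
  coefficientwise because \<open>gauss_moment\<close> at 1/2 and at cis(2 \<theta>)/2 differ by the
  factor \<open>cis \<theta> powr \<beta>\<close>; |\<theta>| < pi/4 keeps the real part of the new
  coefficient positive.\<close>

lemma gauss_laplace_rotate: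
  assumes "Re b > 0" "\<bar>\<theta>\<bar> < pi / 4"
  shows "gauss_laplace b (1 / 2) z = cis \<theta> powr b * gauss_laplace b (cis (2 * \<theta>) / 2) (z * cis \<theta>)"
proof -
  define c where "c = cis (2 * \<theta>) / 2"
  have Re_c: "Re c > 0"
    using assms by (auto simp: c_def intro!: cos_gt_zero_pi)
  have Ln_cis: "Ln (cis \<theta>) = \<i> * of_real \<theta>" "Ln (cis (2 * \<theta>)) = \<i> * of_real (2 * \<theta>)"
    using assms by (auto simp: cis_conv_exp intro!: Ln_exp)
  have pw: "(1 / 2) powr (- (\<beta> / 2)) = cis \<theta> powr \<beta> * c powr (- (\<beta> / 2))" for \<beta> :: complex
  proof -
    have "Ln c = 2 * \<i> * of_real \<theta> - of_real (ln 2)"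
      using Ln_divide_of_real[of 2 "cis (2 * \<theta>)"] by (simp add: c_def Ln_cis)
    moreover have "c \<noteq> 0"
      using Re_c by auto
    ultimately have c_powr: "c powr (- (\<beta> / 2)) = exp (- (\<beta> / 2) * (2 * \<i> * of_real \<theta> - of_real (ln 2)))"
      by (simp only: powr_def if_False)
    have "Ln (1 / 2) = - complex_of_real (ln 2)"
      using Ln_of_real[of "1 / 2"] by (simp add: ln_div)
    then have "(1 / 2) powr (- (\<beta> / 2)) = exp (- (\<beta> / 2) * (- complex_of_real (ln 2)))"
      by (simp only: powr_def) simp
    also have "- (\<beta> / 2) * (- complex_of_real (ln 2)) =
        \<beta> * (\<i> * of_real \<theta>) + - (\<beta> / 2) * (2 * \<i> * of_real \<theta> - of_real (ln 2))"
      by (simp add: algebra_simps)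
    also have "exp \<dots> = cis \<theta> powr \<beta> * c powr (- (\<beta> / 2))"
      by (simp only: c_powr exp_add) (simp add: powr_def Ln_cis)
    finally show ?thesis .
  qed
  have "(\<lambda>n. cis \<theta> powr b * (((-1) ^ n / fact n * gauss_moment c (b + of_nat n)) * (z * cis \<theta>) ^ n))
          sums (cis \<theta> powr b * gauss_laplace b c (z * cis \<theta>))"
    by (intro sums_mult gauss_laplace_sums assms Re_c)
  also have "(\<lambda>n. cis \<theta> powr b * (((-1) ^ n / fact n * gauss_moment c (b + of_nat n)) * (z * cis \<theta>) ^ n)) =
      (\<lambda>n. ((-1) ^ n / fact n * gauss_moment (1 / 2) (b + of_nat n)) * z ^ n)"
    unfolding gauss_moment_def pw
    by (simp add: powr_add powr_nat power_mult_distrib mult_ac)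
  finally show ?thesis
    using sums_unique2[OF gauss_laplace_sums[of b "1 / 2" z]] assms(1) by (simp add: c_def)
qed

lemma norm_exp_minus_1_le:
  fixes w :: complex
  assumes "Re w \<ge> 0"
  shows "norm (exp (- w) - 1) \<le> norm w"
proof -
  have "norm (exp (- w) - exp (- 0)) \<le> 1 * norm (w - 0)"
  proof (rule field_differentiable_bound)
    show "convex {w::complex. Re w \<ge> 0}"
      by (rule convex_halfspace_Re_ge)
    show "((\<lambda>w. exp (- w)) has_field_derivative - exp (- w)) (at w within {w. Re w \<ge> 0})" for w :: complex
      by (auto intro!: derivative_eq_intros)
  qed (use assms in auto)
  then show ?thesis
    by simp
qed

text \<open>Watson's lemma with one term: replacing exp(-c s^2) by 1 costs at most |c| s^2, because
  exp(-w) has a derivative of norm at most 1 on the right half-plane. What remains is a real Laplace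
  integral with exponent Re b + 2.\<close>

lemma gauss_laplace_bound:
  assumes b: "Re b > 0" and c: "Re c > 0" and \<epsilon>: "\<epsilon> > 0" and \<zeta>: "Re \<zeta> \<ge> \<epsilon> * norm \<zeta>" "\<zeta> \<noteq> 0"
  shows "norm (gauss_laplace b c \<zeta> - Gamma b * \<zeta> powr (- b)) \<le>
           norm c * Gamma (Re b + 2) * (\<epsilon> * norm \<zeta>) powr (- (Re b + 2))"
proof -
  define k where "k = \<epsilon> * norm \<zeta>"
  have k: "k > 0"
    using \<epsilon> \<zeta> by (simp add: k_def)
  have Re_\<zeta>: "Re \<zeta> > 0" "Re \<zeta> \<ge> k"
    using \<zeta> k by (auto simp: k_def)
  define f where "f = (\<lambda>s::real. complex_of_real s powr (b - 1) * exp (- (c * of_real s ^ 2) - \<zeta> * of_real s))"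
  define g where "g = (\<lambda>s::real. complex_of_real s powr (b - 1) * exp (- (\<zeta> * of_real s)))"
  define h where "h = (\<lambda>s::real. norm c * (s powr (Re b + 2 - 1) * exp (- (k * s))))"
  have fg: "f integrable_on {0<..}" "g integrable_on {0<..}"
    using absolutely_integrable_gauss_laplace[OF b c, of \<zeta>] absolutely_integrable_Laplace[OF b Re_\<zeta>(1)]
    by (auto simp: f_def g_def absolutely_integrable_on_def)
  have "gauss_laplace b c \<zeta> - Gamma b * \<zeta> powr (- b) = integral {0<..} (\<lambda>s. f s - g s)"
    using fg integral_Laplace[OF b Re_\<zeta>(1)]
    by (simp add: integral_diff gauss_laplace_def f_def g_def)
  also have "norm \<dots> \<le> integral {0<..} h"
  proof (rule integral_norm_bound_integral)
    show "h integrable_on {0<..}"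
      unfolding h_def by (intro integrable_on_mult_right integrable_powr_exp) (use b k in auto)
    show "norm (f s - g s) \<le> h s" if "s \<in> {0<..}" for s
    proof -
      have "f s - g s = complex_of_real s powr (b - 1) * exp (- (\<zeta> * of_real s)) * (exp (- (c * of_real s ^ 2)) - 1)"
        by (simp add: f_def g_def exp_diff exp_minus field_simps)
      also have "norm \<dots> = s powr (Re b - 1) * exp (- (Re \<zeta> * s)) * norm (exp (- (c * of_real s ^ 2)) - 1)"
        using that by (simp add: norm_mult norm_of_real_powr)
      also have "\<dots> \<le> s powr (Re b - 1) * exp (- (k * s)) * norm (c * of_real s ^ 2)"
        using that Re_\<zeta> c
        by (intro mult_mono norm_exp_minus_1_le) (auto simp flip: of_real_power)
      also have "\<dots> = h s"
      proof -
        have "s powr (Re b + 2 - 1) = s powr (Re b - 1) * s\<^sup>2"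
          using that powr_add[of s "Re b - 1" 2] by (simp add: powr_numeral algebra_simps)
        then show ?thesis
          by (simp add: h_def norm_mult norm_power mult_ac)
      qed
      finally show ?thesis .
    qed
  qed (use fg in \<open>auto intro: integrable_diff\<close>)
  also have "integral {0<..} h = norm c * (Gamma (Re b + 2) * k powr (- (Re b + 2)))"
  proof -
    define h' where "h' = (\<lambda>s. s powr (Re b + 2 - 1) * exp (- (k * s)))"
    \<comment> \<open>The real integral is embedded in the complex numbers so that
      \<open>integral_Laplace_real\<close> evaluates it.\<close>
    have "complex_of_real (integral {0<..} h') = integral {0<..} (\<lambda>s. complex_of_real (h' s))"
      unfolding h'_def
      by (rule integral_linear[OF _ bounded_linear_of_real, symmetric, unfolded o_def] integrable_powr_exp)+
         (use b k in auto)
    also have "\<dots> = integral {0<..} (\<lambda>s. of_real s powr (of_real (Re b + 2) - 1) * exp (- (of_real k * of_real s)))"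
    proof (rule integral_cong)
      fix x :: real assume "x \<in> {0<..}"
      then have "complex_of_real (x powr (Re b + 2 - 1)) = of_real x powr of_real (Re b + 2 - 1)"
        by (intro powr_of_real[symmetric]) auto
      then show "complex_of_real (h' x) = of_real x powr (of_real (Re b + 2) - 1) * exp (- (of_real k * of_real x))"
        by (simp add: h'_def flip: exp_of_real)
    qed
    also have "\<dots> = Gamma (of_real (Re b + 2)) * of_real k powr (- of_real (Re b + 2))"
      by (rule integral_Laplace_real) (use b k in auto)
    also have "\<dots> = of_real (Gamma (Re b + 2) * k powr (- (Re b + 2)))"
      using k powr_of_real[of k "- (Re b + 2)"] by (simp only: Gamma_complex_of_real of_real_mult of_real_minus)
    finally have "integral {0<..} h' = Gamma (Re b + 2) * k powr (- (Re b + 2))"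
      using of_real_eq_iff by blast
    then show ?thesis
      by (simp add: h_def h'_def)
  qed
  finally show ?thesis
    by (simp add: k_def mult_ac)
qed

section \<open>The parabolic cylinder function\<close>

text \<open>The second-order equation y'' = q y as a first-order system that carries y' along, so
  that no \<open>deriv\<close> enters the computations. As there is no y' term, Wronskians are
  constant.\<close>

definition ode_solution :: "(complex \<Rightarrow> complex) \<Rightarrow> (complex \<Rightarrow> complex) \<Rightarrow> (complex \<Rightarrow> complex) \<Rightarrow> bool" where
  "ode_solution q y y' \<longleftrightarrow>
     (\<forall>z. (y has_field_derivative y' z) (at z) \<and> (y' has_field_derivative q z * y z) (at z))"

lemma wronskian_constant:
  assumes "ode_solution q f f'" "ode_solution q g g'"
  shows "f z * g' z - f' z * g z = f w * g' w - f' w * g w"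
proof -
  have "((\<lambda>z. f z * g' z - f' z * g z) has_field_derivative 0) (at z)" for z
    using assms unfolding ode_solution_def
    by (auto intro!: derivative_eq_intros)
  then obtain c where "\<And>z. f z * g' z - f' z * g z = c"
    using has_field_derivative_zero_constant[of UNIV "\<lambda>z. f z * g' z - f' z * g z"] by auto
  then show ?thesis
    by simp
qed

text \<open>Cramer's rule: at one point, y W(f,g) = f W(y,g) - g W(y,f) is a polynomial identity,
  and the constant Wronskians W may be taken at any other point w. Later w = 0.\<close>

lemma ode_solution_expand:
  assumes y: "ode_solution q y y'" and f: "ode_solution q f f'" and g: "ode_solution q g g'"
  shows "y z * (f w * g' w - f' w * g w) =
           f z * (y w * g' w - y' w * g w) - g z * (y w * f' w - y' w * f w)"
  using wronskian_constant[OF f g, of z w] wronskian_constant[OF y g, of z w]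
    wronskian_constant[OF y f, of z w]
  by (simp flip: \<open>f z * g' z - f' z * g z = _\<close> \<open>y z * g' z - y' z * g z = _\<close>
       \<open>y z * f' z - y' z * f z = _\<close>) (simp add: algebra_simps)

definition pcU :: "complex \<Rightarrow> complex \<Rightarrow> complex" where
  "pcU a z = exp (- (z\<^sup>2 / 4)) * gauss_laplace (a + 1 / 2) (1 / 2) z / Gamma (a + 1 / 2)"

definition pcU' :: "complex \<Rightarrow> complex \<Rightarrow> complex" where
  "pcU' a z = - exp (- (z\<^sup>2 / 4)) *
     (z / 2 * gauss_laplace (a + 1 / 2) (1 / 2) z + gauss_laplace (a + 3 / 2) (1 / 2) z) / Gamma (a + 1 / 2)"

text \<open>Two derivatives bring in the integrals with b, b+1 and b+2, where b = a + 1/2. The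
  recurrence removes the last one, and then the b+1 integrals cancel.\<close>

lemma pcU_ode:
  assumes a: "Re a > -1/2"
  shows "ode_solution (\<lambda>z. z\<^sup>2 / 4 + a) (pcU a) (pcU' a)"
  unfolding ode_solution_def
proof safe
  fix z
  define b where "b = a + 1 / 2"
  have b: "Re b > 0"
    using a by (simp add: b_def)
  have b1: "a + 1 / 2 = b" "a + 3 / 2 = b + 1" "a = b - 1 / 2"
    by (simp_all add: b_def)
  have [simp]: "Gamma b \<noteq> 0"
    using b by (auto simp: Gamma_eq_zero_iff elim!: nonpos_Ints_cases)
  note [derivative_intros] = gauss_laplace_has_field_derivative[THEN DERIV_chain2]
  show "(pcU a has_field_derivative pcU' a z) (at z)"
    unfolding pcU_def pcU'_def b1(1,2) using b
    by (auto intro!: derivative_eq_intros simp: field_simps)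
  have rec: "gauss_laplace (b + 2) (1 / 2) z = b * gauss_laplace b (1 / 2) z - z * gauss_laplace (b + 1) (1 / 2) z"
    using gauss_laplace_recurrence[of b "1 / 2" z] b by (simp add: algebra_simps)
  have "(pcU' a has_field_derivative
      (- (exp (- (z\<^sup>2 / 4)) * (- (z / 2))) * (z / 2 * gauss_laplace b (1 / 2) z + gauss_laplace (b + 1) (1 / 2) z)
       - exp (- (z\<^sup>2 / 4)) * (gauss_laplace b (1 / 2) z / 2 + z / 2 * (- gauss_laplace (b + 1) (1 / 2) z)
           + - gauss_laplace (b + 2) (1 / 2) z)) / Gamma b) (at z)"
    unfolding pcU'_def b1(1,2) using b
    by (auto intro!: derivative_eq_intros simp: add.assoc simp del: mult_minus_left mult_minus_right minus_mult_minus)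
      (simp add: algebra_simps add_divide_distrib diff_divide_distrib)
  also have "?this = (pcU' a has_field_derivative (z\<^sup>2 / 4 + a) * pcU a z) (at z)"
    unfolding rec pcU_def b1(1)
    by (rule arg_cong[of _ _ "\<lambda>d. (pcU' a has_field_derivative d) (at z)"])
       (simp add: b1(3) field_simps power2_eq_square)
  finally show "(pcU' a has_field_derivative (z\<^sup>2 / 4 + a) * pcU a z) (at z)" .
qed

text \<open>Turning the ray by almost pi/4 against the sign of Arg z brings z to some \<zeta> well
  inside the right half-plane, where the one-term estimate applies. The pi/2 of the half-plane and
  this pi/4 make up the 3 pi/4 of the sector.\<close>

lemma gauss_laplace_sector_bound:
  assumes b: "Re b > 0" and \<delta>: "\<delta> > 0"
  shows "\<exists>K. \<forall>z. z \<noteq> 0 \<longrightarrow> \<bar>Arg z\<bar> \<le> 3 / 4 * pi - \<delta> \<longrightarrow>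
           norm (gauss_laplace b (1 / 2) z - Gamma b * z powr (- b)) \<le> K * norm z powr (- (Re b + 2))"
proof -
  define \<delta>' where "\<delta>' = min \<delta> (pi / 4)"
  \<comment> \<open>With |Arg z| <= 3 pi/4 - \<delta> this choice gives |Arg z + \<theta>| <= pi/2 -
    \<open>\<delta>'\<close>/2 while |\<theta>| < pi/4; the cap pi/4 on \<open>\<delta>'\<close>
    keeps \<open>\<theta>0\<close> positive.\<close>
  define \<theta>0 where "\<theta>0 = pi / 4 - \<delta>' / 2"
  define \<epsilon> where "\<epsilon> = cos (pi / 2 - \<delta>' / 2)"
  have \<delta>': "\<delta>' > 0" "\<delta>' \<le> \<delta>" "\<delta>' \<le> pi / 4"
    using \<delta> by (auto simp: \<delta>'_def)
  have \<epsilon>: "\<epsilon> > 0"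
    unfolding \<epsilon>_def by (rule cos_gt_zero) (use \<delta>' in auto)
  \<comment> \<open>exp |Im b| bounds the norm of \<open>cis \<theta> powr b\<close> because
    |\<theta>| < 1, and 1/2 is the norm of the rotated coefficient.\<close>
  define K where "K = exp (\<bar>Im b\<bar>) * (1 / 2 * Gamma (Re b + 2) * \<epsilon> powr (- (Re b + 2)))"
  show ?thesis
  proof (intro exI allI impI)
    fix z :: complex
    assume z: "z \<noteq> 0" "\<bar>Arg z\<bar> \<le> 3 / 4 * pi - \<delta>"
    define \<theta> where "\<theta> = (if Arg z \<le> 0 then \<theta>0 else - \<theta>0)"
    define \<zeta> where "\<zeta> = z * cis \<theta>"
    have \<theta>: "\<bar>\<theta>\<bar> < pi / 4"
      using \<delta>' pi_gt_zero by (auto simp: \<theta>_def \<theta>0_def)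
    have "\<bar>\<theta>\<bar> < 1"
      using \<theta> pi_less_4 by linarith
    have arg: "\<bar>Arg z + \<theta>\<bar> \<le> pi / 2 - \<delta>' / 2"
      using z(2) \<delta>' by (auto simp: \<theta>_def \<theta>0_def abs_le_iff)
    have "\<epsilon> \<le> cos \<bar>Arg z + \<theta>\<bar>"
      unfolding \<epsilon>_def using arg \<delta>' by (intro cos_monotone_0_pi_le) auto
    then have cos: "\<epsilon> \<le> cos (Arg z + \<theta>)"
      by simp
    have z_eq: "z = of_real (norm z) * cis (Arg z)"
      using rcis_cmod_Arg[of z] by (simp add: rcis_def)
    have \<zeta>_eq: "\<zeta> = of_real (norm z) * cis (Arg z + \<theta>)"
      unfolding \<zeta>_def using z_eq by (metis cis_mult mult.assoc)
    have norm_\<zeta>: "norm \<zeta> = norm z" and "\<zeta> \<noteq> 0"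
      using z by (simp_all add: \<zeta>_def norm_mult)
    have Re_\<zeta>: "Re \<zeta> \<ge> \<epsilon> * norm \<zeta>"
      using cos z(1) by (simp add: norm_\<zeta>) (simp add: \<zeta>_eq mult.commute mult_left_mono)
    \<comment> \<open>|Arg z + \<theta>| < pi, so this is the principal logarithm and the powers of
      z and \<zeta> differ by exactly \<open>cis \<theta> powr b\<close>.\<close>
    have "Ln \<zeta> = of_real (ln (norm z)) + \<i> * of_real (Arg z + \<theta>)"
    proof (rule Ln_unique)
      show "exp (of_real (ln (norm z)) + \<i> * of_real (Arg z + \<theta>)) = \<zeta>"
        using z(1) by (simp add: \<zeta>_eq exp_add exp_of_real cis_conv_exp del: of_real_add)
    qed (use arg \<delta>' pi_gt_zero in \<open>auto simp: abs_le_iff\<close>)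
    moreover have "Ln (cis \<theta>) = \<i> * of_real \<theta>"
      using \<theta> by (auto simp: cis_conv_exp intro!: Ln_exp)
    moreover have "Ln z = of_real (ln (norm z)) + \<i> * of_real (Arg z)"
      using z(1) by (intro complex_eqI) (auto simp: Arg_def)
    ultimately have "z powr (- b) = exp (b * Ln (cis \<theta>) + - b * Ln \<zeta>)"
      using z(1) by (simp add: powr_def algebra_simps)
    then have z_powr: "z powr (- b) = cis \<theta> powr b * \<zeta> powr (- b)"
      using \<open>\<zeta> \<noteq> 0\<close> by (simp only: exp_add) (simp add: powr_def)
    have "norm (cis \<theta> powr b) = exp (- (Im b * \<theta>))"
      using \<open>Ln (cis \<theta>) = _\<close> by (simp add: powr_def)
    also have "\<dots> \<le> exp \<bar>Im b\<bar>"
    proof -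
      have "- (Im b * \<theta>) \<le> \<bar>Im b\<bar> * \<bar>\<theta>\<bar>"
        by (metis abs_ge_minus_self abs_mult)
      also have "\<dots> \<le> \<bar>Im b\<bar> * 1"
        using \<open>\<bar>\<theta>\<bar> < 1\<close> by (intro mult_left_mono) auto
      finally show ?thesis
        by simp
    qed
    finally have norm_cis: "norm (cis \<theta> powr b) \<le> exp \<bar>Im b\<bar>" .
    define c where "c = cis (2 * \<theta>) / 2"
    have Re_c: "Re c > 0"
      using \<theta> by (auto simp: c_def intro!: cos_gt_zero_pi)
    have "gauss_laplace b (1 / 2) z - Gamma b * z powr (- b) =
       cis \<theta> powr b * (gauss_laplace b c \<zeta> - Gamma b * \<zeta> powr (- b))"
      unfolding gauss_laplace_rotate[OF b \<theta>] c_def \<zeta>_def[symmetric] z_powr by (simp add: algebra_simps)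
    also have "norm \<dots> \<le> exp \<bar>Im b\<bar> * (norm c * Gamma (Re b + 2) * (\<epsilon> * norm \<zeta>) powr (- (Re b + 2)))"
      unfolding norm_mult[of "cis \<theta> powr b"]
      by (intro mult_mono norm_cis gauss_laplace_bound b Re_c \<epsilon> Re_\<zeta> \<open>\<zeta> \<noteq> 0\<close>) auto
    also have "\<dots> = K * norm z powr (- (Re b + 2))"
      using \<epsilon> by (simp add: K_def norm_\<zeta> c_def norm_divide powr_mult mult_ac)
    finally show "norm (gauss_laplace b (1 / 2) z - Gamma b * z powr (- b)) \<le> K * norm z powr (- (Re b + 2))" .
  qed
qed

lemma norm_complex_powr:
  fixes z w :: complex
  assumes "z \<noteq> 0"
  shows "norm (z powr w) = norm z powr Re w * exp (- (Im w * Arg z))"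
  using assms by (simp add: powr_def Arg_def exp_diff exp_minus field_simps)

text \<open>The sector bound divided by the leading term leaves a relative error of order |z|^(-2).
  For complex b the norm of \<open>z powr (- b)\<close> also depends on Arg z, but only within a
  factor exp(pi |Im b|).\<close>

lemma pcU_asymp:
  assumes a: "Re a > -1/2" and \<delta>: "\<delta> > 0"
  shows "pcU a \<sim>[inf at_infinity (principal {z. \<bar>Arg z\<bar> \<le> 3 / 4 * pi - \<delta>})]
           (\<lambda>z. z powr (- a - 1 / 2) * exp (- (z\<^sup>2 / 4)))"
    (is "_ \<sim>[?F] ?g")
proof (rule asymp_equivI')
  define b where "b = a + 1 / 2"
  have b: "Re b > 0"
    using a by (simp add: b_def)
  have b1: "a + 1 / 2 = b" "- a - 1 / 2 = - b"
    by (simp_all add: b_def)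
  have G: "Gamma b \<noteq> 0"
    using b by (auto simp: Gamma_eq_zero_iff elim!: nonpos_Ints_cases)
  obtain K where K: "\<And>z. z \<noteq> 0 \<Longrightarrow> \<bar>Arg z\<bar> \<le> 3 / 4 * pi - \<delta> \<Longrightarrow>
           norm (gauss_laplace b (1 / 2) z - Gamma b * z powr (- b)) \<le> K * norm z powr (- (Re b + 2))"
    using gauss_laplace_sector_bound[OF b \<delta>] by blast
  define K' where "K' = K * exp (pi * \<bar>Im b\<bar>) / norm (Gamma b)"
  have bound: "norm (pcU a z / ?g z - 1) \<le> K' * norm z powr (- 2)"
    if z: "z \<noteq> 0" "\<bar>Arg z\<bar> \<le> 3 / 4 * pi - \<delta>" for z
  proof -
    have "K * norm z powr (- (Re b + 2)) \<ge> 0"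
      using K[OF z] norm_ge_zero order_trans by blast
    have nz: "Gamma b * z powr (- b) \<noteq> 0"
      using z G by simp
    have "pcU a z / ?g z - 1 = (gauss_laplace b (1 / 2) z - Gamma b * z powr (- b)) / (Gamma b * z powr (- b))"
      unfolding pcU_def b1 using z nz by (simp add: divide_simps)
    also have "norm \<dots> \<le> (K * norm z powr (- (Re b + 2))) / (norm (Gamma b) * (norm z powr (- Re b) * exp (- (pi * \<bar>Im b\<bar>))))"
      unfolding norm_divide
    proof (rule frac_le)
      have "\<bar>Arg z\<bar> \<le> pi"
        using Arg_bounded[of z] by auto
      then have "\<bar>Im b * Arg z\<bar> \<le> pi * \<bar>Im b\<bar>"
        unfolding abs_mult by (metis abs_ge_zero mult.commute mult_left_mono)
      then have "- (pi * \<bar>Im b\<bar>) \<le> Im b * Arg z"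
        by (simp add: abs_le_iff)
      then show "norm (Gamma b) * (norm z powr (- Re b) * exp (- (pi * \<bar>Im b\<bar>))) \<le> norm (Gamma b * z powr (- b))"
        using z by (simp add: norm_mult norm_complex_powr mult_left_mono)
    qed (use K[OF z] z G \<open>_ \<ge> 0\<close> in auto)
    also have "\<dots> = K' * norm z powr (- 2)"
      using z by (simp add: K'_def powr_diff powr_minus exp_minus field_simps)
    finally show ?thesis .
  qed
  have "((\<lambda>z. pcU a z / ?g z - 1) \<longlongrightarrow> 0) ?F"
  proof (rule Lim_null_comparison)
    have "eventually (\<lambda>z::complex. z \<noteq> 0) at_infinity"
      by (rule eventually_not_equal_at_infinity)
    then show "eventually (\<lambda>z. norm (pcU a z / ?g z - 1) \<le> K' * norm z powr (- 2)) ?F"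
      unfolding eventually_inf_principal
      by (rule eventually_mono) (use bound in auto)
    have "((\<lambda>x::real. K' * x powr (-2)) \<longlongrightarrow> 0) at_top"
      by real_asymp
    moreover have "filterlim (norm :: complex \<Rightarrow> real) at_top at_infinity"
      by (rule filterlim_norm_at_top)
    ultimately have "((\<lambda>z::complex. K' * norm z powr (- 2)) \<longlongrightarrow> 0) at_infinity"
      by (rule filterlim_compose)
    then show "((\<lambda>z::complex. K' * norm z powr (- 2)) \<longlongrightarrow> 0) ?F"
      by (rule tendsto_mono[rotated]) simp
  qed
  then show "((\<lambda>z. pcU a z / ?g z) \<longlongrightarrow> 1) ?F"
    using Lim_null by blast
qed

lemma is_parabolic_cylinder_U_pcU:
  assumes a: "Re a > -1/2"
  shows "is_parabolic_cylinder_U a (pcU a)"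
proof -
  note ode = pcU_ode[OF a, unfolded ode_solution_def]
  have "deriv (pcU a) = pcU' a" "deriv (pcU' a) = (\<lambda>z. (z\<^sup>2 / 4 + a) * pcU a z)"
    using ode by (auto intro!: DERIV_imp_deriv)
  moreover have "pcU a holomorphic_on UNIV"
    using ode by (auto simp: holomorphic_on_open)
  ultimately show ?thesis
    using pcU_asymp[OF a] by (simp add: is_parabolic_cylinder_U_def numeral_2_eq_2)
qed

section \<open>Uniqueness of the parabolic cylinder function\<close>

lemma is_parabolic_cylinder_U_ode:
  assumes "is_parabolic_cylinder_U a y"
  shows "ode_solution (\<lambda>z. z\<^sup>2 / 4 + a) y (deriv y)"
  unfolding ode_solution_def
proof (intro allI conjI)
  fix z
  have hol: "y holomorphic_on UNIV"
    and eq: "deriv (deriv y) z = (z\<^sup>2 / 4 + a) * y z"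
    using assms by (simp_all add: is_parabolic_cylinder_U_def numeral_2_eq_2)
  show "(y has_field_derivative deriv y z) (at z)"
    by (rule holomorphic_derivI[OF hol]) auto
  have "deriv y holomorphic_on UNIV"
    by (rule holomorphic_deriv[OF hol]) auto
  then show "(deriv y has_field_derivative (z\<^sup>2 / 4 + a) * y z) (at z)"
    unfolding eq[symmetric] by (rule holomorphic_derivI) auto
qed

lemma is_parabolic_cylinder_U_asymp:
  assumes "is_parabolic_cylinder_U a y" "\<delta> > 0"
  shows "y \<sim>[inf at_infinity (principal {z. \<bar>Arg z\<bar> \<le> 3 / 4 * pi - \<delta>})]
           (\<lambda>z. z powr (- a - 1 / 2) * exp (- (z\<^sup>2 / 4)))"
  using assms unfolding is_parabolic_cylinder_U_def by blast

text \<open>The definition prescribes asymptotics for y only, whereas the Wronskian needs y' too.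
  Cauchy's inequality on the unit disc about x yields y'. In this disc Re(w^2) >= (x-1)^2 - 1 = x^2
  - 2x, which is where the loss x/2 in the exponent comes from.\<close>

lemma is_parabolic_cylinder_U_real_bound:
  assumes a: "Re a > -1/2" and y: "is_parabolic_cylinder_U a y"
  shows "\<exists>C. eventually (\<lambda>x::real. norm (y (of_real x)) \<le> C * exp (- (x\<^sup>2 / 4) + x / 2) \<and>
           norm (deriv y (of_real x)) \<le> C * exp (- (x\<^sup>2 / 4) + x / 2)) at_top"
proof -
  define b where "b = a + 1 / 2"
  have b: "Re b > 0" and b1: "- a - 1 / 2 = - b"
    using a by (simp_all add: b_def)
  \<comment> \<open>Taking \<delta> = pi/4 leaves |Arg z| <= pi/2, a sector that contains the unit
    discs far out on the positive axis.\<close>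
  have "y \<sim>[inf at_infinity (principal {z. \<bar>Arg z\<bar> \<le> 3 / 4 * pi - pi / 4})]
        (\<lambda>z. z powr (- b) * exp (- (z\<^sup>2 / 4)))"
    unfolding b1[symmetric] by (rule is_parabolic_cylinder_U_asymp[OF y]) simp
  then have "y \<in> O[inf at_infinity (principal {z. \<bar>Arg z\<bar> \<le> 3 / 4 * pi - pi / 4})](\<lambda>z. z powr (- b) * exp (- (z\<^sup>2 / 4)))"
    by (rule asymp_equiv_imp_bigo)
  then obtain c where c: "c > 0" "eventually (\<lambda>z. \<bar>Arg z\<bar> \<le> 3 / 4 * pi - pi / 4 \<longrightarrow>
      norm (y z) \<le> c * norm (z powr (- b) * exp (- (z\<^sup>2 / 4)))) at_infinity"
    by (elim landau_o.bigE) (simp add: eventually_inf_principal)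
  then obtain X where X: "\<And>z. norm z \<ge> X \<Longrightarrow> \<bar>Arg z\<bar> \<le> 3 / 4 * pi - pi / 4 \<Longrightarrow>
      norm (y z) \<le> c * norm (z powr (- b) * exp (- (z\<^sup>2 / 4)))"
    unfolding eventually_at_infinity by blast
  define C where "C = c * exp (pi * \<bar>Im b\<bar>)"
  \<comment> \<open>The margin keeps |w| >= X and |w| >= 1, so that the asymptotic bound applies and
    \<open>norm w powr (- Re b)\<close> is at most 1.\<close>
  have near: "norm (y w) \<le> C * exp (- (x\<^sup>2 / 4) + x / 2)"
    if x: "x \<ge> max X 1 + 2" and w: "norm (of_real x - w) \<le> 1" for x w
  proof -
    have re: "Re w \<ge> x - 1" "\<bar>Im w\<bar> \<le> 1"
      using w abs_Re_le_cmod[of "of_real x - w"] abs_Im_le_cmod[of "of_real x - w"] by auto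
    have nw: "norm w \<ge> X" "norm w \<ge> 1"
      using re x complex_Re_le_cmod[of w] by auto
    have w0: "w \<noteq> 0" "Re w > 0"
      using re x by auto
    have arg: "\<bar>Arg w\<bar> < pi / 2"
      using w0 Arg_Re_pos by blast
    have "norm (w powr (- b) * exp (- (w\<^sup>2 / 4))) \<le> exp (pi * \<bar>Im b\<bar>) * exp (- (x\<^sup>2 / 4) + x / 2)"
      unfolding norm_mult
    proof (rule mult_mono)
      have "norm w powr (- Re b) \<le> norm w powr 0"
        using nw b by (intro powr_mono) auto
      moreover have "Im b * Arg w \<le> pi * \<bar>Im b\<bar>"
      proof -
        have "Im b * Arg w \<le> \<bar>Im b\<bar> * \<bar>Arg w\<bar>"
          by (metis abs_ge_self abs_mult)
        also have "\<dots> \<le> \<bar>Im b\<bar> * pi"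
          using arg pi_gt_zero by (intro mult_left_mono) linarith+
        finally show ?thesis
          by (simp add: mult.commute)
      qed
      ultimately have "norm w powr (- Re b) * exp (Im b * Arg w) \<le> 1 * exp (pi * \<bar>Im b\<bar>)"
        using w0 by (intro mult_mono) auto
      then show "norm (w powr (- b)) \<le> exp (pi * \<bar>Im b\<bar>)"
        using w0 by (simp add: norm_complex_powr)
      have "(x - 1)\<^sup>2 \<le> (Re w)\<^sup>2"
        using re x by (intro power_mono) auto
      moreover have "(Im w)\<^sup>2 \<le> 1"
        using re by (simp add: abs_square_le_1)
      ultimately have "x\<^sup>2 - 2 * x \<le> Re (w\<^sup>2)"
        by (simp add: power2_eq_square algebra_simps)
      then show "norm (exp (- (w\<^sup>2 / 4))) \<le> exp (- (x\<^sup>2 / 4) + x / 2)"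
        by simp
    qed auto
    then have "c * norm (w powr (- b) * exp (- (w\<^sup>2 / 4))) \<le> C * exp (- (x\<^sup>2 / 4) + x / 2)"
      unfolding C_def mult.assoc using c(1) by (intro mult_left_mono) auto
    moreover have "norm (y w) \<le> c * norm (w powr (- b) * exp (- (w\<^sup>2 / 4)))"
      by (rule X[OF nw(1)]) (use arg in linarith)
    ultimately show ?thesis
      by linarith
  qed
  have "norm (y (of_real x)) \<le> C * exp (- (x\<^sup>2 / 4) + x / 2) \<and>
           norm (deriv y (of_real x)) \<le> C * exp (- (x\<^sup>2 / 4) + x / 2)" if x: "x \<ge> max X 1 + 2" for x
  proof
    show "norm (y (of_real x)) \<le> C * exp (- (x\<^sup>2 / 4) + x / 2)"
      by (rule near[OF x]) simp
    have hol: "y holomorphic_on UNIV"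
      using y by (simp add: is_parabolic_cylinder_U_def)
    have "norm ((deriv ^^ 1) y (of_real x)) \<le> fact 1 * (C * exp (- (x\<^sup>2 / 4) + x / 2)) / 1 ^ 1"
    proof (rule Cauchy_inequality)
      show "y holomorphic_on ball (of_real x) 1"
        by (rule holomorphic_on_subset[OF hol]) auto
      show "continuous_on (cball (of_real x) 1) y"
        by (rule holomorphic_on_imp_continuous_on[OF holomorphic_on_subset[OF hol]]) auto
      show "norm (y w) \<le> C * exp (- (x\<^sup>2 / 4) + x / 2)" if "norm (of_real x - w) = 1" for w
        by (rule near[OF x]) (use that in simp)
    qed auto
    then show "norm (deriv y (of_real x)) \<le> C * exp (- (x\<^sup>2 / 4) + x / 2)"
      by simp
  qed
  then show ?thesis
    unfolding eventually_at_top_linorder by blast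
qed

lemma gauss_laplace_0:
  assumes "Re b > 0" "Re c > 0"
  shows "gauss_laplace b c 0 = gauss_moment c b"
  using integral_Gauss[OF assms] by (simp add: gauss_laplace_def gauss_moment_def)

lemma pcU_0:
  assumes "Re a > -1/2"
  shows "pcU a 0 = gauss_moment (1 / 2) (a + 1 / 2) / Gamma (a + 1 / 2)"
    and "pcU' a 0 = - gauss_moment (1 / 2) (a + 3 / 2) / Gamma (a + 1 / 2)"
  using assms by (simp_all add: pcU_def pcU'_def gauss_laplace_0)

lemma Gamma_nonzero_Re_pos: "Re b > 0 \<Longrightarrow> Gamma b \<noteq> 0"
  by (auto simp: Gamma_eq_zero_iff elim!: nonpos_Ints_cases)

lemma pcU_0_nonzero:
  assumes "Re a > -1/2"
  shows "pcU a 0 \<noteq> 0" "pcU' a 0 \<noteq> 0"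
  using assms by (auto simp: pcU_0 gauss_moment_def Gamma_nonzero_Re_pos)

lemma ode_solution_reflect:
  assumes "ode_solution q y y'" "\<And>z. q (- z) = q z"
  shows "ode_solution q (\<lambda>z. y (- z)) (\<lambda>z. - y' (- z))"
  unfolding ode_solution_def
proof (intro allI conjI)
  fix z
  have y: "(y has_field_derivative y' (- z)) (at (- z))" "(y' has_field_derivative q z * y (- z)) (at (- z))"
    using assms(1) unfolding ode_solution_def by (auto simp flip: assms(2)[of z])
  have "(uminus has_field_derivative - 1) (at z)"
    by (auto intro!: derivative_eq_intros)
  note DERIV_chain2[where g = uminus, OF y(1) this] DERIV_chain2[where g = uminus, OF y(2) this]
  then show "((\<lambda>z. y (- z)) has_field_derivative - y' (- z)) (at z)"
    "((\<lambda>z. - y' (- z)) has_field_derivative q z * y (- z)) (at z)"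
    by (auto dest: DERIV_minus)
qed

text \<open>A competitor y and \<open>pcU a\<close> both decay along the positive axis, so their
  Wronskian is 0. In the basis \<open>pcU a z\<close>, \<open>pcU a (- z)\<close> this leaves a
  multiple of \<open>pcU a\<close>, and the common asymptotics force the factor 1.\<close>

lemma parabolic_cylinder_U_eq:
  assumes a: "Re a > -1/2"
  shows "parabolic_cylinder_U a = pcU a"
  unfolding parabolic_cylinder_U_def
proof (rule the_equality)
  show "is_parabolic_cylinder_U a (pcU a)"
    by (rule is_parabolic_cylinder_U_pcU[OF a])
  fix y assume y: "is_parabolic_cylinder_U a y"
  note ode_U = pcU_ode[OF a]
  have ode_U': "ode_solution (\<lambda>z. z\<^sup>2 / 4 + a) (\<lambda>z. pcU a (- z)) (\<lambda>z. - pcU' a (- z))"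
    by (rule ode_solution_reflect[OF ode_U]) simp
  note ode_y = is_parabolic_cylinder_U_ode[OF y]
  have deriv_U: "deriv (pcU a) = pcU' a"
    using ode_U by (auto simp: ode_solution_def intro!: DERIV_imp_deriv)
  define w where "w = y 0 * pcU' a 0 - deriv y 0 * pcU a 0"
  obtain C1 where C1: "eventually (\<lambda>x::real. norm (y (of_real x)) \<le> C1 * exp (- (x\<^sup>2 / 4) + x / 2) \<and>
           norm (deriv y (of_real x)) \<le> C1 * exp (- (x\<^sup>2 / 4) + x / 2)) at_top"
    using is_parabolic_cylinder_U_real_bound[OF a y] by blast
  obtain C2 where C2: "eventually (\<lambda>x::real. norm (pcU a (of_real x)) \<le> C2 * exp (- (x\<^sup>2 / 4) + x / 2) \<and>
           norm (pcU' a (of_real x)) \<le> C2 * exp (- (x\<^sup>2 / 4) + x / 2)) at_top"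
    using is_parabolic_cylinder_U_real_bound[OF a is_parabolic_cylinder_U_pcU[OF a]]
    unfolding deriv_U by blast
  have "((\<lambda>x::real. w) \<longlongrightarrow> 0) at_top"
  proof (rule Lim_null_comparison)
    show "eventually (\<lambda>x. norm w \<le> 2 * (C1 * exp (- (x\<^sup>2 / 4) + x / 2) * (C2 * exp (- (x\<^sup>2 / 4) + x / 2)))) at_top"
      using C1 C2
    proof eventually_elim
      case (elim x)
      define e1 where "e1 = C1 * exp (- (x\<^sup>2 / 4) + x / 2)"
      define e2 where "e2 = C2 * exp (- (x\<^sup>2 / 4) + x / 2)"
      have "w = y (of_real x) * pcU' a (of_real x) - deriv y (of_real x) * pcU a (of_real x)"
        unfolding w_def by (rule wronskian_constant[OF ode_y ode_U])
      also have "norm \<dots> \<le> norm (y (of_real x)) * norm (pcU' a (of_real x)) + norm (deriv y (of_real x)) * norm (pcU a (of_real x))"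
        by (metis norm_mult norm_triangle_ineq4)
      also have "\<dots> \<le> e1 * e2 + e1 * e2"
        using elim unfolding e1_def[symmetric] e2_def[symmetric]
        by (intro add_mono mult_mono) (auto intro: order_trans[OF norm_ge_zero])
      finally show ?case
        by (simp add: e1_def e2_def mult_ac)
    qed
    show "((\<lambda>x. 2 * (C1 * exp (- (x\<^sup>2 / 4) + x / 2) * (C2 * exp (- (x\<^sup>2 / 4) + x / 2)))) \<longlongrightarrow> 0) at_top"
      by real_asymp
  qed
  then have w0: "w = 0"
    by (simp add: tendsto_const_iff)
  \<comment> \<open>The denominator is the Wronskian of the basis at 0; it is nonzero because Gamma
    values do not vanish.\<close>
  define k where "k = (y 0 * - pcU' a 0 - deriv y 0 * pcU a 0) / (- (2 * pcU a 0 * pcU' a 0))"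
  have y_eq: "y z = k * pcU a z" for z
  proof -
    have "y z * (pcU a 0 * - pcU' a 0 - pcU' a 0 * pcU a 0) =
        pcU a z * (y 0 * - pcU' a 0 - deriv y 0 * pcU a 0) - pcU a (- z) * w"
      using ode_solution_expand[OF ode_y ode_U ode_U', of z 0] by (simp only: w_def minus_zero)
    then have "y z * (- (2 * pcU a 0 * pcU' a 0)) = pcU a z * (y 0 * - pcU' a 0 - deriv y 0 * pcU a 0)"
      by (simp add: w0 mult_ac)
    then show ?thesis
      unfolding k_def using pcU_0_nonzero[OF a] by (subst times_divide_eq_left, subst eq_divide_eq) (simp add: mult.commute)
  qed
  define F where "F = inf at_infinity (principal {z. \<bar>Arg z\<bar> \<le> 3 / 4 * pi - pi / 4})"
  define g where "g = (\<lambda>z. z powr (- a - 1 / 2) * exp (- (z\<^sup>2 / 4)))"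
  have "eventually (\<lambda>z::complex. z \<noteq> 0) F"
    unfolding F_def by (rule filter_leD[OF inf_le1]) (rule eventually_not_equal_at_infinity)
  then have g_nz: "eventually (\<lambda>z. f z \<noteq> 0 \<or> g z \<noteq> 0) F" for f :: "complex \<Rightarrow> complex"
    by eventually_elim (simp add: g_def)
  have eqv: "y \<sim>[F] g" "pcU a \<sim>[F] g"
    unfolding F_def g_def
    by (rule is_parabolic_cylinder_U_asymp, rule y is_parabolic_cylinder_U_pcU[OF a], simp)+
  \<comment> \<open>Composing with the positive axis transfers both limits to the nontrivial filter
    \<open>at_top\<close>, where limits are unique.\<close>
  have lim: "filterlim (\<lambda>x::real. complex_of_real x) F at_top"
  proof -
    have "filterlim (\<lambda>x::real. complex_of_real x) at_infinity at_top"
      by (rule filterlim_of_real_at_infinity)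
    moreover have "eventually (\<lambda>x::real. complex_of_real x \<in> {z. \<bar>Arg z\<bar> \<le> 3 / 4 * pi - pi / 4}) at_top"
      using eventually_gt_at_top[of 0] by eventually_elim (simp add: Arg_of_real)
    ultimately show ?thesis
      by (simp add: F_def filterlim_inf filterlim_principal)
  qed
  have "((\<lambda>z. y z / g z) \<longlongrightarrow> 1) F" "((\<lambda>z. pcU a z / g z) \<longlongrightarrow> 1) F"
    by (rule asymp_equivD_strong[OF eqv(1) g_nz] asymp_equivD_strong[OF eqv(2) g_nz])+
  then have "((\<lambda>z. k * (pcU a z / g z)) \<longlongrightarrow> 1) F" "((\<lambda>z. k * (pcU a z / g z)) \<longlongrightarrow> k * 1) F"
    by (simp add: y_eq, intro tendsto_mult tendsto_const)
  then have "((\<lambda>x::real. k * (pcU a (of_real x) / g (of_real x))) \<longlongrightarrow> 1) at_top"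
    "((\<lambda>x::real. k * (pcU a (of_real x) / g (of_real x))) \<longlongrightarrow> k * 1) at_top"
    using filterlim_compose[OF _ lim] by blast+
  then have "k = 1"
    using tendsto_unique[of "at_top :: real filter"] by fastforce
  then show "y = pcU a"
    using y_eq by auto
qed

section \<open>Moments and Beta integrals\<close>

lemma of_real_powr_eq_exp:
  assumes "x > 0"
  shows "complex_of_real x powr w = exp (w * of_real (ln x))"
  using assms by (simp add: powr_def Ln_of_real)

lemma continuous_on_of_real_powr':
  assumes "continuous_on S f" "\<And>x. x \<in> S \<Longrightarrow> f x > 0"
  shows "continuous_on S (\<lambda>x. complex_of_real (f x) powr b)"
  by (rule continuous_on_compose2[OF continuous_on_of_real_powr[OF subset_refl] assms(1)]) (use assms(2) in auto)

lemma absolutely_integrable_cong: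
  assumes "f absolutely_integrable_on S" "\<And>x. x \<in> S \<Longrightarrow> f x = g x"
  shows "g absolutely_integrable_on S"
  using assms(1) set_integrable_cong[OF refl refl assms(2)] by (rule iffD1[rotated])

text \<open>Carries Fubini and Tonelli for \<open>lborel\<close> over to gauge integrals on open
  sets. Joint continuity gives Borel measurability, and an integrable bound for the inner integrals
  of the norm gives integrability on the product. That the inner integrals are absolutely integrable
  themselves is how the moments are later seen to exist.\<close>

lemma fubini_absolutely_integrable:
  fixes F :: "real \<Rightarrow> real \<Rightarrow> complex"
  assumes open_AB: "open A" "open B"
    and cont: "continuous_on (A \<times> B) (\<lambda>(x, y). F x y)"
    and int1: "\<And>x. x \<in> A \<Longrightarrow> F x absolutely_integrable_on B"
    and int2: "\<And>y. y \<in> B \<Longrightarrow> (\<lambda>x. F x y) absolutely_integrable_on A"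
    and bound: "\<And>x. x \<in> A \<Longrightarrow> integral B (\<lambda>y. norm (F x y)) \<le> g x" "g integrable_on A"
  shows "integral A (\<lambda>x. integral B (F x)) = integral B (\<lambda>y. integral A (\<lambda>x. F x y))"
    and "(\<lambda>x. integral B (F x)) absolutely_integrable_on A"
    and "(\<lambda>y. integral A (\<lambda>x. F x y)) absolutely_integrable_on B"
proof -
  define f where "f = (\<lambda>x y. indicator (A \<times> B) (x, y) *\<^sub>R F x y)"
  have "(\<lambda>p. indicator (A \<times> B) p *\<^sub>R (case p of (x, y) \<Rightarrow> F x y)) \<in> borel_measurable borel"
    by (rule borel_measurable_continuous_on_indicator) (use open_AB cont in \<open>auto intro!: borel_open open_Times\<close>)
  then have meas: "case_prod f \<in> borel_measurable (lborel \<Otimes>\<^sub>M lborel)"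
    by (simp add: f_def case_prod_beta' borel_prod[symmetric] cong: measurable_cong_sets)
  have meas1: "f x \<in> borel_measurable lborel" for x
    using measurable_compose_Pair1[OF _ meas, of x] by simp
  have meas2: "(\<lambda>x. f x y) \<in> borel_measurable lborel" for y
    using measurable_Pair_compose_split[OF meas, of "\<lambda>x. x" lborel "\<lambda>_. y"] by simp
  have f1: "f x = (\<lambda>y. indicator A x *\<^sub>R (indicator B y *\<^sub>R F x y))" for x
    by (auto simp: f_def indicator_def)
  have f2: "(\<lambda>x. f x y) = (\<lambda>x. indicator B y *\<^sub>R (indicator A x *\<^sub>R F x y))" for y
    by (auto simp: f_def indicator_def)
  have sB: "set_integrable lborel B (F x)" if "x \<in> A" for x
    using int1[OF that] meas1[of x] that
    unfolding set_integrable_def by (subst (asm) integrable_completion) (auto simp: f1)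
  have sA: "set_integrable lborel A (\<lambda>x. F x y)" if "y \<in> B" for y
    using int2[OF that] meas2[of y] that
    unfolding set_integrable_def by (subst (asm) integrable_completion) (auto simp: f2)
  have L1: "(LINT y|lborel. f x y) = indicator A x *\<^sub>R integral B (F x)" for x
    using set_borel_integral_eq_integral(2)[OF sB, of x]
    by (cases "x \<in> A") (auto simp: f1 set_lebesgue_integral_def)
  have L2: "(LINT x|lborel. f x y) = indicator B y *\<^sub>R integral A (\<lambda>x. F x y)" for y
    using set_borel_integral_eq_integral(2)[OF sA, of y]
    by (cases "y \<in> B") (auto simp: f2 set_lebesgue_integral_def)
  have L1n: "(LINT y|lborel. norm (f x y)) = integral B (\<lambda>y. norm (F x y))" if "x \<in> A" for x
  proof -
    have "set_integrable lborel B (\<lambda>y. norm (F x y))"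
      using set_integrable_norm[OF sB[OF that]] .
    then show ?thesis
      using set_borel_integral_eq_integral(2) that by (fastforce simp: f1 set_lebesgue_integral_def)
  qed
  define h where "h = (\<lambda>x. LINT y|lborel. norm (f x y))"
  have h_meas: "h \<in> borel_measurable lborel"
    unfolding h_def using meas by measurable
  have "h absolutely_integrable_on A"
  proof (rule measurable_bounded_by_integrable_imp_absolutely_integrable[OF _ _ bound(2)])
    have "h \<in> borel_measurable lebesgue"
      using h_meas by (rule measurable_completion)
    then show "h \<in> borel_measurable (lebesgue_on A)"
      by (rule measurable_restrict_space1)
    show "A \<in> sets lebesgue"
      using open_AB by (simp add: borel_open)
    show "norm (h x) \<le> g x" if "x \<in> A" for x
      using bound(1)[OF that] by (simp add: h_def L1n that integral_nonneg_AE flip: L1n)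
  qed
  then have "integrable lborel (\<lambda>x. indicator A x *\<^sub>R h x)"
    unfolding set_integrable_def using h_meas open_AB
    by (subst (asm) integrable_completion) (auto intro!: borel_measurable_indicator)
  moreover have "(\<lambda>x. indicator A x *\<^sub>R h x) = h"
  proof
    show "indicator A x *\<^sub>R h x = h x" for x
      by (cases "x \<in> A") (simp_all add: h_def f_def)
  qed
  ultimately have h_int: "integrable lborel h"
    by (simp only:)
  have f_int: "integrable (lborel \<Otimes>\<^sub>M lborel) (case_prod f)"
  proof (rule lborel_pair.Fubini_integrable[OF meas])
    show "integrable lborel (\<lambda>x. LINT y|lborel. norm (case_prod f (x, y)))"
      using h_int by (simp add: h_def)
    show "AE x in lborel. integrable lborel (\<lambda>y. case_prod f (x, y))"
    proof (rule AE_I2)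
      fix x
      show "integrable lborel (\<lambda>y. case_prod f (x, y))"
        using sB[of x] by (cases "x \<in> A") (auto simp: f1 set_integrable_def)
    qed
  qed
  have i1: "integrable lborel (\<lambda>x. indicator A x *\<^sub>R integral B (F x))"
    using lborel_pair.integrable_fst[OF f_int] by (simp add: L1)
  have i2: "integrable lborel (\<lambda>y. indicator B y *\<^sub>R integral A (\<lambda>x. F x y))"
    using lborel_pair.integrable_snd[OF f_int] by (simp add: L2)
  show "(\<lambda>x. integral B (F x)) absolutely_integrable_on A"
    using i1 unfolding set_integrable_def by (subst integrable_completion) auto
  show "(\<lambda>y. integral A (\<lambda>x. F x y)) absolutely_integrable_on B"
    using i2 unfolding set_integrable_def by (subst integrable_completion) auto
  have "(LINT y|lborel. LINT x|lborel. f x y) = (LINT x|lborel. LINT y|lborel. f x y)"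
    by (rule lborel_pair.Fubini_integral[OF f_int])
  then have "set_lebesgue_integral lborel B (\<lambda>y. integral A (\<lambda>x. F x y)) =
             set_lebesgue_integral lborel A (\<lambda>x. integral B (F x))"
    by (simp add: L1 L2 set_lebesgue_integral_def)
  then show "integral A (\<lambda>x. integral B (F x)) = integral B (\<lambda>y. integral A (\<lambda>x. F x y))"
    using i1 i2 by (simp add: set_borel_integral_eq_integral(2) set_integrable_def)
qed

text \<open>Write Gamma(q) (1+x)^(-q) as a Laplace integral in s and exchange the integrals. The
  integral over x is then a Laplace integral too, and a Gamma integral with exponent p + q - 1
  remains.\<close>

lemma Beta_integral_complex:
  assumes p: "Re p < 1" and q: "Re q > 0" and pq: "Re (p + q) > 1"
  shows "(\<lambda>x. of_real x powr (- p) * of_real (1 + x) powr (- q)) absolutely_integrable_on {0<..}"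
    and "integral {0<..} (\<lambda>x. of_real x powr (- p) * of_real (1 + x) powr (- q)) = 
           Gamma (1 - p) * Gamma (p + q - 1) / Gamma q"
proof -
  define F where "F = (\<lambda>s x. complex_of_real s powr (q - 1) * exp (- of_real s) * 
     (of_real x powr (- p) * exp (- (of_real s * of_real x))))"
  have intx: "F s absolutely_integrable_on {0<..}"
    and eqx: "integral {0<..} (F s) = Gamma (1 - p) * (of_real s powr (p + q - 1 - 1) * exp (- (1 * of_real s)))"
    if "s \<in> {0<..}" for s
  proof -
    have "(\<lambda>x. of_real x powr (- p) * exp (- (of_real s * of_real x))) absolutely_integrable_on {0<..}"
      using absolutely_integrable_Laplace[of "1 - p" "of_real s"] p that by simp
    then show "F s absolutely_integrable_on {0<..}"
      unfolding F_def by (rule set_integrable_mult_right[rotated])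
    have "integral {0<..} (F s) = of_real s powr (q - 1) * exp (- of_real s) * (Gamma (1 - p) * of_real s powr (p - 1))"
      using integral_Laplace_real[of "1 - p" s] p that by (simp add: F_def)
    moreover have "of_real s powr (q - 1) * of_real s powr (p - 1) = complex_of_real s powr (p + q - 1 - 1)"
      by (simp add: algebra_simps flip: powr_add)
    ultimately show "integral {0<..} (F s) = Gamma (1 - p) * (of_real s powr (p + q - 1 - 1) * exp (- (1 * of_real s)))"
      by (simp add: mult_ac)
  qed
  have F_alt: "F s x = of_real x powr (- p) * (of_real s powr (q - 1) * exp (- (of_real (1 + x) * of_real s)))" for s x
  proof -
    have "exp (- (complex_of_real (1 + x) * of_real s)) = exp (- of_real s) * exp (- (of_real s * of_real x))"
      by (simp only: exp_add[symmetric]) (simp add: algebra_simps)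
    then show ?thesis
      by (simp only: F_def mult_ac)
  qed
  have ints: "(\<lambda>s. F s x) absolutely_integrable_on {0<..}"
    and eqs: "integral {0<..} (\<lambda>s. F s x) = of_real x powr (- p) * (Gamma q * of_real (1 + x) powr (- q))"
    if "x \<in> {0<..}" for x
  proof -
    show "(\<lambda>s. F s x) absolutely_integrable_on {0<..}"
      using absolutely_integrable_Laplace[of q "of_real (1 + x)"] q that
      unfolding F_alt by (intro set_integrable_mult_right) auto
    show "integral {0<..} (\<lambda>s. F s x) = of_real x powr (- p) * (Gamma q * of_real (1 + x) powr (- q))"
      using integral_Laplace_real[of q "1 + x"] q that unfolding F_alt by (simp del: of_real_add)
  qed
  \<comment> \<open>The norm of the integrand has the same form with Re p and Re q, so the bound
    comes from the same Laplace formula; Re(p+q) > 1 makes it integrable in s.\<close>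
  have Fb: "integral {0<..} (\<lambda>x. norm (F s x)) \<le> norm (Gamma (complex_of_real (1 - Re p))) * (s powr (Re (p + q - 1) - 1) * exp (- (1 * s)))"
    if "s \<in> {0<..}" for s
  proof -
    have s: "s > 0"
      using that by simp
    have "complex_of_real (integral {0<..} (\<lambda>x. norm (F s x))) = integral {0<..} (\<lambda>x. complex_of_real (norm (F s x)))"
      using intx[OF that] integral_linear[of "\<lambda>x. norm (F s x)" "{0<..}" complex_of_real]
      by (simp add: o_def absolutely_integrable_on_def bounded_linear_of_real)
    also have "\<dots> = integral {0<..} (\<lambda>x. of_real (s powr (Re q - 1) * exp (- s)) *
        (of_real x powr (of_real (1 - Re p) - 1) * exp (- (of_real s * of_real x))))"
    proof (rule integral_cong)
      fix x :: real assume x: "x \<in> {0<..}"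
      have "complex_of_real (x powr (- Re p)) = of_real x powr (of_real (1 - Re p) - 1)"
        using x powr_of_real[of x "- Re p"] by simp
      then show "complex_of_real (norm (F s x)) = of_real (s powr (Re q - 1) * exp (- s)) *
        (of_real x powr (of_real (1 - Re p) - 1) * exp (- (of_real s * of_real x)))"
        using x s by (simp add: F_def norm_mult norm_of_real_powr flip: exp_of_real)
    qed
    also have "\<dots> = of_real (s powr (Re q - 1) * exp (- s)) * (Gamma (of_real (1 - Re p)) * of_real s powr (- of_real (1 - Re p)))"
      using integral_Laplace_real[of "of_real (1 - Re p)" s] p s by simp
    finally have nrm: "norm (complex_of_real (integral {0<..} (\<lambda>x. norm (F s x)))) =
        s powr (Re q - 1) * exp (- s) * (norm (Gamma (complex_of_real (1 - Re p))) * s powr (Re p - 1))"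
      using s by (simp add: norm_mult norm_of_real_powr)
    have powr_eq: "s powr (Re (p + q - 1) - 1) = s powr (Re q - 1) * s powr (Re p - 1)"
      by (simp add: algebra_simps flip: powr_add)
    have "integral {0<..} (\<lambda>x. norm (F s x)) \<le> norm (complex_of_real (integral {0<..} (\<lambda>x. norm (F s x))))"
      by simp
    also note nrm
    also have "s powr (Re q - 1) * exp (- s) * (norm (Gamma (complex_of_real (1 - Re p))) * s powr (Re p - 1)) =
      norm (Gamma (complex_of_real (1 - Re p))) * (s powr (Re (p + q - 1) - 1) * exp (- (1 * s)))"
      by (simp only: powr_eq mult_ac mult_1)
    finally show ?thesis .
  qed
  have cont: "continuous_on ({0<..} \<times> {0<..}) (\<lambda>(s, x). F s x)"
    unfolding F_def case_prod_beta
    by (intro continuous_on_mult continuous_on_of_real_powr' continuous_on_exp continuous_on_minus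
          continuous_on_of_real continuous_on_fst continuous_on_snd continuous_on_id) auto
  have gint: "(\<lambda>s. norm (Gamma (complex_of_real (1 - Re p))) * (s powr (Re (p + q - 1) - 1) * exp (- (1 * s)))) integrable_on {0<..}"
    by (intro integrable_on_mult_right integrable_powr_exp) (use pq in auto)
  note fub = fubini_absolutely_integrable[OF open_greaterThan open_greaterThan cont intx ints Fb gint]
  have "Gamma q \<noteq> 0"
    using q by (rule Gamma_nonzero_Re_pos)
  have "(\<lambda>x. of_real x powr (- p) * (Gamma q * of_real (1 + x) powr (- q))) absolutely_integrable_on {0<..}"
    using fub(3) by (rule set_integrable_cong[THEN iffD1, rotated -1]) (use eqs in auto)
  then have "(\<lambda>x. (1 / Gamma q) * (of_real x powr (- p) * (Gamma q * of_real (1 + x) powr (- q)))) absolutely_integrable_on {0<..}"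
    by (intro set_integrable_mult_right) auto
  also have "(\<lambda>x. (1 / Gamma q) * (of_real x powr (- p) * (Gamma q * of_real (1 + x) powr (- q)))) =
     (\<lambda>x::real. of_real x powr (- p) * of_real (1 + x) powr (- q))"
    using \<open>Gamma q \<noteq> 0\<close> by (simp add: field_simps)
  finally show "(\<lambda>x. of_real x powr (- p) * of_real (1 + x) powr (- q)) absolutely_integrable_on {0<..}" .
  have "Gamma q * integral {0<..} (\<lambda>x. of_real x powr (- p) * of_real (1 + x) powr (- q)) =
      integral {0<..} (\<lambda>x. integral {0<..} (\<lambda>s. F s x))"
    by (subst integral_mult_right[symmetric], rule integral_cong) (simp only: eqs mult_ac)
  also have "\<dots> = integral {0<..} (\<lambda>s. integral {0<..} (F s))"
    by (rule fub(1)[symmetric])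
  also have "\<dots> = integral {0<..} (\<lambda>s. Gamma (1 - p) * (of_real s powr (p + q - 1 - 1) * exp (- (1 * of_real s))))"
    by (rule integral_cong) (rule eqx)
  also have "\<dots> = Gamma (1 - p) * Gamma (p + q - 1)"
    using integral_Laplace[of "p + q - 1" 1] pq by simp
  finally show "integral {0<..} (\<lambda>x. of_real x powr (- p) * of_real (1 + x) powr (- q)) = 
           Gamma (1 - p) * Gamma (p + q - 1) / Gamma q"
    using \<open>Gamma q \<noteq> 0\<close> by (simp add: field_simps)
qed

text \<open>An incomplete Beta integral: the upper part of the integral in
  \<open>Beta_integral_complex\<close>.\<close>

definition half_Beta :: "complex \<Rightarrow> complex \<Rightarrow> complex" where
  "half_Beta p q = integral {1..} (\<lambda>x. of_real x powr (- p) * of_real (1 + x) powr (- q))"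

text \<open>Inverting x turns the part over (0,1] into the part over [1,infinity) with 2 - p - q in
  place of p, since x^(-2) x^p (1 + 1/x)^(-q) = x^(p+q-2) (1+x)^(-q).\<close>

lemma half_Beta_reflect:
  assumes p: "Re p < 1" and q: "Re q > 0" and pq: "Re (p + q) > 1"
  shows "half_Beta p q + half_Beta (2 - p - q) q = Gamma (1 - p) * Gamma (p + q - 1) / Gamma q"
proof -
  define f where "f = (\<lambda>x. complex_of_real x powr (- p) * of_real (1 + x) powr (- q))"
  have f_int: "f absolutely_integrable_on {0<..}"
    unfolding f_def by (rule Beta_integral_complex(1)[OF p q pq])
  have f1: "f absolutely_integrable_on {1..}" and f2: "f absolutely_integrable_on {0<..1}"
    by (rule set_integrable_subset[OF f_int], auto)+
  have img: "(\<lambda>x::real. 1 / x) ` {1..} = {0<..1}"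
    by (auto simp: field_simps intro!: image_eqI[of _ _ "1 / _"])
  have "f absolutely_integrable_on ((\<lambda>x. 1 / x) ` {1..}) \<and> integral ((\<lambda>x. 1 / x) ` {1..}) f = integral {0<..1} f"
    unfolding img using f2 by simp
  then have "integral {1..} (\<lambda>x. \<bar>- (1 / x\<^sup>2)\<bar> *\<^sub>R f (1 / x)) = integral {0<..1} f"
    by (subst (asm) has_absolute_integral_change_of_variables_real[symmetric, where h = "\<lambda>x. - (1 / x\<^sup>2)"])
       (auto intro!: derivative_eq_intros inj_onI simp: power2_eq_square)
  also have "integral {1..} (\<lambda>x. \<bar>- (1 / x\<^sup>2)\<bar> *\<^sub>R f (1 / x)) = half_Beta (2 - p - q) q"
    unfolding half_Beta_def
  proof (rule integral_cong)
    fix x :: real assume "x \<in> {1..}"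
    then have x: "x > 0"
      by simp
    have "1 + 1 / x = (1 + x) / x"
      using x by (simp add: field_simps)
    then have ln: "ln (1 / x) = - ln x" "ln (1 + 1 / x) = ln (1 + x) - ln x"
      using x by (simp_all add: ln_div)
    have "x\<^sup>2 = exp (2 * ln x)"
      using x by (simp add: exp_double)
    then have "complex_of_real \<bar>- (1 / x\<^sup>2)\<bar> = exp (- 2 * of_real (ln x))"
      by (simp add: exp_minus field_simps flip: exp_of_real)
    then have "\<bar>- (1 / x\<^sup>2)\<bar> *\<^sub>R f (1 / x) = exp (- 2 * of_real (ln x)) *
       (exp (- p * of_real (- ln x)) * exp (- q * of_real (ln (1 + x) - ln x)))"
      unfolding f_def scaleR_conv_of_real
      using x of_real_powr_eq_exp[of "1 / x" "- p"] of_real_powr_eq_exp[of "1 + 1 / x" "- q"]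
      by (simp only: ln) (simp add: add_pos_pos)
    also have "\<dots> = exp (- (2 - p - q) * of_real (ln x)) * exp (- q * of_real (ln (1 + x)))"
      by (simp only: flip: exp_add) (rule arg_cong[of _ _ exp], simp add: algebra_simps)
    also have "\<dots> = complex_of_real x powr (- (2 - p - q)) * of_real (1 + x) powr (- q)"
      using x by (simp only: of_real_powr_eq_exp add_pos_pos zero_less_one)
    finally show "\<bar>- (1 / x\<^sup>2)\<bar> *\<^sub>R f (1 / x) = complex_of_real x powr (- (2 - p - q)) * of_real (1 + x) powr (- q)" .
  qed
  finally have 1: "integral {0<..1} f = half_Beta (2 - p - q) q" ..
  have "(f has_integral (integral {0<..1} f + integral {1..} f)) ({0<..1} \<union> {1..})"
    by (rule has_integral_Un)
       (use f1 f2 in \<open>auto simp: absolutely_integrable_on_def Int_atLeastAtMostL1 intro: negligible_subset[of "{1}"]\<close>)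
  moreover have "{0<..1} \<union> {1..} = {0::real<..}"
    by auto
  ultimately have "integral {0<..} f = integral {0<..1} f + integral {1..} f"
    by (simp add: integral_unique)
  then show ?thesis
    using Beta_integral_complex(2)[OF p q pq] unfolding 1[symmetric]
    by (simp only: f_def half_Beta_def add.commute)
qed


text \<open>The substitution \<open>x = 2 Q(v) / v\<^sup>2\<close> with \<open>Q(v) = v\<^sup>2/2 + v + 1/4\<close>.\<close>

lemma integral_half_Beta_substitution:
  fixes p q :: complex
  defines "Q \<equiv> \<lambda>v::real. v\<^sup>2 / 2 + v + 1 / 4"
  assumes "Re p < 1" "Re q > 0" "Re (p + q) > 1"
  shows "(\<lambda>v. of_real v powr (2 * p + 2 * q - 3) * of_real (Q v) powr (- p) * of_real (2 * v + 1) powr (1 - 2 * q))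
           absolutely_integrable_on {0<..}"
    and "integral {0<..} (\<lambda>v. of_real v powr (2 * p + 2 * q - 3) * of_real (Q v) powr (- p) * of_real (2 * v + 1) powr (1 - 2 * q))
           = 2 powr (p - q) * half_Beta p q"
proof -
  define g where "g = (\<lambda>v::real. 1 + 2 / v + 1 / (2 * v\<^sup>2))"
  define f where "f = (\<lambda>x. complex_of_real x powr (- p) * of_real (1 + x) powr (- q))"
  define F where "F = (\<lambda>v. of_real v powr (2 * p + 2 * q - 3) * of_real (Q v) powr (- p) * complex_of_real (2 * v + 1) powr (1 - 2 * q))"
  \<comment> \<open>From 1 + x = (2 + 1/v)^2 / 2 follows 2 + 1/v = sqrt(2x + 2), hence this inverse;
    x > 1 makes it positive.\<close>
  have g_inv: "g (1 / (sqrt (2 * x + 2) - 2)) = x" if "x > 1" for x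
  proof -
    have "sqrt (2 * x + 2) > sqrt 4"
      using that by (subst real_sqrt_less_iff) auto
    then have "sqrt (2 * x + 2) - 2 > 0"
      by simp
    then have "g (1 / (sqrt (2 * x + 2) - 2)) = 1 + 2 * (sqrt (2 * x + 2) - 2) + (sqrt (2 * x + 2) - 2)\<^sup>2 / 2"
      by (simp add: g_def power_divide)
    also have "\<dots> = (sqrt (2 * x + 2))\<^sup>2 / 2 - 1"
      by (simp add: power2_diff field_simps)
    also have "\<dots> = x"
      using that by (simp add: field_simps)
    finally show ?thesis .
  qed
  have img: "g ` {0<..} = {1<..}"
  proof (intro set_eqI iffI)
    fix x :: real assume x: "x \<in> {1<..}"
    have "sqrt (2 * x + 2) > sqrt 4"
      using x by (subst real_sqrt_less_iff) auto
    then have "1 / (sqrt (2 * x + 2) - 2) \<in> {0<..}"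
      by simp
    then show "x \<in> g ` {0<..}"
      using g_inv[of x] x by (metis greaterThan_iff image_eqI)
  next
    fix x assume "x \<in> g ` {0<..}"
    then obtain v where "v > 0" "x = g v"
      by auto
    moreover have "2 / v + 1 / (2 * v\<^sup>2) > 0"
      using \<open>v > 0\<close> by (simp add: add_pos_pos)
    ultimately show "x \<in> {1<..}"
      by (simp add: g_def)
  qed
  have mono: "g w < g v" if "0 < v" "v < w" for v w
  proof -
    have "2 / w < 2 / v"
      using that by (simp add: field_simps)
    moreover have "1 / (2 * w\<^sup>2) < 1 / (2 * v\<^sup>2)"
      using that by (intro divide_strict_left_mono) (auto intro!: power_strict_mono)
    ultimately show ?thesis
      by (simp add: g_def)
  qed
  have inj: "inj_on g {0<..}"
    by (rule inj_onI) (metis greaterThan_iff linorder_neqE mono order_less_irrefl)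
  have deriv: "(g has_field_derivative - ((2 * v + 1) / v ^ 3)) (at v within {0<..})" if "v \<in> {0<..}" for v
    unfolding g_def using that
    by (auto intro!: derivative_eq_intros simp: field_simps power2_eq_square power3_eq_cube)
  have f_int: "f absolutely_integrable_on {1<..}"
    unfolding f_def by (rule set_integrable_subset[OF Beta_integral_complex(1)]) (use assms in auto)
  have f_eq: "integral {1<..} f = half_Beta p q"
    unfolding half_Beta_def f_def
    by (rule integral_spike_set) (auto intro: negligible_subset[of "{1}"])
  have sub: "(\<lambda>v. \<bar>- ((2 * v + 1) / v ^ 3)\<bar> *\<^sub>R f (g v)) absolutely_integrable_on {0<..} \<and>
      integral {0<..} (\<lambda>v. \<bar>- ((2 * v + 1) / v ^ 3)\<bar> *\<^sub>R f (g v)) = half_Beta p q"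
    by (subst has_absolute_integral_change_of_variables_real[where b = "half_Beta p q", OF _ deriv inj])
       (use f_int f_eq in \<open>auto simp: img\<close>)
  \<comment> \<open>All bases are positive reals, so both sides are exponentials of combinations of
    ln 2, ln v, ln Q(v) and ln(2v+1), and only exponents are compared.\<close>
  have eq: "\<bar>- ((2 * v + 1) / v ^ 3)\<bar> *\<^sub>R f (g v) = 2 powr (q - p) * F v" if "v \<in> {0<..}" for v
  proof -
    have v: "v > 0"
      using that by simp
    have Q: "Q v > 0"
      using v by (simp add: Q_def add_pos_pos)
    have "g v = 2 * Q v / v\<^sup>2"
      using v by (simp add: g_def Q_def field_simps power2_eq_square)
    then have g: "g v > 0" "ln (g v) = ln 2 + ln (Q v) - 2 * ln v"
      using v Q by (simp_all add: ln_div ln_mult ln_realpow)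
    have "1 + g v = (2 * v + 1)\<^sup>2 / (2 * v\<^sup>2)"
      using v by (simp add: g_def field_simps power2_eq_square)
    then have g1: "1 + g v > 0" "ln (1 + g v) = 2 * ln (2 * v + 1) - ln 2 - 2 * ln v"
      using v by (simp_all add: ln_div ln_mult ln_realpow)
    have "complex_of_real \<bar>- ((2 * v + 1) / v ^ 3)\<bar> = of_real (exp (ln (2 * v + 1) - 3 * ln v))"
    proof -
      have "exp (3 * ln v) = v ^ 3"
        using v by (metis exp_ln exp_of_nat_mult of_nat_numeral)
      then show ?thesis
        using v by (simp add: exp_diff)
    qed
    then have "\<bar>- ((2 * v + 1) / v ^ 3)\<bar> *\<^sub>R f (g v) =
       exp (of_real (ln (2 * v + 1) - 3 * ln v)) *
        (exp (- p * of_real (ln 2 + ln (Q v) - 2 * ln v)) * exp (- q * of_real (2 * ln (2 * v + 1) - ln 2 - 2 * ln v)))"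
      unfolding f_def scaleR_conv_of_real using g g1 by (simp only: of_real_powr_eq_exp exp_of_real)
    also have "\<dots> = exp ((q - p) * of_real (ln 2)) * (exp ((2 * p + 2 * q - 3) * of_real (ln v)) *
        exp (- p * of_real (ln (Q v))) * exp ((1 - 2 * q) * of_real (ln (2 * v + 1))))"
      by (simp only: flip: exp_add) (rule arg_cong[of _ _ exp], simp add: algebra_simps)
    also have "\<dots> = 2 powr (q - p) * F v"
      using v Q of_real_powr_eq_exp[of 2] by (simp add: F_def of_real_powr_eq_exp del: of_real_add of_real_mult)
    finally show ?thesis .
  qed
  have sub': "(\<lambda>v. 2 powr (q - p) * F v) absolutely_integrable_on {0<..}"
    "integral {0<..} (\<lambda>v. 2 powr (q - p) * F v) = half_Beta p q"
  proof -
    show "(\<lambda>v. 2 powr (q - p) * F v) absolutely_integrable_on {0<..}"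
      by (rule absolutely_integrable_cong[OF conjunct1[OF sub]]) (rule eq)
    have "integral {0<..} (\<lambda>v. 2 powr (q - p) * F v) = integral {0<..} (\<lambda>v. \<bar>- ((2 * v + 1) / v ^ 3)\<bar> *\<^sub>R f (g v))"
      by (rule integral_cong) (rule eq[symmetric])
    then show "integral {0<..} (\<lambda>v. 2 powr (q - p) * F v) = half_Beta p q"
      using sub by simp
  qed
  have inv: "(2::complex) powr (p - q) * 2 powr (q - p) = 1"
    by (simp flip: powr_add)
  have "(\<lambda>v. 2 powr (p - q) * (2 powr (q - p) * F v)) absolutely_integrable_on {0<..}"
    by (intro set_integrable_mult_right sub'(1))
  then have "F absolutely_integrable_on {0<..}"
    by (simp only: mult.assoc[symmetric] inv mult_1_left)
  then show "(\<lambda>v. of_real v powr (2 * p + 2 * q - 3) * of_real (Q v) powr (- p) * of_real (2 * v + 1) powr (1 - 2 * q))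
           absolutely_integrable_on {0<..}"
    by (simp only: F_def)
  have "integral {0<..} F = 2 powr (p - q) * (2 powr (q - p) * integral {0<..} F)"
    by (simp only: mult.assoc[symmetric] inv mult_1_left)
  also have "2 powr (q - p) * integral {0<..} F = half_Beta p q"
    using sub'(2) by simp
  finally show "integral {0<..} (\<lambda>v. of_real v powr (2 * p + 2 * q - 3) * of_real (Q v) powr (- p) * of_real (2 * v + 1) powr (1 - 2 * q))
           = 2 powr (p - q) * half_Beta p q"
    by (simp only: F_def)
qed


section \<open>Moments of the parabolic cylinder function on the half-line\<close>

lemma absolutely_integrable_scale:
  fixes f :: "real \<Rightarrow> 'a::euclidean_space"
  assumes "f absolutely_integrable_on {0<..}" "r > 0"
  shows "(\<lambda>s. r *\<^sub>R f (r * s)) absolutely_integrable_on {0<..}"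
    and "integral {0<..} (\<lambda>s. r *\<^sub>R f (r * s)) = integral {0<..} f"
proof -
  have "(\<lambda>s. \<bar>r\<bar> *\<^sub>R f (r * s)) absolutely_integrable_on {0<..} \<and>
      integral {0<..} (\<lambda>s. \<bar>r\<bar> *\<^sub>R f (r * s)) = integral {0<..} f"
    by (subst has_absolute_integral_change_of_variables_real[where g = "\<lambda>s. r * s"])
       (use assms in \<open>auto intro!: derivative_eq_intros inj_onI simp: image_mult_Ioi\<close>)
  then show "(\<lambda>s. r *\<^sub>R f (r * s)) absolutely_integrable_on {0<..}"
    and "integral {0<..} (\<lambda>s. r *\<^sub>R f (r * s)) = integral {0<..} f"
    using assms(2) by simp_all
qed

text \<open>Insert the Laplace representation and put s = t v. The exponents t^2/4, s^2/2 and t s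
  combine to t^2 Q(v) with Q(v) = v^2/2 + v + 1/4, and after exchanging the integrals the one over t
  is a Gaussian moment.\<close>

lemma pcU_moment_integral:
  fixes R :: nat and a :: complex
  assumes a: "Re a > -1/2"
  defines "b \<equiv> a + 1 / 2"
  shows "(\<lambda>t. of_real t ^ R * pcU a (of_real t)) absolutely_integrable_on {0<..}"
    and "(\<lambda>v. of_real v powr (b - 1) * of_real (v\<^sup>2 / 2 + v + 1 / 4) powr (- ((b + of_nat R + 1) / 2))) absolutely_integrable_on {0<..}"
    and "Gamma b * integral {0<..} (\<lambda>t. of_real t ^ R * pcU a (of_real t)) =
           Gamma ((b + of_nat R + 1) / 2) / 2 *
             integral {0<..} (\<lambda>v. of_real v powr (b - 1) * of_real (v\<^sup>2 / 2 + v + 1 / 4) powr (- ((b + of_nat R + 1) / 2)))"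
proof -
  have b: "Re b > 0"
    using a by (simp add: b_def)
  define Q where "Q = (\<lambda>v::real. v\<^sup>2 / 2 + v + 1 / 4)"
  define F where "F = (\<lambda>t v. complex_of_real t powr (b + of_nat R) * (of_real v powr (b - 1) * exp (- (of_real (Q v) * of_real t ^ 2))))"
  define f where "f = (\<lambda>t s. complex_of_real s powr (b - 1) * exp (- (1 / 2 * of_real s ^ 2) - of_real t * of_real s))"
  have f_int: "f t absolutely_integrable_on {0<..}" and f_eq: "integral {0<..} (f t) = gauss_laplace b (1 / 2) (of_real t)" for t
    using absolutely_integrable_gauss_laplace[OF b, of "1 / 2" "of_real t"] by (simp_all add: f_def gauss_laplace_def)
  have F_eq: "F t v = of_real t ^ R * exp (- (of_real t ^ 2 / 4)) * (t *\<^sub>R f t (t * v))" if "t > 0" "v > 0" for t v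
  proof -
    have "complex_of_real t powr (b + of_nat R) = of_real t ^ R * of_real t * of_real t powr (b - 1)"
      using that of_real_powr_nat_add[of t "b - 1" 1] by (simp add: of_real_powr_nat_add mult_ac)
    moreover have "complex_of_real (t * v) powr (b - 1) = of_real t powr (b - 1) * of_real v powr (b - 1)"
      using that powr_times_real[of "of_real t" "of_real v"] by simp
    moreover have "exp (- (complex_of_real (Q v) * of_real t ^ 2)) =
        exp (- (of_real t ^ 2 / 4)) * exp (- (1 / 2 * of_real (t * v) ^ 2) - of_real t * of_real (t * v))"
      by (simp only: flip: exp_add) (rule arg_cong[of _ _ exp], simp add: Q_def field_simps power2_eq_square)
    ultimately show ?thesis
      by (simp only: F_def f_def scaleR_conv_of_real mult_ac)
  qed
  have intv: "F t absolutely_integrable_on {0<..}"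
    and eqv: "integral {0<..} (F t) = of_real t ^ R * exp (- (of_real t ^ 2 / 4)) * gauss_laplace b (1 / 2) (of_real t)"
    if "t \<in> {0<..}" for t
  proof -
    have "(\<lambda>v. of_real t ^ R * exp (- (of_real t ^ 2 / 4)) * (t *\<^sub>R f t (t * v))) absolutely_integrable_on {0<..}"
      using that by (intro set_integrable_mult_right absolutely_integrable_scale f_int) auto
    then show "F t absolutely_integrable_on {0<..}"
      by (rule absolutely_integrable_cong) (use that F_eq in auto)
    have "integral {0<..} (F t) = integral {0<..} (\<lambda>v. of_real t ^ R * exp (- (of_real t ^ 2 / 4)) * (t *\<^sub>R f t (t * v)))"
      by (rule integral_cong) (use that F_eq in auto)
    also have "\<dots> = of_real t ^ R * exp (- (of_real t ^ 2 / 4)) * gauss_laplace b (1 / 2) (of_real t)"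
      using that by (simp only: integral_mult_right absolutely_integrable_scale(2)[OF f_int] f_eq greaterThan_iff)
    finally show "integral {0<..} (F t) = of_real t ^ R * exp (- (of_real t ^ 2 / 4)) * gauss_laplace b (1 / 2) (of_real t)" .
  qed
  have Q: "Q v > 0" if "v > 0" for v
    using that by (simp add: Q_def add_pos_pos)
  have intt: "(\<lambda>t. F t v) absolutely_integrable_on {0<..}"
    and eqt: "integral {0<..} (\<lambda>t. F t v) = Gamma ((b + of_nat R + 1) / 2) / 2 *
        (of_real v powr (b - 1) * of_real (Q v) powr (- ((b + of_nat R + 1) / 2)))"
    if "v \<in> {0<..}" for v
  proof -
    have F': "(\<lambda>t. F t v) = (\<lambda>t. of_real v powr (b - 1) * (complex_of_real t powr (b + of_nat R + 1 - 1) * exp (- (of_real (Q v) * of_real t ^ 2))))"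
      by (simp add: F_def mult_ac)
    show "(\<lambda>t. F t v) absolutely_integrable_on {0<..}"
      unfolding F' using absolutely_integrable_gauss_laplace[of "b + of_nat R + 1" "of_real (Q v)" 0] b Q that
      by (intro set_integrable_mult_right) (auto simp: add_pos_nonneg)
    show "integral {0<..} (\<lambda>t. F t v) = Gamma ((b + of_nat R + 1) / 2) / 2 *
        (of_real v powr (b - 1) * of_real (Q v) powr (- ((b + of_nat R + 1) / 2)))"
      unfolding F' using integral_Gauss[of "b + of_nat R + 1" "of_real (Q v)"] b Q that
      by (simp add: add_pos_nonneg)
  qed
  \<comment> \<open>Bounds the norm integral of the Laplace integrand for all t > 0 at once, as
    exp(-t s) <= 1; the remaining factor t^R exp(-t^2/4) is integrable.\<close>
  define C where "C = integral {0<..} (\<lambda>s. s powr (Re b - 1) * exp (0 * s - 1 / 2 * s\<^sup>2))"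
  have Fb: "integral {0<..} (\<lambda>v. norm (F t v)) \<le> C * (t powr (real R + 1 - 1) * exp (0 * t - 1 / 4 * t\<^sup>2))"
    if "t \<in> {0<..}" for t
  proof -
    have t: "t > 0"
      using that by simp
    have nf: "(\<lambda>s. norm (f t s)) absolutely_integrable_on {0<..}"
      using set_integrable_norm[OF f_int] .
    have "integral {0<..} (\<lambda>v. norm (F t v)) = integral {0<..} (\<lambda>v. t ^ R * exp (- (t\<^sup>2 / 4)) * (t *\<^sub>R norm (f t (t * v))))"
      by (rule integral_cong) (use t F_eq in \<open>auto simp: norm_mult norm_power simp flip: of_real_power\<close>)
    also have "\<dots> = t ^ R * exp (- (t\<^sup>2 / 4)) * integral {0<..} (\<lambda>s. norm (f t s))"
      using absolutely_integrable_scale(2)[OF nf t] by simp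
    also have "integral {0<..} (\<lambda>s. norm (f t s)) \<le> C"
      unfolding C_def
    proof (rule integral_le)
      show "(\<lambda>s. norm (f t s)) integrable_on {0<..}"
        using nf by (simp add: absolutely_integrable_on_def)
      show "(\<lambda>s. s powr (Re b - 1) * exp (0 * s - 1 / 2 * s\<^sup>2)) integrable_on {0<..}"
        by (rule integrable_powr_gauss) (use b in auto)
      show "norm (f t s) \<le> s powr (Re b - 1) * exp (0 * s - 1 / 2 * s\<^sup>2)" if "s \<in> {0<..}" for s
        using that t by (auto simp: f_def norm_mult norm_of_real_powr intro!: mult_left_mono simp flip: of_real_power)
    qed
    finally show ?thesis
      using t by (simp add: powr_realpow mult_left_mono mult_ac)
  qed
  have gint: "(\<lambda>t. C * (t powr (real R + 1 - 1) * exp (0 * t - 1 / 4 * t\<^sup>2))) integrable_on {0<..}"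
    by (intro integrable_on_mult_right integrable_powr_gauss) auto
  have cont: "continuous_on ({0<..} \<times> {0<..}) (\<lambda>(t, v). F t v)"
    unfolding F_def case_prod_beta Q_def
    by (intro continuous_on_mult continuous_on_of_real_powr' continuous_on_exp continuous_on_minus continuous_on_add
          continuous_on_of_real continuous_on_fst continuous_on_snd continuous_on_id continuous_on_power continuous_on_const continuous_on_divide) auto
  note fub = fubini_absolutely_integrable[OF open_greaterThan open_greaterThan cont intv intt Fb gint]
  have G: "Gamma b \<noteq> 0"
    using b by (rule Gamma_nonzero_Re_pos)
  have G': "Gamma ((b + of_nat R + 1) / 2) / 2 \<noteq> 0"
    using b Gamma_nonzero_Re_pos[of "(b + of_nat R + 1) / 2"] by (auto simp: add_pos_nonneg)
  have pcU_eq: "of_real t ^ R * pcU a (of_real t) = 1 / Gamma b * integral {0<..} (F t)" if "t \<in> {0<..}" for t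
    using eqv[OF that] by (simp add: pcU_def b_def)
  have "(\<lambda>t. 1 / Gamma b * integral {0<..} (F t)) absolutely_integrable_on {0<..}"
    by (intro set_integrable_mult_right fub(2))
  then show "(\<lambda>t. of_real t ^ R * pcU a (of_real t)) absolutely_integrable_on {0<..}"
    by (rule absolutely_integrable_cong) (rule pcU_eq[symmetric])
  define c where "c = Gamma ((b + of_nat R + 1) / 2) / 2"
  define w where "w = (\<lambda>v. complex_of_real v powr (b - 1) * of_real (v\<^sup>2 / 2 + v + 1 / 4) powr (- ((b + of_nat R + 1) / 2)))"
  have eqt': "1 / c * integral {0<..} (\<lambda>t. F t v) = w v" if "v \<in> {0<..}" for v
  proof -
    have "integral {0<..} (\<lambda>t. F t v) = c * w v"
      using eqt[OF that] by (simp only: c_def w_def Q_def)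
    then show ?thesis
      using G' by (simp only: c_def[symmetric]) simp
  qed
  have "(\<lambda>v. 1 / c * integral {0<..} (\<lambda>t. F t v)) absolutely_integrable_on {0<..}"
    by (intro set_integrable_mult_right fub(3))
  then show "w absolutely_integrable_on {0<..}"
    by (rule absolutely_integrable_cong) (rule eqt')
  have "integral {0<..} (\<lambda>t. of_real t ^ R * pcU a (of_real t)) = 1 / Gamma b * integral {0<..} (\<lambda>t. integral {0<..} (F t))"
    by (subst integral_mult_right[symmetric], rule integral_cong, rule pcU_eq)
  then have "Gamma b * integral {0<..} (\<lambda>t. of_real t ^ R * pcU a (of_real t)) = integral {0<..} (\<lambda>t. integral {0<..} (F t))"
    using G by simp
  also have "\<dots> = integral {0<..} (\<lambda>v. integral {0<..} (\<lambda>t. F t v))"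
    by (rule fub(1))
  also have "\<dots> = c * integral {0<..} (\<lambda>v. 1 / c * integral {0<..} (\<lambda>t. F t v))"
    using G' by (subst integral_mult_right) (simp add: c_def)
  also have "integral {0<..} (\<lambda>v. 1 / c * integral {0<..} (\<lambda>t. F t v)) = integral {0<..} w"
    by (rule integral_cong) (rule eqt')
  finally show "Gamma b * integral {0<..} (\<lambda>t. of_real t ^ R * pcU a (of_real t)) = c * integral {0<..} w" .
qed


text \<open>For R = 1 the weight contains Q to the power -(b/2 + 1). The half-Beta substitution
  could match its powers of v and Q only with q = 0, outside its range. Integration by parts leads
  to p = b/2, q = 3/2 instead.\<close>

lemma moment_integral_by_parts:
  fixes b :: complex
  defines "Q \<equiv> \<lambda>v::real. v\<^sup>2 / 2 + v + 1 / 4"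
  assumes b: "Re b > 0"
    and int1: "(\<lambda>v. of_real v powr (b - 1) * of_real (Q v) powr (- (b / 2 + 1))) absolutely_integrable_on {0<..}"
    and int2: "(\<lambda>v. of_real v powr b * of_real (Q v) powr (- (b / 2)) / of_real (2 * v + 1) ^ 2) absolutely_integrable_on {0<..}"
  shows "b * integral {0<..} (\<lambda>v. of_real v powr (b - 1) * of_real (Q v) powr (- (b / 2 + 1))) =
         8 * integral {0<..} (\<lambda>v. of_real v powr b * of_real (Q v) powr (- (b / 2)) / of_real (2 * v + 1) ^ 2)"
proof -
  define f1 where "f1 = (\<lambda>v. complex_of_real v powr (b - 1) * of_real (Q v) powr (- (b / 2 + 1)))"
  define f2 where "f2 = (\<lambda>v. complex_of_real v powr b * of_real (Q v) powr (- (b / 2)) / of_real (2 * v + 1) ^ 2)"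
  \<comment> \<open>Since Q - v Q'/2 = (2v+1)/4, the derivative of v^b Q^(-b/2) is (b/4) v^(b-1)
    Q^(-b/2-1) (2v+1). Dividing by 2v+1 isolates the first integrand, and differentiating 1/(2v+1)
    supplies the second.\<close>
  define G where "G = (\<lambda>v. complex_of_real v powr b * of_real (Q v) powr (- (b / 2)) / of_real (2 * v + 1))"
  define f where "f = (\<lambda>v. b / 4 * f1 v - 2 * f2 v)"
  have Q: "Q v > 0" if "v > 0" for v
    using that by (simp add: Q_def add_pos_pos)
  have deriv: "(G has_vector_derivative f v) (at v)" if v: "v > 0" for v
  proof -
    define z where "z = complex_of_real v"
    define q where "q = z\<^sup>2 / 2 + z + 1 / 4"
    have q: "q = of_real (Q v)"
      by (simp add: q_def z_def Q_def)
    have nz: "z \<notin> \<real>\<^sub>\<le>\<^sub>0" "q \<notin> \<real>\<^sub>\<le>\<^sub>0" "z \<noteq> 0" "q \<noteq> 0"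
      using v Q[OF v] by (auto simp: q z_def)
    have nz2: "2 * z + 1 \<noteq> 0"
      using v by (auto simp: z_def complex_eq_iff)
    define A where "A = z powr (b - 1)"
    define P where "P = q powr (- (b / 2) - 1)"
    have zb: "z powr b = A * z"
      using nz by (simp add: A_def powr_diff)
    have qb: "q powr (- (b / 2)) = P * q"
      using nz by (simp add: P_def powr_diff)
    have "((\<lambda>z. z powr b * (z\<^sup>2 / 2 + z + 1 / 4) powr (- (b / 2)) / (2 * z + 1)) has_field_derivative
       ((b * A * (P * q) + A * z * (- (b / 2) * P * (z + 1))) * (2 * z + 1) - A * z * (P * q) * 2) / (2 * z + 1)\<^sup>2) (at z)"
    proof -
      have d1: "((\<lambda>z. z powr b) has_field_derivative b * A) (at z)"
        unfolding A_def by (rule has_field_derivative_powr[OF nz(1)])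
      have d2: "((\<lambda>z. (z\<^sup>2 / 2 + z + 1 / 4) powr (- (b / 2))) has_field_derivative - (b / 2) * P * (z + 1)) (at z)"
        unfolding P_def
        by (rule DERIV_chain2[where g = "\<lambda>z. z\<^sup>2 / 2 + z + 1 / 4" and f = "\<lambda>q. q powr (- (b / 2))"])
           (use has_field_derivative_powr[OF nz(2), of "- (b / 2)"] in \<open>auto simp: q_def intro!: derivative_eq_intros\<close>)
      have d3: "((\<lambda>z. 2 * z + 1) has_field_derivative 2) (at z)"
        by (auto intro!: derivative_eq_intros)
      show ?thesis
        using DERIV_divide[OF DERIV_mult[OF d1 d2] d3 nz2, folded q_def, unfolded zb qb]
        by (simp add: power2_eq_square mult_ac)
    qed
    also have "((b * A * (P * q) + A * z * (- (b / 2) * P * (z + 1))) * (2 * z + 1) - A * z * (P * q) * 2) / (2 * z + 1)\<^sup>2 =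
       b / 4 * (A * P) - 2 * (A * z * (P * q) / (2 * z + 1)\<^sup>2)"
    proof -
      have "(b * A * (P * q) + A * z * (- (b / 2) * P * (z + 1))) = b / 4 * (A * P) * (2 * z + 1)"
        by (simp add: q_def field_simps power2_eq_square)
      moreover have "n = c * d \<Longrightarrow> d \<noteq> 0 \<Longrightarrow> (n * d - x * 2) / d\<^sup>2 = c - 2 * (x / d\<^sup>2)" for n c d x :: complex
        by (simp add: field_simps power2_eq_square)
      ultimately show ?thesis
        using nz2 by blast
    qed
    also have "\<dots> = f v"
      by (simp add: f_def f1_def f2_def zb[unfolded z_def] qb[unfolded q] A_def P_def z_def q)
    finally have "((\<lambda>z. z powr b * (z\<^sup>2 / 2 + z + 1 / 4) powr (- (b / 2)) / (2 * z + 1)) has_field_derivative f v) (at (of_real v))"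
      by (simp add: z_def)
    from has_vector_derivative_real_field[OF this] show ?thesis
      by (simp add: G_def Q_def)
  qed
  have f1_int: "f1 absolutely_integrable_on {0<..}" and f2_int: "f2 absolutely_integrable_on {0<..}"
    using int1 int2 by (simp_all only: f1_def f2_def)
  then have f_int: "f absolutely_integrable_on {0<..}"
    unfolding f_def by (intro set_integral_diff(1) set_integrable_mult_right)
  have f_cont: "continuous_on {0<..} f"
    unfolding f_def f1_def f2_def Q_def
    by (intro continuous_on_mult continuous_on_diff continuous_on_divide continuous_on_of_real_powr' continuous_on_of_real continuous_on_add
         continuous_on_id continuous_on_power continuous_on_const) (auto simp: add_pos_pos complex_eq_iff)
  have f_set: "set_integrable lborel {0<..} f"
  proof -
    have "(\<lambda>x. indicator {0<..} x *\<^sub>R f x) \<in> borel_measurable borel"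
      by (rule borel_measurable_continuous_on_indicator[OF _ f_cont]) auto
    then show ?thesis
      using f_int unfolding set_integrable_def by (subst (asm) integrable_completion) auto
  qed
  have G_norm: "norm (G v) = v powr Re b * Q v powr (- (Re b / 2)) / (2 * v + 1)" if "v > 0" for v
    using that Q[OF that] by (simp add: G_def norm_mult norm_divide norm_of_real_powr del: of_real_add of_real_mult)
  have lim0: "(G \<longlongrightarrow> 0) (at_right 0)"
  proof (rule Lim_null_comparison)
    show "eventually (\<lambda>v. norm (G v) \<le> v powr Re b * Q v powr (- (Re b / 2)) / (2 * v + 1)) (at_right 0)"
      using eventually_at_right_less[of 0] by eventually_elim (simp add: G_norm)
    show "((\<lambda>v. v powr Re b * Q v powr (- (Re b / 2)) / (2 * v + 1)) \<longlongrightarrow> 0) (at_right 0)"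
      unfolding Q_def using b by real_asymp
  qed
  have lim_inf: "(G \<longlongrightarrow> 0) at_top"
  proof (rule Lim_null_comparison)
    show "eventually (\<lambda>v. norm (G v) \<le> v powr Re b * Q v powr (- (Re b / 2)) / (2 * v + 1)) at_top"
      using eventually_gt_at_top[of 0] by eventually_elim (simp add: G_norm)
    show "((\<lambda>v. v powr Re b * Q v powr (- (Re b / 2)) / (2 * v + 1)) \<longlongrightarrow> 0) at_top"
      unfolding Q_def using b by real_asymp
  qed
  \<comment> \<open>Both boundary values of \<open>G\<close> vanish: at 0 since Re b > 0, at
    infinity since \<open>G\<close> decays like 1/v.\<close>
  have "(LBINT x=0..\<infinity>. f x) = 0 - 0"
  proof (rule interval_integral_FTC_integrable)
    show "isCont f x" if "0 < ereal x" for x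
      using f_cont that by (simp add: continuous_on_eq_continuous_at zero_ereal_def)
    show "(G has_vector_derivative f x) (at x)" if "0 < ereal x" for x
      using deriv that by (simp add: zero_ereal_def)
    show "set_integrable lborel (einterval 0 \<infinity>) f"
      using f_set by (simp add: einterval_def zero_ereal_def greaterThan_def)
  qed (use lim0 lim_inf in \<open>auto simp: zero_ereal_def ereal_tendsto_simps1\<close>)
  then have "integral {0<..} f = 0"
    by (simp add: interval_lebesgue_integral_0_infty set_borel_integral_eq_integral(2)[OF f_set])
  moreover have "integral {0<..} f = b / 4 * integral {0<..} f1 - 2 * integral {0<..} f2"
    unfolding f_def using f1_int f2_int
    by (intro integral_unique has_integral_diff has_integral_mult_right integrable_integral)
       (auto simp: absolutely_integrable_on_def)
  ultimately show ?thesis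
    by (simp add: f1_def f2_def)
qed

text \<open>Here p = (b+1)/2 and q = 1/2, so the factor 2v+1 of the substitution has exponent
  0.\<close>

lemma pcU_moment_0:
  assumes a: "Re a > -1/2" "Re a < 1/2"
  defines "b \<equiv> a + 1 / 2"
  shows "Gamma b * integral {0<..} (\<lambda>t. pcU a (of_real t)) =
           Gamma ((b + 1) / 2) / 2 * 2 powr (b / 2) * half_Beta ((b + 1) / 2) (1 / 2)"
proof -
  have b: "Re b > 0" "Re b < 1"
    using a by (simp_all add: b_def)
  define Q where "Q = (\<lambda>v::real. v\<^sup>2 / 2 + v + 1 / 4)"
  have "integral {0<..} (\<lambda>v. of_real v powr (b - 1) * of_real (Q v) powr (- ((b + 1) / 2))) =
      integral {0<..} (\<lambda>v. of_real v powr (2 * ((b + 1) / 2) + 2 * (1 / 2) - 3) * of_real (Q v) powr (- ((b + 1) / 2)) * of_real (2 * v + 1) powr (1 - 2 * (1 / 2)))"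
  proof (rule integral_cong)
    fix v :: real assume "v \<in> {0<..}"
    then have "complex_of_real (2 * v + 1) \<noteq> 0"
      by (simp only: of_real_eq_0_iff) simp
    moreover have "2 * ((b + 1) / 2) + 2 * (1 / 2) - 3 = b - 1" "1 - 2 * (1 / 2) = (0::complex)"
      by simp_all
    ultimately show "of_real v powr (b - 1) * of_real (Q v) powr (- ((b + 1) / 2)) = 
      of_real v powr (2 * ((b + 1) / 2) + 2 * (1 / 2) - 3) * of_real (Q v) powr (- ((b + 1) / 2)) * complex_of_real (2 * v + 1) powr (1 - 2 * (1 / 2))"
      by (simp only: powr_0 if_False powr_def mult_zero_left exp_zero mult_1_right)
  qed
  also have "\<dots> = 2 powr ((b + 1) / 2 - 1 / 2) * half_Beta ((b + 1) / 2) (1 / 2)"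
    unfolding Q_def by (rule integral_half_Beta_substitution(2)) (use b in \<open>auto simp: field_simps\<close>)
  also have "(b + 1) / 2 - 1 / 2 = b / 2"
    by (simp add: add_divide_distrib)
  finally show ?thesis
    using pcU_moment_integral(3)[OF a(1), of 0, folded b_def]
    by (simp only: Q_def of_nat_0 add_0_right power_0 mult_1_left mult.assoc)
qed

text \<open>After the integration by parts p = b/2 and q = 3/2, so 2v+1 has exponent -2. The
  constants combine to (b/4) Gamma(b/2) 8/b = 2 Gamma(b/2).\<close>

lemma pcU_moment_1:
  assumes a: "Re a > -1/2" "Re a < 1/2"
  defines "b \<equiv> a + 1 / 2"
  shows "Gamma b * integral {0<..} (\<lambda>t. of_real t * pcU a (of_real t)) =
           2 * Gamma (b / 2) * 2 powr (b / 2 - 3 / 2) * half_Beta (b / 2) (3 / 2)"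
proof -
  have b: "Re b > 0" "Re b < 1"
    using a by (simp_all add: b_def)
  define Q where "Q = (\<lambda>v::real. v\<^sup>2 / 2 + v + 1 / 4)"
  have eq: "of_real v powr (2 * (b / 2) + 2 * (3 / 2) - 3) * of_real (Q v) powr (- (b / 2)) * of_real (2 * v + 1) powr (1 - 2 * (3 / 2))
      = of_real v powr b * of_real (Q v) powr (- (b / 2)) / of_real (2 * v + 1) ^ 2" if "v \<in> {0<..}" for v
  proof -
    have "complex_of_real (2 * v + 1) powr (- 2) = 1 / of_real (2 * v + 1) ^ 2"
      using that powr_nat[of "complex_of_real (2 * v + 1)" 2] by (simp add: powr_minus divide_inverse complex_eq_iff)
    then show ?thesis
      by simp
  qed
  have int2: "(\<lambda>v. of_real v powr b * of_real (Q v) powr (- (b / 2)) / of_real (2 * v + 1) ^ 2) absolutely_integrable_on {0<..}"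
  proof (rule absolutely_integrable_cong)
    show "(\<lambda>v. of_real v powr (2 * (b / 2) + 2 * (3 / 2) - 3) * of_real (Q v) powr (- (b / 2)) * of_real (2 * v + 1) powr (1 - 2 * (3 / 2)))
      absolutely_integrable_on {0<..}"
      unfolding Q_def by (rule integral_half_Beta_substitution(1)) (use b in auto)
  qed (rule eq)
  have eq2: "integral {0<..} (\<lambda>v. of_real v powr b * of_real (Q v) powr (- (b / 2)) / of_real (2 * v + 1) ^ 2) =
      2 powr (b / 2 - 3 / 2) * half_Beta (b / 2) (3 / 2)"
    by (subst integral_cong[OF eq[symmetric]], assumption)
       (unfold Q_def, rule integral_half_Beta_substitution(2), use b in auto)
  have exps: "(b + of_nat 1 + 1) / 2 = b / 2 + 1"
    by (simp add: add_divide_distrib)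
  have 1: "b * integral {0<..} (\<lambda>v. of_real v powr (b - 1) * of_real (Q v) powr (- (b / 2 + 1))) =
     8 * (2 powr (b / 2 - 3 / 2) * half_Beta (b / 2) (3 / 2))"
    unfolding eq2[symmetric] Q_def
    using pcU_moment_integral(2)[OF a(1), of 1, folded b_def, unfolded exps] int2 b(1)
    by (intro moment_integral_by_parts) (simp_all only: Q_def)
  have 2: "Gamma (b / 2 + 1) = b / 2 * Gamma (b / 2)"
    using b by (intro Gamma_plus1) (auto elim!: nonpos_Ints_cases simp: complex_eq_iff)
  have 3: "Gamma b * integral {0<..} (\<lambda>t. of_real t * pcU a (of_real t)) =
    Gamma (b / 2 + 1) / 2 * integral {0<..} (\<lambda>v. of_real v powr (b - 1) * of_real (Q v) powr (- (b / 2 + 1)))"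
    using pcU_moment_integral(3)[OF a(1), of 1, folded b_def, unfolded exps] by (simp only: Q_def power_one_right)
  show ?thesis
    unfolding 3 2 using 1 by (simp add: mult.left_commute[of b])
qed

section \<open>Connection constants\<close>

text \<open>\<open>W 0\<close> and \<open>W 3\<close> at parameter -u/2 in terms of
  \<open>pcU\<close>: the powers of -1 and -i in \<open>W\<close> reduce to the parameters -iu/2,
  iu/2 and to rotations by -pi/4, pi/4.\<close>

definition pcW0 :: "real \<Rightarrow> complex \<Rightarrow> complex" where
  "pcW0 u z = pcU (- (\<i> * of_real u / 2)) (z * cis (- (pi / 4)))"

definition pcW3 :: "real \<Rightarrow> complex \<Rightarrow> complex" where
  "pcW3 u z = pcU (\<i> * of_real u / 2) (z * cis (pi / 4))"

definition pcW0' :: "real \<Rightarrow> complex \<Rightarrow> complex" where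
  "pcW0' u z = cis (- (pi / 4)) * pcU' (- (\<i> * of_real u / 2)) (z * cis (- (pi / 4)))"

definition pcW3' :: "real \<Rightarrow> complex \<Rightarrow> complex" where
  "pcW3' u z = cis (pi / 4) * pcU' (\<i> * of_real u / 2) (z * cis (pi / 4))"

text \<open>As w^4 = -1, the rotation reverses the sign of z^2/4 and turns the equation of U into
  the oscillatory one of the W_j.\<close>

lemma ode_solution_pcU_rotate:
  assumes "Re a > -1/2" "w ^ 4 = -1" "w ^ 2 * a = - k"
  shows "ode_solution (\<lambda>z. - (z\<^sup>2 / 4 + k)) (\<lambda>z. pcU a (z * w)) (\<lambda>z. w * pcU' a (z * w))"
  unfolding ode_solution_def
proof (intro allI conjI)
  fix z
  have d: "((\<lambda>z. z * w) has_field_derivative w) (at z)"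
    by (auto intro!: derivative_eq_intros)
  have U: "(pcU a has_field_derivative pcU' a (z * w)) (at (z * w))"
    "(pcU' a has_field_derivative ((z * w)\<^sup>2 / 4 + a) * pcU a (z * w)) (at (z * w))"
    using pcU_ode[OF assms(1)] unfolding ode_solution_def by blast+
  show "((\<lambda>z. pcU a (z * w)) has_field_derivative w * pcU' a (z * w)) (at z)"
    using DERIV_chain2[OF U(1) d] by (simp add: mult.commute)
  have "((\<lambda>z. w * pcU' a (z * w)) has_field_derivative w * (((z * w)\<^sup>2 / 4 + a) * pcU a (z * w) * w)) (at z)"
    by (rule DERIV_cmult[OF DERIV_chain2[OF U(2) d]])
  also have "w * (((z * w)\<^sup>2 / 4 + a) * pcU a (z * w) * w) = (z\<^sup>2 / 4 * w ^ 4 + w ^ 2 * a) * pcU a (z * w)"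
    by (simp add: algebra_simps power2_eq_square power4_eq_xxxx)
  also have "\<dots> = - (z\<^sup>2 / 4 + k) * pcU a (z * w)"
    by (simp add: assms)
  finally show "((\<lambda>z. w * pcU' a (z * w)) has_field_derivative - (z\<^sup>2 / 4 + k) * pcU a (z * w)) (at z)" .
qed

lemma cis_pi_4_power:
  "cis (pi / 4) ^ 2 = \<i>" "cis (- (pi / 4)) ^ 2 = - \<i>" "cis (pi / 4) ^ 4 = -1" "cis (- (pi / 4)) ^ 4 = -1"
  "cis (pi / 4) * cis (- (pi / 4)) = 1"
proof -
  show 1: "cis (pi / 4) ^ 2 = \<i>" and 2: "cis (- (pi / 4)) ^ 2 = - \<i>"
    by (simp_all add: power2_eq_square cis_mult complex_eq_iff)
  have "x ^ 4 = (x\<^sup>2)\<^sup>2" for x :: complex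
    by simp
  then show "cis (pi / 4) ^ 4 = -1" "cis (- (pi / 4)) ^ 4 = -1"
    by (simp_all only: 1 2 power2_minus power2_i)
  show "cis (pi / 4) * cis (- (pi / 4)) = 1"
    by (simp add: cis_mult)
qed

lemma pcW_ode:
  "ode_solution (\<lambda>z. - (z\<^sup>2 / 4 + of_real u / 2)) (pcW0 u) (pcW0' u)"
  "ode_solution (\<lambda>z. - (z\<^sup>2 / 4 + of_real u / 2)) (pcW3 u) (pcW3' u)"
  unfolding pcW0_def [abs_def] pcW0'_def [abs_def] pcW3_def [abs_def] pcW3'_def [abs_def]
  by (rule ode_solution_pcU_rotate; simp add: cis_pi_4_power)+

lemma W_eq_pcW:
  "W 0 (of_real (- u / 2)) z = pcW0 u z" "W 3 (of_real (- u / 2)) z = pcW3 u z"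
proof -
  have e: "exp (- (complex_of_real pi * \<i> / 4)) = cis (- (pi / 4))"
    by (simp add: cis_conv_exp mult.commute)
  show "W 0 (of_real (- u / 2)) z = pcW0 u z"
    by (simp add: W_def e pcW0_def parabolic_cylinder_U_eq)
  have "\<i> * cis (- (pi / 4)) = cis (pi / 4) ^ 2 * cis (- (pi / 4))"
    by (simp only: cis_pi_4_power)
  also have "\<dots> = cis (pi / 4)"
    by (simp add: power2_eq_square mult.assoc cis_pi_4_power)
  finally have "\<i> * cis (- (pi / 4)) = cis (pi / 4)" .
  then have "(- \<i>) ^ 3 * z * cis (- (pi / 4)) = z * cis (pi / 4)"
    by (simp add: power3_eq_cube mult_ac)
  moreover have "(- 1) ^ 3 * \<i> * complex_of_real (- u / 2) = \<i> * of_real u / 2"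
    by simp
  ultimately show "W 3 (of_real (- u / 2)) z = pcW3 u z"
    by (simp only: W_def e) (simp add: pcW3_def parabolic_cylinder_U_eq)
qed

text \<open>With h = 2^(b/2) every power of 2 in the four values becomes a power of h and of sqrt 2,
  so that the later algebra is free of complex powers.\<close>

lemma pcW_0_values:
  fixes u :: real
  assumes b_def: "b = 1 / 2 - \<i> * of_real u / 2" and h_def: "h = 2 powr (b / 2)"
  shows "pcW0 u 0 = Gamma (b / 2) * h / (2 * Gamma b)"
    and "pcW0' u 0 = - cis (- (pi / 4)) * Gamma ((b + 1) / 2) * of_real (sqrt 2) * h / (2 * Gamma b)"
    and "pcW3 u 0 = Gamma ((1 - b) / 2) * of_real (sqrt 2) / (2 * h * Gamma (1 - b))"
    and "pcW3' u 0 = - cis (pi / 4) * Gamma (1 - b / 2) / (h * Gamma (1 - b))"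
    and "pcW0 u 0 \<noteq> 0" "pcW0' u 0 \<noteq> 0" "pcW3 u 0 \<noteq> 0" "pcW3' u 0 \<noteq> 0"
proof -
  have half: "(1 / 2) powr (- x) = 2 powr x" for x :: complex
  proof -
    have "Ln (1 / 2) = - complex_of_real (ln 2)"
      using Ln_of_real[of "1 / 2"] by (simp add: ln_div)
    then show ?thesis
      by (simp add: powr_def Ln_of_real[of 2, simplified])
  qed
  have mom: "gauss_moment (1 / 2) \<beta> = Gamma (\<beta> / 2) / 2 * 2 powr (\<beta> / 2)" for \<beta>
    by (simp add: gauss_moment_def half)
  have r: "complex_of_real (sqrt 2) = 2 powr (1 / 2)"
    using powr_of_real[of 2 "1 / 2"] by (simp add: powr_half_sqrt)
  define a where "a = \<i> * complex_of_real u / 2"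
  have e: "- a + 1 / 2 = b" "- a + 3 / 2 = b + 1" "a + 1 / 2 = 1 - b" "a + 3 / 2 = 2 - b" and Re_a: "Re a = 0"
    by (simp_all add: b_def a_def)
  have U: "pcU (- a) 0 = gauss_moment (1 / 2) b / Gamma b" "pcU' (- a) 0 = - gauss_moment (1 / 2) (b + 1) / Gamma b"
    "pcU a 0 = gauss_moment (1 / 2) (1 - b) / Gamma (1 - b)" "pcU' a 0 = - gauss_moment (1 / 2) (2 - b) / Gamma (1 - b)"
    using pcU_0[of "- a", unfolded e] pcU_0[of a, unfolded e] Re_a by simp_all
  have h1: "2 powr ((b + 1) / 2) = of_real (sqrt 2) * h" "2 powr ((1 - b) / 2) = of_real (sqrt 2) / h"
    "2 powr (1 - b / 2) = 2 / h"
    unfolding h_def r by (simp_all add: add_divide_distrib diff_divide_distrib powr_add powr_diff)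
  have e2: "(2 - b) / 2 = 1 - b / 2"
    by (simp add: diff_divide_distrib)
  show "pcW0 u 0 = Gamma (b / 2) * h / (2 * Gamma b)"
    by (simp add: pcW0_def U[unfolded a_def] mom h_def)
  show "pcW0' u 0 = - cis (- (pi / 4)) * Gamma ((b + 1) / 2) * of_real (sqrt 2) * h / (2 * Gamma b)"
    by (simp add: pcW0'_def U[unfolded a_def] mom h1 mult_ac)
  show "pcW3 u 0 = Gamma ((1 - b) / 2) * of_real (sqrt 2) / (2 * h * Gamma (1 - b))"
    by (simp add: pcW3_def U[unfolded a_def] mom h1 mult_ac)
  show "pcW3' u 0 = - cis (pi / 4) * Gamma (1 - b / 2) / (h * Gamma (1 - b))"
    by (simp add: pcW3'_def U[unfolded a_def] mom e2 h1 mult_ac)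
  show "pcW0 u 0 \<noteq> 0" "pcW0' u 0 \<noteq> 0" "pcW3 u 0 \<noteq> 0" "pcW3' u 0 \<noteq> 0"
    by (simp_all add: pcW0_def pcW0'_def pcW3_def pcW3'_def pcU_0_nonzero)
qed

lemma Gamma_duplication_powr:
  assumes "Re b > 0"
  shows "Gamma (b / 2) * Gamma ((b + 1) / 2) = 2 powr (1 - b) * of_real (sqrt pi) * Gamma b"
proof -
  have "b / 2 \<notin> \<int>\<^sub>\<le>\<^sub>0" "b / 2 + 1 / 2 \<notin> \<int>\<^sub>\<le>\<^sub>0"
    using assms by (auto elim!: nonpos_Ints_cases simp: complex_eq_iff)
  from Gamma_legendre_duplication[OF this] show ?thesis
    by (simp add: powr_def Ln_of_real[of 2, simplified] add_divide_distrib)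
qed

text \<open>Duplication and reflection at b = 1/2 - iu/2, in the form that eliminates all Gamma
  values. The last two facts rest on exp(i pi b/2) = cis(pi/4) exp(pi u/4), which turns the sine and
  cosine of the reflection formula into expressions in \<epsilon> = exp(-pi u/2).\<close>

lemma Gamma_constants:
  fixes u :: real
  assumes b_def: "b = 1 / 2 - \<i> * of_real u / 2" and h_def: "h = 2 powr (b / 2)"
  shows "h \<noteq> 0" "Gamma b \<noteq> 0" "Gamma (1 - b) \<noteq> 0" "Gamma (b / 2) \<noteq> 0" "Gamma ((b + 1) / 2) \<noteq> 0"
    "Gamma ((1 - b) / 2) \<noteq> 0" "Gamma (1 - b / 2) \<noteq> 0"
    and "Gamma (b / 2) * Gamma ((b + 1) / 2) = 2 / h\<^sup>2 * of_real (sqrt pi) * Gamma b"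
    and "Gamma ((1 - b) / 2) * Gamma (1 - b / 2) = h\<^sup>2 * of_real (sqrt pi) * Gamma (1 - b)"
    and "Gamma (b / 2) * Gamma (1 - b / 2) * sin (of_real pi * b / 2) = of_real pi"
    and "Gamma ((b + 1) / 2) * Gamma ((1 - b) / 2) * cos (of_real pi * b / 2) = of_real pi"
    and "2 * (cis (pi / 4) * of_real (exp (- (pi * u / 4)))) * sin (of_real pi * b / 2) = 1 + \<i> * of_real (exp (- (pi * u / 2)))"
    and "2 * (cis (pi / 4) * of_real (exp (- (pi * u / 4)))) * (\<i> * cos (of_real pi * b / 2)) = \<i> * of_real (exp (- (pi * u / 2))) - 1"
proof -
  show "h \<noteq> 0" "Gamma b \<noteq> 0" "Gamma (1 - b) \<noteq> 0" "Gamma (b / 2) \<noteq> 0" and g2: "Gamma ((b + 1) / 2) \<noteq> 0"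
    "Gamma ((1 - b) / 2) \<noteq> 0" and g4: "Gamma (1 - b / 2) \<noteq> 0"
    by (auto simp: b_def h_def intro!: Gamma_nonzero_Re_pos)
  have h2: "h\<^sup>2 = 2 powr b"
    by (simp add: h_def power2_eq_square flip: powr_add)
  show "Gamma (b / 2) * Gamma ((b + 1) / 2) = 2 / h\<^sup>2 * of_real (sqrt pi) * Gamma b"
  proof -
    have "2 powr (1 - b) = 2 / h\<^sup>2"
      by (simp add: h2 powr_diff)
    then show ?thesis
      using Gamma_duplication_powr[of b] by (simp only:) (simp add: b_def)
  qed
  have e: "(1 - b + 1) / 2 = 1 - b / 2"
    by (simp add: field_simps)
  show "Gamma ((1 - b) / 2) * Gamma (1 - b / 2) = h\<^sup>2 * of_real (sqrt pi) * Gamma (1 - b)"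
    using Gamma_duplication_powr[of "1 - b"] unfolding e h2 by (simp add: b_def)
  have sin: "sin (of_real pi * b / 2) = of_real pi / (Gamma (b / 2) * Gamma (1 - b / 2))"
    unfolding Gamma_reflection_complex by simp
  show "Gamma (b / 2) * Gamma (1 - b / 2) * sin (of_real pi * b / 2) = of_real pi"
    unfolding sin using \<open>Gamma (b / 2) \<noteq> 0\<close> g4 by simp
  \<comment> \<open>The cosine at pi b/2 is the sine at pi x, so the reflection formula applies at
    x.\<close>
  define x where "x = (b + 1) / 2"
  have "cos (of_real pi * b / 2) = sin (of_real pi * x)"
    by (simp add: x_def distrib_left add_divide_distrib sin_add)
  moreover have x: "1 - x = (1 - b) / 2"
    by (simp add: x_def field_simps)
  moreover have "sin (of_real pi * x) = of_real pi / (Gamma x * Gamma (1 - x))"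
    unfolding Gamma_reflection_complex by simp
  ultimately have cos: "cos (of_real pi * b / 2) = of_real pi / (Gamma ((b + 1) / 2) * Gamma ((1 - b) / 2))"
    by (simp only: x) (simp only: x_def)
  show "Gamma ((b + 1) / 2) * Gamma ((1 - b) / 2) * cos (of_real pi * b / 2) = of_real pi"
    unfolding cos using g2 \<open>Gamma ((1 - b) / 2) \<noteq> 0\<close> by simp
  define E where "E = cis (pi / 4) * of_real (exp (- (pi * u / 4)))"
  have ex: "exp (\<i> * (of_real pi * b / 2)) = cis (pi / 4) * of_real (exp (pi * u / 4))"
    by (simp add: b_def cis_conv_exp field_simps flip: exp_of_real exp_add)
  have ex': "exp (- (\<i> * (of_real pi * b / 2))) = cis (- (pi / 4)) * of_real (exp (- (pi * u / 4)))"
    unfolding exp_minus ex by (simp add: exp_minus)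
  have "exp (- (pi * u / 4)) * exp (pi * u / 4) = 1" "exp (- (pi * u / 4)) * exp (- (pi * u / 4)) = exp (- (pi * u / 2))"
    by (simp_all flip: exp_add)
  then have e: "complex_of_real (exp (- (pi * u / 4))) * of_real (exp (pi * u / 4)) = 1"
    "complex_of_real (exp (- (pi * u / 4))) * of_real (exp (- (pi * u / 4))) = of_real (exp (- (pi * u / 2)))"
    by (simp_all only: flip: of_real_mult) simp_all
  have "E * exp (\<i> * (of_real pi * b / 2)) =
      cis (pi / 4) ^ 2 * (complex_of_real (exp (- (pi * u / 4))) * of_real (exp (pi * u / 4)))"
    unfolding ex E_def power2_eq_square by (simp only: mult_ac)
  then have E1: "E * exp (\<i> * (of_real pi * b / 2)) = \<i>"
    by (simp only: e cis_pi_4_power mult_1_right)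
  have "E * exp (- (\<i> * (of_real pi * b / 2))) = (cis (pi / 4) * cis (- (pi / 4))) *
      (complex_of_real (exp (- (pi * u / 4))) * of_real (exp (- (pi * u / 4))))"
    unfolding ex' E_def by (simp only: mult_ac)
  then have E2: "E * exp (- (\<i> * (of_real pi * b / 2))) = of_real (exp (- (pi * u / 2)))"
    by (simp only: e cis_pi_4_power mult_1_left)
  have "2 * E * sin (of_real pi * b / 2) = (E * exp (\<i> * (of_real pi * b / 2)) - E * exp (- (\<i> * (of_real pi * b / 2)))) / \<i>"
    by (simp add: sin_exp_eq field_simps)
  also have "\<dots> = 1 + \<i> * of_real (exp (- (pi * u / 2)))"
    unfolding E1 E2 by (simp add: field_simps)
  finally show "2 * (cis (pi / 4) * of_real (exp (- (pi * u / 4)))) * sin (of_real pi * b / 2) = 1 + \<i> * of_real (exp (- (pi * u / 2)))"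
    by (simp only: E_def)
  have "2 * E * (\<i> * cos (of_real pi * b / 2)) = \<i> * (E * exp (\<i> * (of_real pi * b / 2)) + E * exp (- (\<i> * (of_real pi * b / 2))))"
    by (simp add: cos_exp_eq field_simps)
  also have "\<dots> = \<i> * of_real (exp (- (pi * u / 2))) - 1"
    unfolding E1 E2 by (simp add: field_simps)
  finally show "2 * (cis (pi / 4) * of_real (exp (- (pi * u / 4)))) * (\<i> * cos (of_real pi * b / 2)) = \<i> * of_real (exp (- (pi * u / 2))) - 1"
    by (simp only: E_def)
qed

lemma c3_eq:
  "c3 u = of_real (sqrt 2) * of_real (sqrt pi) * (cis (pi / 4) * of_real (exp (- (pi * u / 4)))) / Gamma (1 / 2 - \<i> * of_real u / 2)"
proof -
  have "exp (complex_of_real pi * \<i> / 4) = cis (pi / 4)"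
    by (simp add: cis_conv_exp mult.commute)
  then show ?thesis
    by (simp add: c3_def real_sqrt_mult flip: exp_of_real)
qed

lemma c3_nonzero: "c3 u \<noteq> 0"
  using Gamma_constants(2)[OF refl refl, of u] by (simp add: c3_eq)

text \<open>Value and derivative at 0 of c_3 W_3(z) = W_0(-z) + i \<epsilon> W_0(z); the -1 in the
  second comes from differentiating W_0(-z).\<close>

lemma c3_connection:
  "c3 u * pcW3 u 0 = (1 + \<i> * of_real (exp (- (pi * u / 2)))) * pcW0 u 0"
  "c3 u * pcW3' u 0 = (\<i> * of_real (exp (- (pi * u / 2))) - 1) * pcW0' u 0"
proof -
  define b where "b = 1 / 2 - \<i> * of_real u / 2"
  define h where "h = 2 powr (b / 2)"
  define g1 where "g1 = Gamma (b / 2)"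
  define g2 where "g2 = Gamma ((b + 1) / 2)"
  define g3 where "g3 = Gamma ((1 - b) / 2)"
  define g4 where "g4 = Gamma (1 - b / 2)"
  define G where "G = Gamma b"
  define G' where "G' = Gamma (1 - b)"
  define s where "s = complex_of_real (sqrt pi)"
  define r where "r = complex_of_real (sqrt 2)"
  define S where "S = sin (of_real pi * b / 2)"
  define C where "C = cos (of_real pi * b / 2)"
  define e where "e = complex_of_real (exp (- (pi * u / 2)))"
  define w0 where "w0 = cis (- (pi / 4))"
  define w3 where "w3 = cis (pi / 4)"
  define E where "E = w3 * complex_of_real (exp (- (pi * u / 4)))"
  have s2: "complex_of_real pi = s * s"
    by (simp add: s_def flip: of_real_mult)
  have r2: "r * r = 2"
    by (simp add: r_def flip: of_real_mult)
  note K = Gamma_constants[OF b_def h_def, folded g1_def g2_def g3_def g4_def G_def G'_def s_def r_def w0_def w3_def S_def C_def e_def, folded E_def, unfolded s2]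
  note V = pcW_0_values[OF b_def h_def, folded g1_def g2_def g3_def g4_def G_def G'_def s_def r_def w0_def w3_def]
  have c3: "c3 u = r * s * E / G"
    by (simp only: c3_eq r_def s_def E_def w3_def G_def b_def)
  have w: "w3 = \<i> * w0"
    using cis_pi_4_power(1,5) unfolding w3_def w0_def by (metis mult.assoc mult.right_neutral power2_eq_square)
  have s0: "s \<noteq> 0"
    by (simp add: s_def)
  \<comment> \<open>Duplication knows only g3 g4 and reflection only g1 g4, so the claim is
    multiplied by g4, which is then cancelled. The next fact does the same with g3.\<close>
  have 1: "s * g3 = S * g1 * h\<^sup>2 * G'"
  proof -
    have "(s * g3) * g4 = s * (g3 * g4)"
      by simp
    also have "\<dots> = (g1 * g4 * S) * h\<^sup>2 * G'"
      unfolding K(9,10) by simp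
    finally have "(s * g3) * g4 = (S * g1 * h\<^sup>2 * G') * g4"
      by (simp only: mult_ac)
    then show ?thesis
      using K(7) by simp
  qed
  have 2: "s * g4 = C * g2 * h\<^sup>2 * G'"
  proof -
    have "(s * g4) * g3 = s * (g3 * g4)"
      by simp
    also have "\<dots> = (g2 * g3 * C) * h\<^sup>2 * G'"
      unfolding K(9,11) by simp
    finally have "(s * g4) * g3 = (C * g2 * h\<^sup>2 * G') * g3"
      by (simp only: mult_ac)
    then show ?thesis
      using K(6) by simp
  qed
  have "c3 u * pcW3 u 0 = r * r * E * (s * g3) / (2 * h * G * G')"
    unfolding c3 V(3) by (simp add: mult_ac)
  also have "\<dots> = (2 * E * S) * (g1 * h / (2 * G))"
    unfolding 1 r2 using K(1-3) by (simp add: field_simps power2_eq_square)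
  also have "\<dots> = (1 + \<i> * e) * pcW0 u 0"
    unfolding K(12) V(1) ..
  finally show "c3 u * pcW3 u 0 = (1 + \<i> * of_real (exp (- (pi * u / 2)))) * pcW0 u 0"
    by (simp only: e_def)
  have "c3 u * pcW3' u 0 = - r * E * w3 * (s * g4) / (h * G * G')"
    unfolding c3 V(4) by (simp add: mult_ac)
  also have "\<dots> = (2 * E * (\<i> * C)) * (- w0 * g2 * r * h / (2 * G))"
    unfolding 2 w using K(1-3) by (simp add: field_simps power2_eq_square)
  also have "\<dots> = (\<i> * e - 1) * pcW0' u 0"
    unfolding K(13) V(2) ..
  finally show "c3 u * pcW3' u 0 = (\<i> * of_real (exp (- (pi * u / 2))) - 1) * pcW0' u 0"
    by (simp only: e_def)
qed

text \<open>The integral of t^R W_0(t) from infinity to 0 along the ray of direction cis(pi/4).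
  There the rotation inside W_0 cancels, the R + 1 powers of the direction come from t^R dt, and the
  sign from the orientation.\<close>

definition moment0 :: "real \<Rightarrow> nat \<Rightarrow> complex" where
  "moment0 u R = - (cis (pi / 4) ^ Suc R * integral {0<..} (\<lambda>t. of_real t ^ R * pcU (- (\<i> * of_real u / 2)) (of_real t)))"

definition moment3 :: "real \<Rightarrow> nat \<Rightarrow> complex" where
  "moment3 u R = - (cis (- (pi / 4)) ^ Suc R * integral {0<..} (\<lambda>t. of_real t ^ R * pcU (\<i> * of_real u / 2) (of_real t)))"

text \<open>What remains of the claim for R = 0 and R = 1 once \<open>c3_connection\<close> is used.
  Each moment contains an incomplete Beta integral; in these combinations both get the same
  coefficient, so \<open>half_Beta_reflect\<close> completes them.\<close>

lemma moment_combination: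
  "pcW3' u 0 * moment0 u 0 - pcW0' u 0 * moment3 u 0 = \<i> * of_real (sqrt pi)"
  "pcW3 u 0 * moment0 u 1 - pcW0 u 0 * moment3 u 1 = - 2 * \<i> * of_real (sqrt pi)"
proof -
  define b where "b = 1 / 2 - \<i> * of_real u / 2"
  define h where "h = 2 powr (b / 2)"
  define g1 where "g1 = Gamma (b / 2)"
  define g2 where "g2 = Gamma ((b + 1) / 2)"
  define g3 where "g3 = Gamma ((1 - b) / 2)"
  define g4 where "g4 = Gamma (1 - b / 2)"
  define G where "G = Gamma b"
  define G' where "G' = Gamma (1 - b)"
  define s where "s = complex_of_real (sqrt pi)"
  define r where "r = complex_of_real (sqrt 2)"
  define w0 where "w0 = cis (- (pi / 4))"
  define w3 where "w3 = cis (pi / 4)"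
  define a0 where "a0 = - (\<i> * complex_of_real u / 2)"
  define a3 where "a3 = \<i> * complex_of_real u / 2"
  have s2: "complex_of_real pi = s * s"
    by (simp add: s_def flip: of_real_mult)
  have r2: "r * r = 2" and r0: "r \<noteq> 0"
    by (simp_all add: r_def flip: of_real_mult)
  note K = Gamma_constants(1-9)[OF b_def h_def, folded g1_def g2_def g3_def g4_def G_def G'_def s_def r_def w0_def w3_def]
  note V = pcW_0_values(1-4)[OF b_def h_def, folded g1_def g2_def g3_def g4_def G_def G'_def s_def r_def w0_def w3_def]
  have w: "w3\<^sup>2 = \<i>" "w0\<^sup>2 = - \<i>"
    by (simp_all add: w0_def w3_def cis_pi_4_power)
  have s0: "s \<noteq> 0"
    by (simp add: s_def)
  have r_eq: "r = 2 powr (1 / 2)"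
    unfolding r_def using powr_of_real[of 2 "1 / 2"] by (simp add: powr_half_sqrt)
  have hp: "2 powr ((1 - b) / 2) = r / h" "2 powr (b / 2 - 3 / 2) = h / (2 * r)" "2 powr ((1 - b) / 2 - 3 / 2) = 1 / (2 * h)"
  proof -
    show "2 powr ((1 - b) / 2) = r / h"
      unfolding h_def r_eq by (simp add: diff_divide_distrib powr_diff)
    have "2 powr (3 / 2) = 2 powr (1 + 1 / 2 :: complex)"
      by simp
    also have "\<dots> = 2 * r"
      unfolding powr_add r_eq by simp
    finally have "2 powr (3 / 2) = 2 * r" .
    then show "2 powr (b / 2 - 3 / 2) = h / (2 * r)" "2 powr ((1 - b) / 2 - 3 / 2) = 1 / (2 * h)"
      using \<open>2 powr ((1 - b) / 2) = r / h\<close> r0 by (simp_all add: powr_diff h_def)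
  qed
  have ab: "a0 + 1 / 2 = b" "a3 + 1 / 2 = 1 - b" and a_Re: "Re a0 = 0" "Re a3 = 0"
    by (simp_all add: a0_def a3_def b_def)
  have eb: "(1 - b + 1) / 2 = 1 - b / 2"
    by (simp add: field_simps)
  define H0 where "H0 = half_Beta ((b + 1) / 2) (1 / 2)"
  define H0' where "H0' = half_Beta (1 - b / 2) (1 / 2)"
  define H1 where "H1 = half_Beta (b / 2) (3 / 2)"
  define H1' where "H1' = half_Beta ((1 - b) / 2) (3 / 2)"
  have Re_b: "Re b = 1 / 2"
    by (simp add: b_def)
  have H0: "H0 + H0' = g3 * g1 / s"
  proof -
    have "2 - (b + 1) / 2 - 1 / 2 = 1 - b / 2" "1 - (b + 1) / 2 = (1 - b) / 2" "(b + 1) / 2 + 1 / 2 - 1 = b / 2"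
      by (simp_all add: field_simps)
    then show ?thesis
      using half_Beta_reflect[of "(b + 1) / 2" "1 / 2"] Re_b
      by (simp only: H0_def H0'_def g1_def g3_def s_def Gamma_one_half_complex) simp
  qed
  have H1: "H1 + H1' = 2 * g4 * g2 / s"
  proof -
    have "Gamma (3 / 2 :: complex) = 1 / 2 * Gamma (1 / 2)"
    proof -
      have "(1 / 2 :: complex) \<notin> \<int>\<^sub>\<le>\<^sub>0"
        by (auto elim!: nonpos_Ints_cases simp: complex_eq_iff)
      from Gamma_plus1[OF this] show ?thesis
        by simp
    qed
    then have "Gamma (3 / 2 :: complex) = s / 2"
      by (simp add: s_def Gamma_one_half_complex)
    moreover have "2 - b / 2 - 3 / 2 = (1 - b) / 2" "b / 2 + 3 / 2 - 1 = (b + 1) / 2"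
      by (simp_all add: field_simps)
    ultimately show ?thesis
      using half_Beta_reflect[of "b / 2" "3 / 2"] Re_b
      by (simp only: H1_def H1'_def g2_def g4_def) simp
  qed
  have M0: "G * integral {0<..} (\<lambda>t. pcU a0 (of_real t)) = g2 / 2 * h * H0"
    using pcU_moment_0[of a0] a_Re unfolding ab H0_def h_def G_def G'_def g1_def g2_def g3_def g4_def by simp
  have M0': "G' * integral {0<..} (\<lambda>t. pcU a3 (of_real t)) = g4 / 2 * (r / h) * H0'"
    using pcU_moment_0[of a3] a_Re unfolding ab eb hp H0'_def G_def G'_def g1_def g2_def g3_def g4_def by simp
  have M1: "G * integral {0<..} (\<lambda>t. of_real t * pcU a0 (of_real t)) = 2 * g1 * (h / (2 * r)) * H1"
    using pcU_moment_1[of a0] a_Re unfolding ab hp H1_def G_def G'_def g1_def g2_def g3_def g4_def by simp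
  have M1': "G' * integral {0<..} (\<lambda>t. of_real t * pcU a3 (of_real t)) = 2 * g3 * (1 / (2 * h)) * H1'"
    using pcU_moment_1[of a3] a_Re unfolding ab hp H1'_def G_def G'_def g1_def g2_def g3_def g4_def by simp
  \<comment> \<open>After the half-Betas are added, the four Gamma values occur only through this
    product, to which both duplication formulas apply.\<close>
  have GG: "g1 * g2 * (g3 * g4) = 2 * s\<^sup>2 * G * G'"
    unfolding K(8,9) using K(1) by (simp add: power2_eq_square)
  note nz = K(1-3) r0 s0
  have div: "m = x / c" if "c * m = x" "c \<noteq> 0" for m x c :: complex
    using that by (simp add: field_simps)
  have m0: "moment0 u 0 = - w3 * (g2 / 2 * h * H0 / G)" "moment3 u 0 = - w0 * (g4 / 2 * (r / h) * H0' / G')"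
    using div[OF M0] div[OF M0'] nz unfolding moment0_def moment3_def a0_def a3_def w0_def w3_def by simp_all
  have m1: "moment0 u 1 = - w3\<^sup>2 * (2 * g1 * (h / (2 * r)) * H1 / G)" "moment3 u 1 = - w0\<^sup>2 * (2 * g3 * (1 / (2 * h)) * H1' / G')"
    using div[OF M1] div[OF M1'] nz unfolding moment0_def moment3_def a0_def a3_def w0_def w3_def by (simp_all add: power2_eq_square)
  have "pcW3' u 0 * moment0 u 0 - pcW0' u 0 * moment3 u 0 =
      w3\<^sup>2 * (g4 * g2 * H0 / (2 * G * G')) - w0\<^sup>2 * (g2 * g4 * (r * r) * H0' / (4 * G * G'))"
    unfolding V m0 using nz by (simp add: power2_eq_square mult_ac)
  \<comment> \<open>The values w3^2 = i, w0^2 = -i and r r = 2 make the two coefficients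
    equal.\<close>
  also have "\<dots> = \<i> * (g2 * g4) / (2 * G * G') * (H0 + H0')"
    unfolding w r2 using nz by (simp add: field_simps)
  also have "\<dots> = \<i> * (g1 * g2 * (g3 * g4)) / (2 * s * G * G')"
    unfolding H0 using nz by (simp add: field_simps)
  also have "\<dots> = \<i> * s"
    unfolding GG using nz by (simp add: field_simps power2_eq_square)
  finally show "pcW3' u 0 * moment0 u 0 - pcW0' u 0 * moment3 u 0 = \<i> * of_real (sqrt pi)"
    by (simp only: s_def)
  have "pcW3 u 0 * moment0 u 1 - pcW0 u 0 * moment3 u 1 =
      - w3\<^sup>2 * (g3 * g1 * H1 / (2 * G * G')) + w0\<^sup>2 * (g1 * g3 * H1' / (2 * G * G'))"
    unfolding V m1 using nz by (simp add: mult_ac)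
  also have "\<dots> = - \<i> * (g1 * g3) / (2 * G * G') * (H1 + H1')"
    unfolding w using nz by (simp add: field_simps)
  also have "\<dots> = - \<i> * (g1 * g2 * (g3 * g4)) / (s * G * G')"
    unfolding H1 using nz by (simp add: field_simps)
  also have "\<dots> = - 2 * \<i> * s"
    unfolding GG using nz by (simp add: field_simps power2_eq_square)
  finally show "pcW3 u 0 * moment0 u 1 - pcW0 u 0 * moment3 u 1 = - 2 * \<i> * of_real (sqrt pi)"
    by (simp only: s_def)
qed

section \<open>Moment recursion and hypergeometric recursion\<close>

lemma contour_integral_linepath_primitive:
  assumes "\<And>z. (F has_field_derivative f z) (at z)"
  shows "(f has_contour_integral F b - F a) (linepath a b)"
    and "contour_integral (linepath a b) f = F b - F a"
proof -
  show "(f has_contour_integral F b - F a) (linepath a b)"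
    using contour_integral_primitive[of UNIV F f "linepath a b"] assms by simp
  then show "contour_integral (linepath a b) f = F b - F a"
    by (rule contour_integral_unique)
qed

lemma entire_primitive:
  assumes "f holomorphic_on UNIV"
  obtains F where "\<And>z. (F has_field_derivative f z) (at z)"
  using holomorphic_convex_primitive'[of UNIV f] assms by auto

text \<open>An entire integrand has a primitive, so the path to z may be broken at 0; only the part
  along the ray needs a limit.\<close>

lemma integral_from_infinity_eq:
  assumes f: "f holomorphic_on UNIV"
    and lim: "((\<lambda>r::real. contour_integral (linepath (of_real r * w) 0) f) \<longlongrightarrow> I) at_top"
  shows "integral_from_infinity w z f = I + contour_integral (linepath 0 z) f"
proof -
  obtain F where F: "\<And>z. (F has_field_derivative f z) (at z)"
    using entire_primitive[OF f] by blast
  have "contour_integral (linepath (of_real r * w) z) f =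
      contour_integral (linepath (of_real r * w) 0) f + contour_integral (linepath 0 z) f" for r :: real
    by (simp add: contour_integral_linepath_primitive(2)[OF F])
  then have "((\<lambda>r::real. contour_integral (linepath (of_real r * w) z) f) \<longlongrightarrow> I + contour_integral (linepath 0 z) f) at_top"
    by (simp only:) (intro tendsto_add lim tendsto_const)
  then show ?thesis
    unfolding integral_from_infinity_def by (intro tendsto_Lim) simp
qed

lemma tendsto_integral_Icc_at_top:
  fixes f :: "real \<Rightarrow> complex"
  assumes "f absolutely_integrable_on {0<..}"
  shows "((\<lambda>r. integral {0..r} f) \<longlongrightarrow> integral {0<..} f) at_top"
proof -
  have f: "f absolutely_integrable_on {0..}"
    using assms by (rule absolutely_integrable_spike_set) (auto intro: negligible_subset[of "{0}"])
  have sub: "f absolutely_integrable_on {0..r}" for r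
    by (rule set_integrable_subset[OF f]) auto
  have "((\<lambda>r. (LINT x:{0..r}|lebesgue. f x)) \<longlongrightarrow> (LINT x:{0..}|lebesgue. f x)) at_top"
    by (rule tendsto_set_lebesgue_integral_at_top) (use f in auto)
  then have "((\<lambda>r. integral {0..r} f) \<longlongrightarrow> integral {0..} f) at_top"
    using f sub by (simp add: set_lebesgue_integral_eq_integral)
  also have "integral {0..} f = integral {0<..} f"
    by (rule integral_spike_set) (auto intro: negligible_subset[of "{0}"])
  finally show ?thesis .
qed

lemma pcU_holomorphic:
  assumes "Re a > -1/2"
  shows "pcU a holomorphic_on S"
  using is_parabolic_cylinder_U_pcU[OF assms] holomorphic_on_subset
  unfolding is_parabolic_cylinder_U_def by blast

text \<open>At the point r v of the ray the argument of \<open>pcU a\<close> is r, so the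
  substitution reduces the contour integral to one over the positive axis.\<close>

lemma ray_integral_pcU:
  assumes a: "Re a > -1/2" and vw: "v * w = 1"
  shows "((\<lambda>r::real. contour_integral (linepath (of_real r * v) 0) (\<lambda>z. z ^ R * pcU a (z * w))) \<longlongrightarrow>
           - (v ^ Suc R * integral {0<..} (\<lambda>t. of_real t ^ R * pcU a (of_real t)))) at_top"
proof -
  define g where "g = (\<lambda>t::real. of_real t ^ R * pcU a (of_real t))"
  have "(\<lambda>z. z ^ R * pcU a (z * w)) holomorphic_on UNIV"
    by (intro holomorphic_intros holomorphic_on_compose_gen[OF _ pcU_holomorphic[OF a], unfolded o_def]) auto
  then obtain F where F: "\<And>z. (F has_field_derivative z ^ R * pcU a (z * w)) (at z)"
    using entire_primitive by blast
  have g_int: "(g has_integral (F (of_real r * v) - F 0) / v ^ Suc R) {0..r}" if "r \<ge> 0" for r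
  proof -
    have "((\<lambda>x. F (of_real x * v) / v ^ Suc R) has_vector_derivative g x) (at x within {0..r})" for x
    proof -
      have "((\<lambda>z. z * v) has_field_derivative v) (at (of_real x))"
        by (auto intro!: derivative_eq_intros)
      from DERIV_chain2[OF F this]
      have "((\<lambda>z. F (z * v)) has_field_derivative ((of_real x * v) ^ R * pcU a (of_real x * v * w)) * v) (at (of_real x))" .
      then have "((\<lambda>z. F (z * v) / v ^ Suc R) has_field_derivative ((of_real x * v) ^ R * pcU a (of_real x * v * w)) * v / v ^ Suc R) (at (of_real x))"
        by (rule DERIV_cdivide)
      moreover have "((of_real x * v) ^ R * pcU a (of_real x * v * w)) * v / v ^ Suc R = g x"
        using vw by (auto simp: g_def power_mult_distrib mult.assoc)
      ultimately have "((\<lambda>z. F (z * v) / v ^ Suc R) has_field_derivative g x) (at (of_real x))"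
        by (simp only:)
      from has_vector_derivative_at_within[OF has_vector_derivative_real_field[OF this]] show ?thesis .
    qed
    from fundamental_theorem_of_calculus[OF that this] show ?thesis
      by (simp add: diff_divide_distrib)
  qed
  then have eq: "F 0 - F (of_real r * v) = - (v ^ Suc R * integral {0..r} g)" if "r \<ge> 0" for r
  proof -
    have "integral {0..r} g = (F (of_real r * v) - F 0) / v ^ Suc R"
      by (rule integral_unique[OF g_int[OF that]])
    then show ?thesis
      using vw by (auto simp del: power_Suc)
  qed
  have "((\<lambda>r. - (v ^ Suc R * integral {0..r} g)) \<longlongrightarrow> - (v ^ Suc R * integral {0<..} g)) at_top"
    unfolding g_def
    by (intro tendsto_minus tendsto_mult tendsto_const tendsto_integral_Icc_at_top pcU_moment_integral(1) a)
  then show ?thesis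
    unfolding contour_integral_linepath_primitive(2)[OF F] g_def[symmetric]
    by (rule Lim_transform_eventually)
       (use eventually_ge_at_top[of 0] in \<open>eventually_elim, simp add: eq\<close>)
qed

lemma pcU_decay:
  assumes a: "Re a > -1/2"
  shows "((\<lambda>r::real. of_real r ^ n * pcU a (of_real r)) \<longlongrightarrow> 0) at_top"
    and "((\<lambda>r::real. of_real r ^ n * pcU' a (of_real r)) \<longlongrightarrow> 0) at_top"
proof -
  have deriv_U: "deriv (pcU a) = pcU' a"
    using pcU_ode[OF a] by (auto simp: ode_solution_def intro!: DERIV_imp_deriv)
  obtain C where C: "eventually (\<lambda>x::real. norm (pcU a (of_real x)) \<le> C * exp (- (x\<^sup>2 / 4) + x / 2) \<and>
           norm (pcU' a (of_real x)) \<le> C * exp (- (x\<^sup>2 / 4) + x / 2)) at_top"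
    using is_parabolic_cylinder_U_real_bound[OF a is_parabolic_cylinder_U_pcU[OF a]]
    unfolding deriv_U by blast
  have lim: "((\<lambda>x::real. x ^ n * (C * exp (- (x\<^sup>2 / 4) + x / 2))) \<longlongrightarrow> 0) at_top"
    by real_asymp
  show "((\<lambda>r::real. of_real r ^ n * pcU a (of_real r)) \<longlongrightarrow> 0) at_top"
    by (rule Lim_null_comparison[OF _ lim], use C eventually_ge_at_top[of 0] in eventually_elim)
       (simp add: norm_mult norm_power mult_left_mono)
  show "((\<lambda>r::real. of_real r ^ n * pcU' a (of_real r)) \<longlongrightarrow> 0) at_top"
    by (rule Lim_null_comparison[OF _ lim], use C eventually_ge_at_top[of 0] in eventually_elim)
       (simp add: norm_mult norm_power mult_left_mono)
qed

text \<open>Integrate the differential equation, multiplied by \<open>z\<^sup>R\<close>, along the ray and integrate by parts twice.\<close>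

lemma ray_moment_recursion:
  fixes R :: nat
  assumes ode: "ode_solution (\<lambda>z. - (z\<^sup>2 / 4 + k)) y y'"
    and lim: "\<And>n. ((\<lambda>r::real. contour_integral (linepath (of_real r * v) 0) (\<lambda>z. z ^ n * y z)) \<longlongrightarrow> I n) at_top"
    and decay: "\<And>n. ((\<lambda>r::real. (of_real r * v) ^ n * y (of_real r * v)) \<longlongrightarrow> 0) at_top"
    and decay': "\<And>n. ((\<lambda>r::real. (of_real r * v) ^ n * y' (of_real r * v)) \<longlongrightarrow> 0) at_top"
  shows "I (R + 2) = - 4 * k * I R - 4 * of_nat R * of_nat (R - 1) * I (R - 2)
           - 4 * (if R = 0 then y' 0 else if R = 1 then - y 0 else 0)"
proof -
  have y: "(y has_field_derivative y' z) (at z)" "(y' has_field_derivative - (z\<^sup>2 / 4 + k) * y z) (at z)" for z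
    using ode unfolding ode_solution_def by blast+
  \<comment> \<open>Both integrations by parts at once: P' = z^R y'' - R(R-1) z^(R-2) y, where y''
    is then replaced by means of the equation.\<close>
  define P where "P = (\<lambda>z. z ^ R * y' z - of_nat R * z ^ (R - 1) * y z)"
  define p where "p = (\<lambda>z. - (1 / 4) * (z ^ (R + 2) * y z) + (- k * (z ^ R * y z) + - (of_nat R * of_nat (R - 1)) * (z ^ (R - 2) * y z)))"
  define c where "c = (\<lambda>r n. contour_integral (linepath (complex_of_real r * v) 0) (\<lambda>z. z ^ n * y z))"
  have P: "(P has_field_derivative p z) (at z)" for z
  proof -
    have "(P has_field_derivative
        (z ^ R * (- (z\<^sup>2 / 4 + k) * y z) + of_nat R * z ^ (R - 1) * y' z)
        - (of_nat R * z ^ (R - 1) * y' z + of_nat R * (of_nat (R - 1) * z ^ (R - 1 - 1)) * y z)) (at z)"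
      unfolding P_def
      by (rule derivative_eq_intros y refl | simp)+
    also have "R - 1 - 1 = R - 2"
      by simp
    finally show ?thesis
      by (rule DERIV_cong) (simp add: p_def algebra_simps power2_eq_square)
  qed
  have hol: "(\<lambda>z. z ^ n * y z) holomorphic_on UNIV" for n
    using y(1) by (intro holomorphic_intros) (auto simp: holomorphic_on_open)
  have c: "((\<lambda>z. z ^ n * y z) has_contour_integral c r n) (linepath (of_real r * v) 0)" for r n
    unfolding c_def
    by (intro has_contour_integral_integral contour_integrable_holomorphic_simple[OF hol]) auto
  have "(p has_contour_integral (- (1 / 4) * c r (R + 2) + (- k * c r R + - (of_nat R * of_nat (R - 1)) * c r (R - 2))))
     (linepath (of_real r * v) 0)" for r
    unfolding p_def by (intro has_contour_integral_add has_contour_integral_lmul c)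
  then have eq: "P 0 - P (of_real r * v) =
     - (1 / 4) * c r (R + 2) + (- k * c r R + - (of_nat R * of_nat (R - 1)) * c r (R - 2))" for r
    using contour_integral_linepath_primitive(1)[OF P] has_contour_integral_unique by blast
  have "((\<lambda>r. P 0 - P (of_real r * v)) \<longlongrightarrow> P 0 - (0 - of_nat R * 0)) at_top"
    unfolding P_def mult.assoc[of "of_nat R"]
    by (intro tendsto_diff tendsto_const decay' tendsto_mult[OF tendsto_const decay])
  moreover have "((\<lambda>r. P 0 - P (of_real r * v)) \<longlongrightarrow>
      - (1 / 4) * I (R + 2) + (- k * I R + - (of_nat R * of_nat (R - 1)) * I (R - 2))) at_top"
    unfolding eq c_def by (intro tendsto_add tendsto_mult tendsto_const lim)
  ultimately have "P 0 = - (1 / 4) * I (R + 2) + (- k * I R + - (of_nat R * of_nat (R - 1)) * I (R - 2))"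
    using tendsto_unique[OF trivial_limit_at_top_linorder] by fastforce
  \<comment> \<open>Only R = 0 and R = 1 leave a boundary term at 0. Wherever R - 1 or R - 2 is
    truncated, its coefficient vanishes.\<close>
  moreover have "P 0 = (if R = 0 then y' 0 else if R = 1 then - y 0 else 0)"
    by (auto simp: P_def power_0_left)
  ultimately show ?thesis
    by (simp add: field_simps)
qed

lemma ray_limit_pcW0:
  "((\<lambda>r::real. contour_integral (linepath (of_real r * cis (pi / 4)) 0) (\<lambda>z. z ^ R * pcW0 u z)) \<longlongrightarrow> moment0 u R) at_top"
  unfolding pcW0_def moment0_def by (rule ray_integral_pcU) (simp_all add: cis_pi_4_power)

lemma ray_limit_pcW3:
  "((\<lambda>r::real. contour_integral (linepath (of_real r * cis (- (pi / 4))) 0) (\<lambda>z. z ^ R * pcW3 u z)) \<longlongrightarrow> moment3 u R) at_top"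
  unfolding pcW3_def moment3_def
  by (rule ray_integral_pcU) (use cis_pi_4_power(5) in \<open>simp_all add: mult.commute\<close>)

lemma tendsto_power_mult_rotate:
  fixes f :: "complex \<Rightarrow> complex"
  assumes "((\<lambda>r::real. of_real r ^ n * f (of_real r)) \<longlongrightarrow> 0) at_top" "v * w = 1"
  shows "((\<lambda>r::real. (of_real r * v) ^ n * f (of_real r * v * w)) \<longlongrightarrow> 0) at_top"
  using tendsto_mult[OF tendsto_const[of "v ^ n"] assms(1)] assms(2)
  by (simp add: power_mult_distrib mult.assoc mult.left_commute[of "v ^ n"])

lemma moment0_recursion:
  "moment0 u (R + 2) = - 2 * of_real u * moment0 u R - 4 * of_nat R * of_nat (R - 1) * moment0 u (R - 2)
     - 4 * (if R = 0 then pcW0' u 0 else if R = 1 then - pcW0 u 0 else 0)"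
proof -
  have a: "Re (- (\<i> * complex_of_real u / 2)) > - 1 / 2"
    by simp
  have d: "((\<lambda>r::real. (of_real r * cis (pi / 4)) ^ n * pcW0 u (of_real r * cis (pi / 4))) \<longlongrightarrow> 0) at_top" for n
    unfolding pcW0_def by (rule tendsto_power_mult_rotate[OF pcU_decay(1)[OF a]]) (simp add: cis_pi_4_power)
  have "((\<lambda>r::real. cis (- (pi / 4)) * ((of_real r * cis (pi / 4)) ^ n * pcU' (- (\<i> * of_real u / 2)) (of_real r * cis (pi / 4) * cis (- (pi / 4))))) \<longlongrightarrow> cis (- (pi / 4)) * 0) at_top" for n
    by (intro tendsto_mult[OF tendsto_const] tendsto_power_mult_rotate[OF pcU_decay(2)[OF a]]) (simp add: cis_pi_4_power)
  then have d': "((\<lambda>r::real. (of_real r * cis (pi / 4)) ^ n * pcW0' u (of_real r * cis (pi / 4))) \<longlongrightarrow> 0) at_top" for n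
    unfolding pcW0'_def by (simp only: mult_zero_right mult.left_commute)
  show ?thesis
    using ray_moment_recursion[OF pcW_ode(1) ray_limit_pcW0 d d', of R] by simp
qed

lemma moment3_recursion:
  "moment3 u (R + 2) = - 2 * of_real u * moment3 u R - 4 * of_nat R * of_nat (R - 1) * moment3 u (R - 2)
     - 4 * (if R = 0 then pcW3' u 0 else if R = 1 then - pcW3 u 0 else 0)"
proof -
  have a: "Re (\<i> * complex_of_real u / 2) > - 1 / 2"
    by simp
  have vw: "cis (- (pi / 4)) * cis (pi / 4) = 1"
    using cis_pi_4_power(5) by (simp only: mult.commute)
  have d: "((\<lambda>r::real. (of_real r * cis (- (pi / 4))) ^ n * pcW3 u (of_real r * cis (- (pi / 4)))) \<longlongrightarrow> 0) at_top" for n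
    unfolding pcW3_def by (rule tendsto_power_mult_rotate[OF pcU_decay(1)[OF a] vw])
  have "((\<lambda>r::real. cis (pi / 4) * ((of_real r * cis (- (pi / 4))) ^ n * pcU' (\<i> * of_real u / 2) (of_real r * cis (- (pi / 4)) * cis (pi / 4)))) \<longlongrightarrow> cis (pi / 4) * 0) at_top" for n
    by (intro tendsto_mult[OF tendsto_const] tendsto_power_mult_rotate[OF pcU_decay(2)[OF a] vw])
  then have d': "((\<lambda>r::real. (of_real r * cis (- (pi / 4))) ^ n * pcW3' u (of_real r * cis (- (pi / 4)))) \<longlongrightarrow> 0) at_top" for n
    unfolding pcW3'_def by (simp only: mult_zero_right mult.left_commute)
  show ?thesis
    using ray_moment_recursion[OF pcW_ode(2) ray_limit_pcW3 d d', of R] by simp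
qed

section \<open>The hypergeometric factor\<close>

lemma summable_terminating_2F1:
  fixes a b c x :: complex
  assumes "a = - of_nat m \<or> b = - of_nat m"
  shows "summable (\<lambda>n. g n * (pochhammer a n * pochhammer b n * x ^ n * rGamma (c + of_nat n) / fact n))"
proof (rule summable_finite[of "{..m}"])
  fix n assume "n \<notin> {..m}"
  then have "pochhammer (- of_nat m :: complex) n = 0"
    by (intro pochhammer_of_nat_eq_0_lemma) simp
  then show "g n * (pochhammer a n * pochhammer b n * x ^ n * rGamma (c + of_nat n) / fact n) = 0"
    using assms by auto
qed simp

text \<open>The hypergeometric differential equation, read as a contiguous relation.\<close>

lemma regularized_hyp2F1_contiguous:
  fixes a b c x :: complex
  assumes trm: "a + 1 = - of_nat m \<or> b + 1 = - of_nat m"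
  shows "regularized_hyp2F1 a b c x =
           (c - (a + b + 1) * x) * regularized_hyp2F1 (a + 1) (b + 1) (c + 1) x
           + x * (1 - x) * ((a + 1) * (b + 1)) * regularized_hyp2F1 (a + 2) (b + 2) (c + 2) x"
proof -
  define t where "t = (\<lambda>a b c n. pochhammer a n * pochhammer b n * x ^ n * rGamma (c + of_nat n) / fact n)"
  define f where "f = t (a + 1) (b + 1) (c + 1)"
  define S where "S = (\<Sum>n. f n)"
  define E where "E = (\<Sum>n. of_nat n * f n)"
  have F: "regularized_hyp2F1 a b c x = (\<Sum>n. t a b c n)" for a b c
    by (simp add: regularized_hyp2F1_def t_def)
  have f: "f sums S"
    using summable_terminating_2F1[OF trm, of "\<lambda>_. 1" x "c + 1"]
    by (simp add: S_def f_def t_def summable_sums)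
  have nf: "(\<lambda>n. of_nat n * f n) sums E"
    using summable_terminating_2F1[OF trm, of of_nat x "c + 1"]
    by (simp add: E_def f_def t_def summable_sums)
  have E_eq: "x * ((a + 1) * (b + 1)) * regularized_hyp2F1 (a + 2) (b + 2) (c + 2) x = E"
  \<comment> \<open>A nonzero factor can be cancelled, which also gives the summability of the
    shifted series; if it is 0, all terms \<open>of_nat n * f n\<close> vanish.\<close>
  proof (cases "x * ((a + 1) * (b + 1)) = 0")
    case True
    have "of_nat n * f n = 0" for n
      using True by (cases n) (auto simp: f_def t_def pochhammer_rec)
    then have "E = 0"
      unfolding E_def by (simp only: suminf_zero)
    then show ?thesis
      using True by (simp only: mult_zero_left)
  next
    case False
    have step: "of_nat (Suc n) * f (Suc n) = x * ((a + 1) * (b + 1)) * t (a + 2) (b + 2) (c + 2) n" for n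
      by (simp add: f_def t_def pochhammer_rec add_ac field_simps del: of_nat_Suc) (simp add: algebra_simps)
    have "(\<lambda>n. of_nat (Suc n) * f (Suc n)) sums E"
      using nf by (subst sums_Suc_iff) simp
    then have "(\<lambda>n. x * ((a + 1) * (b + 1)) * t (a + 2) (b + 2) (c + 2) n) sums E"
      by (simp only: step)
    then show ?thesis
      unfolding F using False by (metis sums_mult_D sums_unique suminf_mult sums_summable)
  qed
  \<comment> \<open>The part of the right-hand side that carries an extra factor x, moved up by one
    index to compare powers of x.\<close>
  define g where "g = (\<lambda>n. case n of 0 \<Rightarrow> 0 | Suc k \<Rightarrow> x * ((a + b + 1) * f k + of_nat k * f k))"
  have "(\<lambda>n. g (Suc n)) sums (x * ((a + b + 1) * S + E))"
    unfolding g_def nat.case by (intro sums_mult sums_add f nf)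
  then have g: "g sums (x * ((a + b + 1) * S + E))"
    by (subst (asm) sums_Suc_iff) (simp add: g_def)
  \<comment> \<open>With n = Suc k this is (a+n)(b+n) - n(a+b+n) = a b; for n = 0 it is rGamma(c) =
    c rGamma(c+1).\<close>
  have "t a b c n = c * f n + of_nat n * f n - g n" for n
  proof (cases n)
    case 0
    then show ?thesis
      using rGamma_plus1[of c] by (simp add: g_def f_def t_def)
  next
    case (Suc k)
    have r: "rGamma (c + of_nat (Suc k)) = (c + of_nat (Suc k)) * rGamma (c + of_nat (Suc k) + 1)"
      by (simp only: rGamma_plus1)
    define p where "p = pochhammer (a + 1) k * pochhammer (b + 1) k * x ^ Suc k * rGamma (c + of_nat (Suc k))"
    have pa: "pochhammer (a + 1) (Suc k) = pochhammer (a + 1) k * (a + of_nat (Suc k))"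
      "pochhammer (b + 1) (Suc k) = pochhammer (b + 1) k * (b + of_nat (Suc k))"
      by (simp_all add: pochhammer_Suc add_ac)
    have 1: "t a b c (Suc k) = a * b * p / fact (Suc k)"
      by (simp add: t_def p_def pochhammer_rec mult_ac del: of_nat_Suc)
    have "(c + of_nat (Suc k)) * f (Suc k) = pochhammer (a + 1) (Suc k) * pochhammer (b + 1) (Suc k) * x ^ Suc k * 
        ((c + of_nat (Suc k)) * rGamma (c + of_nat (Suc k) + 1)) / fact (Suc k)"
      by (simp add: f_def t_def add_ac mult_ac del: of_nat_Suc)
    also have "\<dots> = (a + of_nat (Suc k)) * (b + of_nat (Suc k)) * p / fact (Suc k)"
      unfolding r[symmetric] pa p_def by (simp add: mult_ac del: of_nat_Suc)
    finally have 2: "(c + of_nat (Suc k)) * f (Suc k) = (a + of_nat (Suc k)) * (b + of_nat (Suc k)) * p / fact (Suc k)" .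
    have "c + 1 + of_nat k = c + of_nat (Suc k)"
      by simp
    then have "x * f k = p / fact k"
      unfolding f_def t_def p_def by (simp only:) (simp add: mult_ac del: of_nat_Suc)
    also have "\<dots> = of_nat (Suc k) * p / fact (Suc k)"
      by (simp add: field_simps del: of_nat_Suc)
    finally have 3: "x * f k = of_nat (Suc k) * p / fact (Suc k)" .
    have "g (Suc k) = (a + b + of_nat (Suc k)) * (x * f k)"
      by (simp add: g_def algebra_simps)
    then have "c * f n + of_nat n * f n - g n = (c + of_nat (Suc k)) * f (Suc k) - (a + b + of_nat (Suc k)) * (x * f k)"
      by (simp add: Suc algebra_simps)
    also have "\<dots> = t a b c n"
      unfolding 2 3 Suc 1 by (simp add: diff_divide_distrib[symmetric] algebra_simps)
    finally show ?thesis ..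
  qed
  then have "t a b c = (\<lambda>n. c * f n + of_nat n * f n - g n)"
    by auto
  moreover have "(\<lambda>n. c * f n + of_nat n * f n - g n) sums (c * S + E - x * ((a + b + 1) * S + E))"
    by (intro sums_diff sums_add sums_mult f nf g)
  ultimately have "regularized_hyp2F1 a b c x = c * S + E - x * ((a + b + 1) * S + E)"
    unfolding F by (simp add: sums_iff)
  also have "\<dots> = (c - (a + b + 1) * x) * S + (1 - x) * E"
    by (simp add: algebra_simps)
  also have "S = regularized_hyp2F1 (a + 1) (b + 1) (c + 1) x"
    by (simp add: F S_def f_def)
  finally show ?thesis
    unfolding E_eq[symmetric] by (simp only: mult_ac)
qed


section \<open>The coefficients alpha_R\<close>

lemma alpha_exp_factor:
  "exp (- (1 / 4) * pi * u + 1 / 4 * (1 - of_nat R) * pi * \<i>) =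
     of_real (exp (- (pi * u / 4))) * cis ((1 - real R) * (pi / 4))"
  unfolding exp_add by (simp add: cis_conv_exp mult_ac flip: exp_of_real)

text \<open>At x = 1/2 the coefficient c - (a+b+1)/2 is -iu/4 for every R. Raising R by 2 multiplies
  the prefactor by -8i, so the coefficients become (-8i)(-iu/4) = -2u and (-8i)^2 R(R-1)/16 =
  -4R(R-1).\<close>

lemma alpha_recursion:
  "alpha (R + 2) u = - 2 * of_real u * alpha R u - 4 * of_nat R * of_nat (R - 1) * alpha (R - 2) u"
proof -
  define hyp where "hyp = (\<lambda>R::nat. regularized_hyp2F1 (1 / 2 - 1 / 2 * of_nat R) (- (1 / 2) * of_nat R)
       (3 / 4 - 1 / 2 * of_nat R - 1 / 4 * \<i> * u) (1 / 2))"
  define pref where "pref = (\<lambda>R::nat. of_real (sqrt pi) *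
     (of_real (exp (- (pi * u / 4))) * cis ((1 - real R) * (pi / 4))) *
     2 powr (3 / 2 * of_nat R + 1 / 4 + 1 / 4 * \<i> * u) *
     Gamma (1 / 2 - 1 / 2 * \<i> * u))"
  have alpha: "alpha R u = pref R * hyp R" for R
    by (simp only: alpha_def alpha_exp_factor pref_def hyp_def)
  have pref: "pref (R + 2) = - 8 * \<i> * pref R" for R
  proof -
    have "(1 - real (R + 2)) * (pi / 4) = (1 - real R) * (pi / 4) + - (pi / 2)"
      by (simp add: field_simps)
    then have cis: "cis ((1 - real (R + 2)) * (pi / 4)) = cis ((1 - real R) * (pi / 4)) * (- \<i>)"
      by (simp only: cis_mult[symmetric]) (simp add: complex_eq_iff)
    have "3 / 2 * of_nat (R + 2) + 1 / 4 + 1 / 4 * \<i> * of_real u = (3 / 2 * of_nat R + 1 / 4 + 1 / 4 * \<i> * complex_of_real u) + of_nat 3"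
      by (simp add: field_simps)
    moreover have "(2::complex) powr (x + of_nat 3) = 8 * 2 powr x" for x
      unfolding powr_add by (simp add: powr_nat[of "2::complex" 3, simplified])
    ultimately have "2 powr (3 / 2 * of_nat (R + 2) + 1 / 4 + 1 / 4 * \<i> * of_real u) = 8 * 2 powr (3 / 2 * of_nat R + 1 / 4 + 1 / 4 * \<i> * complex_of_real u)"
      by (simp only:)
    then show ?thesis
      unfolding pref_def cis by (simp only:) (simp add: mult_ac)
  qed
  \<comment> \<open>Parameters for R + 2: adding 1 gives those for R, adding 2 those for R - 2. By
    the parity of R, one of a + 1 and b + 1 is a nonpositive integer.\<close>
  define a b c where "a = 1 / 2 - 1 / 2 * complex_of_nat (R + 2)" and "b = - (1 / 2) * complex_of_nat (R + 2)"
    and "c = 3 / 4 - 1 / 2 * of_nat (R + 2) - 1 / 4 * \<i> * complex_of_real u"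
  have "\<exists>m. a + 1 = - of_nat m \<or> b + 1 = - of_nat m"
  proof (cases "even R")
    case True
    then obtain m where "R = 2 * m"
      by (elim evenE)
    then have "b + 1 = - of_nat m"
      by (simp add: b_def field_simps)
    then show ?thesis
      by blast
  next
    case False
    then obtain m where "R = 2 * m + 1"
      by (elim oddE)
    then have "a + 1 = - of_nat m"
      by (simp add: a_def field_simps)
    then show ?thesis
      by blast
  qed
  then obtain m where m: "a + 1 = - of_nat m \<or> b + 1 = - of_nat m"
    by blast
  have ab: "(a + 1) * (b + 1) = of_nat R * of_nat (R - 1) / 4"
    by (cases R) (simp_all add: a_def b_def field_simps)
  have cab: "c - (a + b + 1) * (1 / 2) = - (1 / 4) * \<i> * of_real u"
    by (simp add: a_def b_def c_def field_simps)
  have hyp_Suc2: "hyp (R + 2) = regularized_hyp2F1 a b c (1 / 2)"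
    by (simp only: hyp_def a_def b_def c_def)
  have "a + 1 = 1 / 2 - 1 / 2 * of_nat R" "b + 1 = - (1 / 2) * of_nat R" "c + 1 = 3 / 4 - 1 / 2 * of_nat R - 1 / 4 * \<i> * of_real u"
    by (simp_all add: a_def b_def c_def field_simps)
  then have hyp_R: "regularized_hyp2F1 (a + 1) (b + 1) (c + 1) (1 / 2) = hyp R"
    by (simp only: hyp_def)
  \<comment> \<open>For R < 2 the truncated R - 2 does not give these parameters, but then R(R-1) =
    0.\<close>
  have hyp_R2: "of_nat R * of_nat (R - 1) * regularized_hyp2F1 (a + 2) (b + 2) (c + 2) (1 / 2) = of_nat R * of_nat (R - 1) * hyp (R - 2)"
  proof (cases "R < 2")
    case True
    then have "of_nat R * of_nat (R - 1) = (0::complex)"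
      by (cases R) auto
    then show ?thesis
      by (simp only: mult_zero_left)
  next
    case False
    then obtain k where k: "R = k + 2"
      by (metis add.commute le_Suc_ex not_less)
    have "a + 2 = 1 / 2 - 1 / 2 * of_nat k" "b + 2 = - (1 / 2) * of_nat k" "c + 2 = 3 / 4 - 1 / 2 * of_nat k - 1 / 4 * \<i> * of_real u"
      by (simp_all add: a_def b_def c_def k field_simps)
    then have "regularized_hyp2F1 (a + 2) (b + 2) (c + 2) (1 / 2) = hyp k"
      by (simp only: hyp_def)
    then show ?thesis
      by (simp add: k)
  qed
  have hyp_eq: "hyp (R + 2) = - (1 / 4) * \<i> * of_real u * hyp R + 1 / 16 * (of_nat R * of_nat (R - 1) * hyp (R - 2))"
    unfolding hyp_R2[symmetric] hyp_Suc2 regularized_hyp2F1_contiguous[OF m] cab ab hyp_R by simp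
  have pref_R2: "of_nat R * of_nat (R - 1) * pref R = of_nat R * of_nat (R - 1) * (- 8 * \<i> * pref (R - 2))"
  proof (cases "R < 2")
    case True
    then have "of_nat R * of_nat (R - 1) = (0::complex)"
      by (cases R) auto
    then show ?thesis
      by (simp only: mult_zero_left)
  next
    case False
    then have "pref R = - 8 * \<i> * pref (R - 2)"
      using pref[of "R - 2"] by (metis le_add_diff_inverse2 not_less)
    then show ?thesis
      by (simp only:)
  qed
  have "alpha (R + 2) u = - 2 * of_real u * (pref R * hyp R) - \<i> / 2 * (of_nat R * of_nat (R - 1) * pref R) * hyp (R - 2)"
    unfolding alpha pref hyp_eq by (simp add: algebra_simps)
  also have "\<dots> = - 2 * of_real u * alpha R u - 4 * of_nat R * of_nat (R - 1) * alpha (R - 2) u"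
    unfolding pref_R2 alpha by (simp add: algebra_simps)
  finally show ?thesis .
qed

text \<open>For R = 0 and R = 1 an upper parameter is 0 and the series is 1/Gamma(c), which cancels
  against the Gamma value in W_0'(0) or W_0(0). That the products are real is what starts the
  conjugate formula.\<close>

lemma alpha_base:
  "alpha 0 u * pcW0' u 0 = - of_real (sqrt pi) * of_real (exp (- (pi * u / 4)))"
  "alpha 1 u * pcW0 u 0 = 2 * of_real (sqrt pi) * of_real (exp (- (pi * u / 4)))"
proof -
  define b where "b = 1 / 2 - \<i> * of_real u / 2"
  define h where "h = 2 powr (b / 2)"
  define r where "r = complex_of_real (sqrt 2)"
  define e where "e = complex_of_real (exp (- (pi * u / 4)))"
  have r_eq: "r = 2 powr (1 / 2)"
    unfolding r_def using powr_of_real[of 2 "1 / 2"] by (simp add: powr_half_sqrt)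
  have r2: "r * r = 2"
    by (simp add: r_def flip: of_real_mult)
  note K = Gamma_constants(1-7)[OF b_def h_def]
  note V = pcW_0_values(1-4)[OF b_def h_def]
  have hyp: "regularized_hyp2F1 x 0 c y = rGamma c" "regularized_hyp2F1 0 x c y = rGamma c" for x c y
  proof -
    have "(\<Sum>s. pochhammer x s * pochhammer 0 s * y ^ s * rGamma (c + of_nat s) / fact s) =
      (\<Sum>s\<in>{0}. pochhammer x s * pochhammer 0 s * y ^ s * rGamma (c + of_nat s) / fact s)"
      "(\<Sum>s. pochhammer 0 s * pochhammer x s * y ^ s * rGamma (c + of_nat s) / fact s) =
      (\<Sum>s\<in>{0}. pochhammer 0 s * pochhammer x s * y ^ s * rGamma (c + of_nat s) / fact s)"
      by (rule suminf_finite; simp add: pochhammer_0_left)+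
    then show "regularized_hyp2F1 x 0 c y = rGamma c" "regularized_hyp2F1 0 x c y = rGamma c"
      by (simp_all add: regularized_hyp2F1_def)
  qed
  have G: "Gamma (1 / 2 - 1 / 2 * \<i> * of_real u) = Gamma b"
    by (simp add: b_def)
  have alpha0: "alpha 0 u = of_real (sqrt pi) * (e * cis (pi / 4)) * (r / h) * Gamma b * rGamma ((b + 1) / 2)"
  proof -
    have "of_real (exp (- (pi * u / 4))) * cis ((1 - real 0) * (pi / 4)) = e * cis (pi / 4)"
      by (simp add: e_def)
    moreover have "2 powr (3 / 2 * of_nat 0 + 1 / 4 + 1 / 4 * \<i> * of_real u) = r / h"
    proof -
      have "3 / 2 * of_nat 0 + 1 / 4 + 1 / 4 * \<i> * of_real u = 1 / 2 - b / 2"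
        by (simp add: b_def field_simps)
      then show ?thesis
        by (simp only: powr_diff r_eq h_def)
    qed
    moreover have "3 / 4 - 1 / 2 * of_nat 0 - 1 / 4 * \<i> * of_real u = (b + 1) / 2"
      by (simp add: b_def field_simps)
    ultimately show ?thesis
      unfolding alpha_def alpha_exp_factor G by (simp only: of_nat_0 mult_zero_right hyp mult.assoc)
  qed
  have "alpha 0 u * pcW0' u 0 = - of_real (sqrt pi) * e * (cis (pi / 4) * cis (- (pi / 4))) * (r * r) / 2"
    unfolding alpha0 V(2) r_def[symmetric] using K by (simp add: rGamma_inverse_Gamma field_simps)
  then show "alpha 0 u * pcW0' u 0 = - of_real (sqrt pi) * of_real (exp (- (pi * u / 4)))"
    unfolding r2 cis_pi_4_power by (simp add: e_def)
  have alpha1: "alpha 1 u = of_real (sqrt pi) * e * (4 / h) * Gamma b * rGamma (b / 2)"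
  proof -
    have "of_real (exp (- (pi * u / 4))) * cis ((1 - real 1) * (pi / 4)) = e"
      by (simp add: e_def)
    moreover have "2 powr (3 / 2 * of_nat 1 + 1 / 4 + 1 / 4 * \<i> * of_real u) = 4 / h"
    proof -
      have "3 / 2 * of_nat 1 + 1 / 4 + 1 / 4 * \<i> * of_real u = of_nat 2 - b / 2"
        by (simp add: b_def field_simps)
      moreover have "(2::complex) powr of_nat 2 = 4"
        using powr_nat[of "2::complex" 2] by simp
      ultimately show ?thesis
        by (simp only: powr_diff h_def)
    qed
    moreover have "3 / 4 - 1 / 2 * of_nat 1 - 1 / 4 * \<i> * of_real u = b / 2"
      by (simp add: b_def field_simps)
    moreover have "1 / 2 - 1 / 2 * of_nat 1 = (0::complex)"
      by simp
    ultimately show ?thesis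
      unfolding alpha_def alpha_exp_factor G by (simp only: hyp mult.assoc)
  qed
  then show "alpha 1 u * pcW0 u 0 = 2 * of_real (sqrt pi) * of_real (exp (- (pi * u / 4)))"
    unfolding alpha1 V(1) e_def[symmetric] using K by (simp add: rGamma_inverse_Gamma field_simps)
qed

text \<open>Conjugation exchanges the parameters iu/2 and -iu/2 and the two rotations. The data at 0
  suffice, because \<open>alpha_base\<close> involves nothing else.\<close>

lemma cnj_pcW_0: "cnj (pcW0 u 0) = pcW3 u 0" "cnj (pcW0' u 0) = pcW3' u 0"
proof -
  define a where "a = \<i> * complex_of_real u / 2"
  have "cnj (gauss_moment (1 / 2) b) = gauss_moment (1 / 2) (cnj b)" for b
    by (simp add: gauss_moment_def powr_def cnj_Gamma exp_cnj Ln_of_real[of "1 / 2", simplified])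
  moreover have "cnj (- a + 1 / 2) = a + 1 / 2" "cnj (- a + 3 / 2) = a + 3 / 2"
    by (simp_all add: a_def)
  moreover have "Re a > -1/2" "Re (- a) > -1/2"
    by (simp_all add: a_def)
  ultimately have "cnj (pcU (- a) 0) = pcU a 0" "cnj (pcU' (- a) 0) = pcU' a 0"
    by (simp_all only: pcU_0 complex_cnj_divide complex_cnj_minus cnj_Gamma)
  then show "cnj (pcW0 u 0) = pcW3 u 0" "cnj (pcW0' u 0) = pcW3' u 0"
    by (simp_all add: pcW0_def pcW3_def pcW0'_def pcW3'_def a_def cis_cnj)
qed

lemma c3_mult_alpha:
  "c3 u * alpha R u = \<i> * of_real (exp (- (pi * u / 4))) *
     ((\<i> * of_real (exp (- (pi * u / 2))) - (-1) ^ R) * moment0 u R - c3 u * moment3 u R)"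
  (is "_ = ?T R")
proof (induction R rule: less_induct)
  case (less R)
  define e where "e = \<i> * complex_of_real (exp (- (pi * u / 2)))"
  define E where "E = complex_of_real (exp (- (pi * u / 4)))"
  define s where "s = complex_of_real (sqrt pi)"
  note nz = pcW_0_values(5-8)[OF refl refl, of u]
  consider "R = 0" | "R = 1" | k where "R = k + 2"
    by (metis One_nat_def add_2_eq_Suc' not0_implies_Suc)
  then show ?case
  proof cases
    case 1
    \<comment> \<open>Multiplying by W_0'(0) lets \<open>c3_connection\<close> trade (e - 1) W_0'(0)
      for c_3 W_3'(0), so c_3 comes out as a factor and \<open>moment_combination\<close> applies.
      The case R = 1 uses W_0(0) in the same way.\<close>
    have "(\<i> * E * ((e - 1) * moment0 u 0 - c3 u * moment3 u 0)) * pcW0' u 0 =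
      \<i> * E * (((e - 1) * pcW0' u 0) * moment0 u 0 - c3 u * (pcW0' u 0 * moment3 u 0))"
      by (simp add: algebra_simps)
    also have "\<dots> = \<i> * E * c3 u * (pcW3' u 0 * moment0 u 0 - pcW0' u 0 * moment3 u 0)"
      unfolding e_def c3_connection(2)[symmetric] by (simp add: algebra_simps)
    also have "\<dots> = c3 u * (alpha 0 u * pcW0' u 0)"
      unfolding moment_combination alpha_base E_def[symmetric] by (simp add: mult_ac)
    finally have "\<i> * E * ((e - 1) * moment0 u 0 - c3 u * moment3 u 0) = c3 u * alpha 0 u"
      using nz(2) by (simp only: mult.assoc[symmetric] mult_cancel_right) blast
    then show ?thesis
      by (simp only: 1 e_def E_def power_0)
  next
    case 2
    have "(\<i> * E * ((1 + e) * moment0 u 1 - c3 u * moment3 u 1)) * pcW0 u 0 =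
      \<i> * E * (((1 + e) * pcW0 u 0) * moment0 u 1 - c3 u * (pcW0 u 0 * moment3 u 1))"
      by (simp add: algebra_simps)
    also have "\<dots> = \<i> * E * c3 u * (pcW3 u 0 * moment0 u 1 - pcW0 u 0 * moment3 u 1)"
      unfolding e_def c3_connection(1)[symmetric] by (simp add: algebra_simps)
    also have "\<dots> = c3 u * (alpha 1 u * pcW0 u 0)"
      unfolding moment_combination alpha_base E_def[symmetric] by (simp add: mult_ac)
    finally have "\<i> * E * ((1 + e) * moment0 u 1 - c3 u * moment3 u 1) = c3 u * alpha 1 u"
      using nz(1) by (simp only: mult.assoc[symmetric] mult_cancel_right) blast
    moreover have "1 + e = e - (-1) ^ 1"
      by simp
    ultimately show ?thesis
      by (simp only: 2 e_def E_def)
  next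
    case 3
    define n where "n = of_nat k * of_nat (k - 1) * complex_of_real 4"
    define B0 where "B0 = (if k = 0 then pcW0' u 0 else if k = 1 then - pcW0 u 0 else 0)"
    define B3 where "B3 = (if k = 0 then pcW3' u 0 else if k = 1 then - pcW3 u 0 else 0)"
    have rec: "alpha R u = - 2 * of_real u * alpha k u - n * alpha (k - 2) u"
      "moment0 u R = - 2 * of_real u * moment0 u k - n * moment0 u (k - 2) - 4 * B0"
      "moment3 u R = - 2 * of_real u * moment3 u k - n * moment3 u (k - 2) - 4 * B3"
      using alpha_recursion[of k u] moment0_recursion[of u k] moment3_recursion[of u k]
      unfolding 3 n_def B0_def B3_def by simp_all
    have IH: "c3 u * alpha k u = \<i> * E * ((e - (-1) ^ k) * moment0 u k - c3 u * moment3 u k)"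
      using less.IH[of k] 3 by (simp add: e_def E_def)
    \<comment> \<open>For k < 2 the truncated index k - 2 is harmless because n = 0.\<close>
    have IH': "n * (c3 u * alpha (k - 2) u) = n * (\<i> * E * ((e - (-1) ^ k) * moment0 u (k - 2) - c3 u * moment3 u (k - 2)))"
    proof (cases "k < 2")
      case True
      then have "n = 0"
        by (cases k) (auto simp: n_def)
      then show ?thesis
        by simp
    next
      case False
      then have "(-1) ^ (k - 2) = ((-1) ^ k :: complex)"
        by (simp add: uminus_power_if)
      then show ?thesis
        using less.IH[of "k - 2"] 3 by (simp add: e_def E_def)
    qed
    \<comment> \<open>For k = 0 and k = 1 this is the derivative and the value part of
      \<open>c3_connection\<close>; beyond that both terms are 0.\<close>
    have B: "(e - (-1) ^ k) * B0 - c3 u * B3 = 0"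
      using c3_connection[of u] by (auto simp: B0_def B3_def e_def algebra_simps)
    have "c3 u * alpha R u = - 2 * of_real u * (c3 u * alpha k u) - n * (c3 u * alpha (k - 2) u)"
      unfolding rec by (simp add: algebra_simps)
    also have "\<dots> = \<i> * E * ((e - (-1) ^ k) * moment0 u R - c3 u * moment3 u R) + 4 * \<i> * E * ((e - (-1) ^ k) * B0 - c3 u * B3)"
      unfolding IH IH' rec by (simp add: algebra_simps)
    finally show ?thesis
      unfolding B using 3 by (simp add: e_def E_def)
  qed
qed

lemma alpha_mult_c3:
  "alpha R u * c3 u = ((-1) ^ (R + 1) + \<i> * of_real (exp (- (pi * u / 2)))) * cnj (alpha R u)"
proof (induction R rule: less_induct)
  case (less R)
  define e where "e = \<i> * complex_of_real (exp (- (pi * u / 2)))"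
  note nz = pcW_0_values(5-8)[OF refl refl, of u]
  consider "R = 0" | "R = 1" | k where "R = k + 2"
    by (metis One_nat_def add_2_eq_Suc' not0_implies_Suc)
  then show ?case
  proof cases
    case 1
    \<comment> \<open>The right-hand side of \<open>alpha_base\<close> is real, so conjugation moves
      from W_0'(0) to W_3'(0) without changing it.\<close>
    have "cnj (alpha 0 u) * pcW3' u 0 = cnj (alpha 0 u * pcW0' u 0)"
      by (simp add: cnj_pcW_0)
    also have "\<dots> = alpha 0 u * pcW0' u 0"
      unfolding alpha_base by simp
    finally have cnj: "cnj (alpha 0 u) * pcW3' u 0 = alpha 0 u * pcW0' u 0" .
    have "(alpha 0 u * c3 u) * pcW3' u 0 * pcW0' u 0 = (alpha 0 u * pcW0' u 0) * (c3 u * pcW3' u 0)"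
      by (simp only: mult_ac)
    also have "\<dots> = ((e - 1) * cnj (alpha 0 u)) * pcW3' u 0 * pcW0' u 0"
      unfolding cnj[symmetric] c3_connection e_def by (simp only: mult_ac)
    finally have "alpha 0 u * c3 u = (e - 1) * cnj (alpha 0 u)"
      using nz by simp
    then show ?thesis
      by (simp add: 1 e_def)
  next
    case 2
    have "cnj (alpha 1 u) * pcW3 u 0 = cnj (alpha 1 u * pcW0 u 0)"
      by (simp add: cnj_pcW_0)
    also have "\<dots> = alpha 1 u * pcW0 u 0"
      unfolding alpha_base by simp
    finally have cnj: "cnj (alpha 1 u) * pcW3 u 0 = alpha 1 u * pcW0 u 0" .
    have "(alpha 1 u * c3 u) * pcW3 u 0 * pcW0 u 0 = (alpha 1 u * pcW0 u 0) * (c3 u * pcW3 u 0)"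
      by (simp only: mult_ac)
    also have "\<dots> = ((1 + e) * cnj (alpha 1 u)) * pcW3 u 0 * pcW0 u 0"
      unfolding cnj[symmetric] c3_connection e_def by (simp only: mult_ac)
    finally have "alpha 1 u * c3 u = (1 + e) * cnj (alpha 1 u)"
      using nz by simp
    then show ?thesis
      by (simp add: 2 e_def)
  next
    case 3
    define n where "n = complex_of_real (of_nat k * of_nat (k - 1) * 4)"
    have rec: "alpha R u = - 2 * of_real u * alpha k u - n * alpha (k - 2) u"
      using alpha_recursion[of k u] unfolding 3 n_def by simp
    have n: "cnj n = n"
      by (simp add: n_def)
    have IH: "alpha k u * c3 u = ((-1) ^ (k + 1) + e) * cnj (alpha k u)"
      using less.IH[of k] 3 by (simp add: e_def)
    have IH': "n * (alpha (k - 2) u * c3 u) = n * (((-1) ^ (k + 1) + e) * cnj (alpha (k - 2) u))"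
    proof (cases "k < 2")
      case True
      then have "n = 0"
        by (cases k) (auto simp: n_def)
      then show ?thesis
        by simp
    next
      case False
      then have "(-1) ^ (k - 2) = ((-1) ^ k :: complex)"
        by (simp add: uminus_power_if)
      then show ?thesis
        using less.IH[of "k - 2"] 3 by (simp add: e_def)
    qed
    have "alpha R u * c3 u = - 2 * of_real u * (alpha k u * c3 u) - n * (alpha (k - 2) u * c3 u)"
      unfolding rec by (simp add: algebra_simps)
    also have "\<dots> = ((-1) ^ (k + 1) + e) * cnj (alpha R u)"
      unfolding IH IH' rec by (simp add: n algebra_simps)
    finally show ?thesis
      using 3 by (simp add: e_def)
  qed
qed

section \<open>The connection formula\<close>

lemma c3_pcW3:
  "c3 u * pcW3 u z = pcW0 u (- z) + \<i> * of_real (exp (- (pi * u / 2))) * pcW0 u z"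
proof -
  define e where "e = \<i> * complex_of_real (exp (- (pi * u / 2)))"
  note ode0 = pcW_ode(1)[of u] and ode3 = pcW_ode(2)[of u]
  have ode0': "ode_solution (\<lambda>z. - (z\<^sup>2 / 4 + of_real u / 2)) (\<lambda>z. pcW0 u (- z)) (\<lambda>z. - pcW0' u (- z))"
    by (rule ode_solution_reflect[OF ode0]) simp
  define p q where "p = pcW0 u 0" and "q = pcW0' u 0"
  \<comment> \<open>Expansion of W_3 in the basis W_0(z), W_0(-z) with coefficients from the data at
    0, multiplied by c_3 so that \<open>c3_connection\<close> can be inserted.\<close>
  have "c3 u * (pcW3 u z * (p * - q - q * p)) =
      pcW0 u z * (c3 u * pcW3 u 0 * - q - c3 u * pcW3' u 0 * p) - pcW0 u (- z) * (c3 u * pcW3 u 0 * q - c3 u * pcW3' u 0 * p)"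
  proof -
    have "pcW3 u z * (p * - q - q * p) =
        pcW0 u z * (pcW3 u 0 * - q - pcW3' u 0 * p) - pcW0 u (- z) * (pcW3 u 0 * q - pcW3' u 0 * p)"
      using ode_solution_expand[OF ode3 ode0 ode0', of z 0] by (simp only: minus_zero p_def q_def)
    then have "c3 u * (pcW3 u z * (p * - q - q * p)) = 
        c3 u * (pcW0 u z * (pcW3 u 0 * - q - pcW3' u 0 * p) - pcW0 u (- z) * (pcW3 u 0 * q - pcW3' u 0 * p))"
      by (rule arg_cong)
    then show ?thesis
      by (simp only: right_diff_distrib mult_ac)
  qed
  also have "\<dots> = - (2 * p * q) * (pcW0 u (- z) + e * pcW0 u z)"
    unfolding c3_connection by (simp add: e_def p_def q_def algebra_simps)
  finally have "- (2 * p * q) * (c3 u * pcW3 u z) = - (2 * p * q) * (pcW0 u (- z) + e * pcW0 u z)"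
    by (simp add: algebra_simps)
  then show ?thesis
    using pcW_0_values(5,6)[OF refl refl, of u] by (simp add: p_def q_def e_def)
qed

text \<open>Both integrals from infinity are split at 0; the pieces along the rays are the moments
  and do not depend on z.\<close>

lemma WR03_eq:
  "WR03 R (- u / 2) z = \<i> * of_real (exp (- (pi * u / 4))) *
     (pcW3 u z * (moment0 u R + contour_integral (linepath 0 z) (\<lambda>t. t ^ R * pcW0 u t))
      - pcW0 u z * (moment3 u R + contour_integral (linepath 0 z) (\<lambda>t. t ^ R * pcW3 u t)))"
proof -
  have hol: "(\<lambda>t. t ^ R * pcW0 u t) holomorphic_on UNIV" "(\<lambda>t. t ^ R * pcW3 u t) holomorphic_on UNIV"
  proof -
    have "pcW0 u holomorphic_on UNIV" "pcW3 u holomorphic_on UNIV"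
      using pcW_ode[of u] unfolding ode_solution_def by (auto simp: holomorphic_on_open)
    then show "(\<lambda>t. t ^ R * pcW0 u t) holomorphic_on UNIV" "(\<lambda>t. t ^ R * pcW3 u t) holomorphic_on UNIV"
      by (auto intro!: holomorphic_intros)
  qed
  have "exp (complex_of_real pi * \<i> / 4) = cis (pi / 4)" "exp (- (complex_of_real pi * \<i> / 4)) = cis (- (pi / 4))"
    by (simp_all add: cis_conv_exp mult.commute)
  moreover have "pi * (- u / 2) / 2 = - (pi * u / 4)"
    by simp
  ultimately show ?thesis
    unfolding WR03_def W_eq_pcW
    by (simp only: integral_from_infinity_eq[OF hol(1) ray_limit_pcW0] integral_from_infinity_eq[OF hol(2) ray_limit_pcW3] exp_of_real)
qed


text \<open>The relation for c_3 W_3, multiplied by t^R and integrated from 0; replacing t by -t in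
  the reflected term produces (-1)^(R+1).\<close>

lemma c3_contour_integral_pcW3:
  "c3 u * contour_integral (linepath 0 z) (\<lambda>t. t ^ R * pcW3 u t) =
     (-1) ^ (R + 1) * contour_integral (linepath 0 (- z)) (\<lambda>t. t ^ R * pcW0 u t)
     + \<i> * of_real (exp (- (pi * u / 2))) * contour_integral (linepath 0 z) (\<lambda>t. t ^ R * pcW0 u t)"
proof -
  define e where "e = \<i> * complex_of_real (exp (- (pi * u / 2)))"
  define s :: complex where "s = (-1) ^ (R + 1)"
  have "pcW0 u holomorphic_on UNIV"
    using pcW_ode(1)[of u] unfolding ode_solution_def by (auto simp: holomorphic_on_open)
  then have "(\<lambda>t. t ^ R * pcW0 u t) holomorphic_on UNIV"
    by (auto intro!: holomorphic_intros)
  then obtain F where F: "\<And>t. (F has_field_derivative t ^ R * pcW0 u t) (at t)"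
    using entire_primitive by blast
  define G where "G = (\<lambda>t. (s * F (- t) + e * F t) / c3 u)"
  have G: "(G has_field_derivative t ^ R * pcW3 u t) (at t)" for t
  proof -
    have neg: "(uminus has_field_derivative - 1) (at t)"
      by (auto intro!: derivative_eq_intros)
    have "(G has_field_derivative (s * ((- t) ^ R * pcW0 u (- t) * - 1) + e * (t ^ R * pcW0 u t)) / c3 u) (at t)"
      unfolding G_def by (intro DERIV_cdivide DERIV_add DERIV_cmult DERIV_chain2[OF F neg] F)
    also have "s * ((- t) ^ R * pcW0 u (- t) * - 1) = (s * ((-1) ^ R * - 1)) * (t ^ R * pcW0 u (- t))"
      unfolding power_minus[of t R] by (simp only: mult_ac)
    also have "s * ((-1) ^ R * - 1) = 1"
      by (cases "even R") (auto simp: s_def)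
    also have "(1 * (t ^ R * pcW0 u (- t)) + e * (t ^ R * pcW0 u t)) / c3 u = t ^ R * (c3 u * pcW3 u t) / c3 u"
      unfolding c3_pcW3 e_def by (simp add: algebra_simps)
    also have "\<dots> = t ^ R * pcW3 u t"
      using c3_nonzero by simp
    finally show ?thesis .
  qed
  have "c3 u * contour_integral (linepath 0 z) (\<lambda>t. t ^ R * pcW3 u t) = s * (F (- z) - F 0) + e * (F z - F 0)"
    unfolding contour_integral_linepath_primitive(2)[OF G] G_def using c3_nonzero by (simp add: field_simps)
  then show ?thesis
    unfolding contour_integral_linepath_primitive(2)[OF F] by (simp only: s_def e_def)
qed

text \<open>After multiplication by c_3 both sides are polynomials in W_0(z), W_0(-z), the moments
  and the integrals of t^R W_0 from 0 to z and to -z. The \<epsilon> multiples of these integrals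
  cancel, and the moments match by the value of c_3 alpha_R.\<close>

lemma WR03_connection:
  "WR03 R (- u / 2) z = (-1) ^ R * WR03 R (- u / 2) (- z)
     + ((-1) ^ (R + 1) - \<i> * of_real (exp (- (pi * u / 2)))) * alpha R u * pcW0 u (- z)
     + alpha R u * c3 u * pcW3 u (- z)"
proof -
  define e where "e = \<i> * complex_of_real (exp (- (pi * u / 2)))"
  define \<kappa> where "\<kappa> = \<i> * complex_of_real (exp (- (pi * u / 4)))"
  define s :: complex where "s = (-1) ^ R"
  define X Y where "X = pcW0 u z" and "Y = pcW0 u (- z)"
  define I0 I3 where "I0 = moment0 u R" and "I3 = moment3 u R"
  define Jp Jm where "Jp = contour_integral (linepath 0 z) (\<lambda>t. t ^ R * pcW0 u t)"
    and "Jm = contour_integral (linepath 0 (- z)) (\<lambda>t. t ^ R * pcW0 u t)"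
  define c where "c = c3 u"
  have ss: "s * s = 1"
    by (simp add: s_def flip: power_mult_distrib)
  have W3: "c * pcW3 u z = Y + e * X" "c * pcW3 u (- z) = X + e * Y"
    using c3_pcW3[of u z] c3_pcW3[of u "- z"] by (simp_all only: X_def Y_def e_def c_def minus_minus)
  have J3: "c * contour_integral (linepath 0 z) (\<lambda>t. t ^ R * pcW3 u t) = - s * Jm + e * Jp"
    "c * contour_integral (linepath 0 (- z)) (\<lambda>t. t ^ R * pcW3 u t) = - s * Jp + e * Jm"
    using c3_contour_integral_pcW3[of u z R] c3_contour_integral_pcW3[of u "- z" R]
    by (simp_all add: Jp_def Jm_def e_def c_def s_def)
  have \<Phi>: "c * WR03 R (- u / 2) z = \<kappa> * ((Y + e * X) * (I0 + Jp) - X * (c * I3 + (- s * Jm + e * Jp)))"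
    "c * WR03 R (- u / 2) (- z) = \<kappa> * ((X + e * Y) * (I0 + Jm) - Y * (c * I3 + (- s * Jp + e * Jm)))"
  proof -
    have "c * (\<kappa> * (w3 * (i0 + j0) - w0 * (i3 + j3))) = \<kappa> * ((c * w3) * (i0 + j0) - w0 * (c * i3 + c * j3))"
      for w3 w0 i0 i3 j0 j3
      by (simp add: algebra_simps)
    then show "c * WR03 R (- u / 2) z = \<kappa> * ((Y + e * X) * (I0 + Jp) - X * (c * I3 + (- s * Jm + e * Jp)))"
      "c * WR03 R (- u / 2) (- z) = \<kappa> * ((X + e * Y) * (I0 + Jm) - Y * (c * I3 + (- s * Jp + e * Jm)))"
      by (simp_all only: WR03_eq \<kappa>_def[symmetric] W3 J3 I0_def I3_def Jp_def Jm_def X_def Y_def)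
  qed
  have \<alpha>: "c * alpha R u = \<kappa> * ((e - s) * I0 - c * I3)"
    using c3_mult_alpha[of u R] by (simp only: c_def \<kappa>_def e_def s_def I0_def I3_def)
  \<comment> \<open>\<open>d\<close> stands for c I3. The only relation used is s^2 = 1, so the two
    signs are checked separately.\<close>
  have alg: "\<kappa> * ((Y + e * X) * (I0 + Jp) - X * (d + (- s * Jm + e * Jp))) =
      s * (\<kappa> * ((X + e * Y) * (I0 + Jm) - Y * (d + (- s * Jp + e * Jm)))) + (- s - e) * (\<kappa> * ((e - s) * I0 - d)) * Y
      + \<kappa> * ((e - s) * I0 - d) * (X + e * Y)" for d
  proof -
    have "s = 1 \<or> s = - 1"
      using ss by (simp add: square_eq_1_iff)
    then show ?thesis
      by (elim disjE; simp add: algebra_simps)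
  qed
  have "c * WR03 R (- u / 2) z = s * (c * WR03 R (- u / 2) (- z)) + (- s - e) * (c * alpha R u) * Y + c * alpha R u * (c * pcW3 u (- z))"
    unfolding \<Phi> \<alpha> W3(2) by (rule alg)
  also have "\<dots> = c * (s * WR03 R (- u / 2) (- z) + (- s - e) * alpha R u * Y + alpha R u * c * pcW3 u (- z))"
    by (simp only: distrib_left mult_ac)
  finally show ?thesis
    using c3_nonzero[of u] by (simp add: c_def s_def e_def Y_def)
qed

theorem mainTheorem15:
  fixes u :: real and R :: nat and z :: complex
  assumes "u > 0"
  shows "WR03 R (- u / 2) (of_real (sqrt (2 * u)) * z) =
           (-1) ^ R * WR03 R (- u / 2) (- (of_real (sqrt (2 * u)) * z))
         + ((-1) ^ (R + 1) - \<i> * exp (- (of_real (pi * u / 2)))) * alpha R u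
             * W 0 (- of_real u / 2) (- (of_real (sqrt (2 * u)) * z))
         + alpha R u * c3 u * W 3 (- of_real u / 2) (- (of_real (sqrt (2 * u)) * z))
       \<and> WR03 R (- u / 2) (of_real (sqrt (2 * u)) * z) =
           (-1) ^ R * WR03 R (- u / 2) (- (of_real (sqrt (2 * u)) * z))
         + ((-1) ^ (R + 1) - \<i> * exp (- (of_real (pi * u / 2)))) * alpha R u
             * W 0 (- of_real u / 2) (- (of_real (sqrt (2 * u)) * z))
         + ((-1) ^ (R + 1) + \<i> * exp (- (of_real (pi * u / 2)))) * cnj (alpha R u)
             * W 3 (- of_real u / 2) (- (of_real (sqrt (2 * u)) * z))"
proof -
  have "- complex_of_real u / 2 = of_real (- u / 2)"
    by simp
  then have W: "W 0 (- of_real u / 2) x = pcW0 u x" "W 3 (- of_real u / 2) x = pcW3 u x" for x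
    by (simp_all only: W_eq_pcW)
  have e: "exp (- complex_of_real (pi * u / 2)) = of_real (exp (- (pi * u / 2)))"
    by (simp only: exp_of_real of_real_minus[symmetric])
  show ?thesis
    \<comment> \<open>\<open>alpha_mult_c3\<close> read backwards turns the second formula into the
      first.\<close>
    unfolding W e alpha_mult_c3[symmetric] using WR03_connection by blast
qed

end
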